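(* There exists an absolute constant $c_2>0$ such that the following holds. Let $\tau>0$ and let $F=\mathcal{L}(\xi)\in\mathcal{A}_1(\tau)$ be the distribution of a real random variable $\xi$ with $\mathbf{E}\,\xi=0$. Let $\Phi=\Phi_F$ be the normal distribution with mean zero and the same variance as $F$. Then $$W_\psi(F,\Phi)\le c_2\,\tau,$$ with the Orlicz function $\psi(x)=\exp\{|x|\}-1$.
   Context: For $\tau\ge 0$, $\mathcal{A}_1(\tau)$ denotes the class of probability distributions $F$ on $\mathbf{R}$ for which the function $$\varphi(z)=\varphi(F,z)=\log\int_{\mathbf{R}} e^{zx}\,F\{dx\}\qquad(\varphi(0)=0)$$ is defined and analytic for all $z\in\mathbf{C}$ with $|z|\tau<1$, and satisfies $$|\varphi'''(z)|\le \tau\,\sigma^2\qquad\text{for all } z\in\mathbf{C},\ |z|\tau<1,$$ where $\sigma^2$ is the variance of $F$. A normal distribution with variance zero is understood as the degenerate distribution at its mean. $\mathcal{L}(\xi)$ denotes the distribution of $\xi$. For an Orlicz function $\psi$ and probability distributions $G,H$ on $\mathbf{R}$, the Wasserstein distance associated with $\psi$ is $$W_\psi(G,H)=\inf\Big\{a>0:\ \inf_{\pi}\int\psi(|x-y|/a)\,d\pi(x,y)\le 1\Big\},$$ where the inner infimum is taken over all probability distributions $\pi$ on $\mathbf{R}^2$ with marginal distributions $G$ and $H$. An absolute constant is one that does not depend on $\tau$, $F$ or any other parameter. *)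

theory Defs
  imports "HOL-Probability.Probability"
begin

definition laplace_transform :: "real measure \<Rightarrow> complex \<Rightarrow> complex" where
  "laplace_transform F z = (LINT x|F. exp (z * complex_of_real x))"

text \<open>
  The logarithm of the transform is not the principal branch \<^const>\<open>Ln\<close> but the analytic
  branch on the disc (the plane if \<open>\<tau> = 0\<close>) that vanishes at the origin; as the disc is
  connected, such a \<open>\<phi>\<close> is unique there. Integrability is required separately, because the
  Bochner integral is \<open>0\<close> for functions that are not integrable.
\<close>

definition is_log_laplace :: "real \<Rightarrow> real measure \<Rightarrow> (complex \<Rightarrow> complex) \<Rightarrow> bool" where
  "is_log_laplace \<tau> F \<phi> \<longleftrightarrow>
     \<phi> analytic_on {z. norm z * \<tau> < 1} \<and> \<phi> 0 = 0 \<and>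
     (\<forall>z. norm z * \<tau> < 1 \<longrightarrow>
        integrable F (\<lambda>x. exp (z * complex_of_real x)) \<and>
        exp (\<phi> z) = laplace_transform F z)"

definition class_A1 :: "real \<Rightarrow> real measure set" where
  "class_A1 \<tau> = {F. real_distribution F \<and>
     (\<exists>\<phi>. is_log_laplace \<tau> F \<phi> \<and>
        (\<forall>z. norm z * \<tau> < 1 \<longrightarrow>
           norm ((deriv ^^ 3) \<phi> z) \<le> \<tau> * prob_space.variance F (\<lambda>x. x)))}"

text \<open>The second parameter is the variance, whereas \<^const>\<open>normal_density\<close> takes the standard deviation.\<close>

definition normal_distribution :: "real \<Rightarrow> real \<Rightarrow> real measure" where
  "normal_distribution \<mu> v =
     (if v = 0 then return borel \<mu>
      else density lborel (\<lambda>x. ennreal (normal_density \<mu> (sqrt v) x)))"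

definition couplings :: "real measure \<Rightarrow> real measure \<Rightarrow> (real \<times> real) measure set" where
  "couplings G H = {\<pi>. prob_space \<pi> \<and> sets \<pi> = sets (borel \<Otimes>\<^sub>M borel) \<and>
     distr \<pi> borel fst = G \<and> distr \<pi> borel snd = H}"

text \<open>
  The distance is valued in \<^typ>\<open>ennreal\<close>, so that it is infinite (and not an arbitrary real
  number) if there is no admissible \<open>a\<close>. The function \<open>\<psi>\<close> is meant to be nonnegative.
\<close>

definition wasserstein_orlicz ::
    "(real \<Rightarrow> real) \<Rightarrow> real measure \<Rightarrow> real measure \<Rightarrow> ennreal" where
  "wasserstein_orlicz \<psi> G H =
     Inf (ennreal ` {a. a > 0 \<and>
       (INF \<pi>\<in>couplings G H. \<integral>\<^sup>+ (x, y). ennreal (\<psi> (\<bar>x - y\<bar> / a)) \<partial>\<pi>) \<le> 1})"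

end

theory Submission
  imports Defs "HOL-Complex_Analysis.Cauchy_Integral_Formula"
begin

text \<open>
  After rescaling, \<open>\<tau> = 1/8\<close>; write \<open>v\<close> for the variance, \<open>L\<close> for the transform and
  \<open>\<phi> = log L\<close>. The Esscher transform \<open>e\<^bsup>hx\<^esup> F(dx) / L(h)\<close>, centred at its mean \<open>\<phi>'(h)\<close>, has the
  characteristic function \<open>exp (- \<phi>''(h) t\<^sup>2/2 + O(v |t|\<^sup>3))\<close> for \<open>|t| \<le> 2\<close>, so a Berry--Esseen bound of
  order \<open>1/sqrt v\<close> holds for it. Undoing the tilt gives the sandwich
  \<open>P(\<eta> \<ge> vh + \<delta>) \<le> P(\<xi> \<ge> \<phi>'(h)) \<le> P(\<eta> \<ge> vh - \<delta>)\<close> with \<open>\<delta> = O(1 + v h\<^sup>2)\<close>, where \<open>\<eta>\<close> is the normal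
  variable. Hence the quantile coupling satisfies \<open>|\<xi> - \<eta>| = O(1 + \<eta>\<^sup>2/v)\<close> as long as \<open>|\<eta>| \<le> c v\<close>; the
  complementary event has probability \<open>e\<^bsup>-c' v\<^esup>\<close> and is absorbed by the exponential moments of
  \<open>\<xi>\<close> and \<open>\<eta>\<close>. For bounded \<open>v\<close> these moments suffice on their own.
\<close>

section \<open>Kernels with compactly supported Fourier transform\<close>

text \<open>The characteristic function of a tilted law is controlled only for bounded
  \<open>t\<close>, because \<open>h + i t\<close> must stay in the disc of analyticity. Hence the
  kernels with Fourier transform supported in [-2, 2]: they resolve scale 1, while the law has
  spread sqrt v, and the error is 1/sqrt v. Intervals [0, L] are enough, because exp (- h x) on the
  half-line is a mixture of them with weights of total mass 1; so the error does not depend on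
  \<open>h\<close>.

  This error is additive, whereas tails of size exp (- v h^2 / 2) are to be compared. The tilt takes
  that factor out of both tails. What is left of the normal tail changes by at least a multiple of p
  when its threshold moves by a small p, so an additive error of order 1/sqrt v is absorbed by a
  shift of that order, without asymptotics of the Mills ratio. After rescaling by sqrt v this is the
  constant part of \<delta>; the part v h^2 is the cubic error v h^3 of the exponent divided by the
  logarithmic slope h of the tail.

  The term \<eta>^2/v of the coupling is harmless because exp (c \<eta>^2/v) is integrable for c <
  1/2.\<close>

lemma has_bochner_integral_even:
  fixes g :: "real \<Rightarrow> real"
  assumes ev: "\<And>t. g (- t) = g t" and z: "\<And>t. \<bar>t\<bar> > a \<Longrightarrow> g t = 0"
    and meas[measurable]: "g \<in> borel_measurable borel"
    and I: "has_bochner_integral lborel (\<lambda>t. g t * indicator {0..a} t) I"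
  shows "has_bochner_integral lborel g (2 * I)"
proof -
  have "has_bochner_integral lborel (\<lambda>t. g (0 + (-1) * t) * indicator {0..a} (0 + (-1) * t)) (I /\<^sub>R \<bar>-1\<bar>)"
    using I by (subst lborel_has_bochner_integral_real_affine_iff[symmetric]) auto
  with I have "has_bochner_integral lborel
      (\<lambda>t. g t * indicator {0..a} t + g (0 + (-1) * t) * indicator {0..a} (0 + (-1) * t)) (I + I)"
    by (intro has_bochner_integral_add) auto
  moreover have "AE t in lborel. g t * indicator {0..a} t + g (0 + (-1) * t) * indicator {0..a} (0 + (-1) * t) = g t"
    using AE_lborel_singleton[of 0]
  proof eventually_elim
    case (elim t)
    with z[of t] show ?case
      by (cases "\<bar>t\<bar> > a") (auto simp: ev indicator_def)
  qed
  ultimately show ?thesis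
    by (subst (asm) has_bochner_integral_cong_AE) auto
qed

lemma integral_even_iexp:
  fixes k :: "real \<Rightarrow> real"
  assumes ev: "\<And>t. k (- t) = k t" and k: "integrable lborel k"
  shows "(CLINT t|lborel. k t * iexp (t * x)) = complex_of_real (LINT t|lborel. k t * cos (t * x))"
proof -
  have [measurable]: "k \<in> borel_measurable borel" using k by auto
  have c: "integrable lborel (\<lambda>t. k t * cos (t * x))"
    by (rule Bochner_Integration.integrable_bound[OF k]) (auto simp: abs_mult mult_left_le)
  have s: "integrable lborel (\<lambda>t. k t * sin (t * x))"
    by (rule Bochner_Integration.integrable_bound[OF k]) (auto simp: abs_mult mult_left_le)
  have "(LINT t|lborel. k t * sin (t * x)) = (LINT t|lborel. k (-t) * sin (-t * x))"
    using lborel_integral_real_affine[of "-1" "\<lambda>t. k t * sin (t * x)" 0] by simp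
  also have "\<dots> = - (LINT t|lborel. k t * sin (t * x))" by (simp add: ev)
  finally have s0: "(LINT t|lborel. k t * sin (t * x)) = 0" by simp
  have "(CLINT t|lborel. k t * iexp (t * x)) =
     (CLINT t|lborel. complex_of_real (k t * cos (t * x)) + \<i> * complex_of_real (k t * sin (t * x)))"
    by (intro Bochner_Integration.integral_cong refl)
      (simp add: complex_eq_iff Re_exp Im_exp)
  also have "\<dots> = complex_of_real (LINT t|lborel. k t * cos (t * x)) + \<i> * complex_of_real (LINT t|lborel. k t * sin (t * x))"
    using c s
    by (subst Bochner_Integration.integral_add) (auto simp del: of_real_mult simp: integral_complex_of_real)
  finally show ?thesis using s0 by simp
qed

section \<open>Cosine transforms of the tent function and of the cubic B-spline\<close>

lemma integral_tent_cos:
  fixes x :: real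
  assumes "x \<noteq> 0"
  shows "(LINT t|lborel. max 0 (1 - \<bar>t\<bar>) * cos (t * x)) = 2 * (1 - cos x) / x\<^sup>2"
proof -
  let ?F = "\<lambda>t. (1 - t) * sin (t * x) / x - cos (t * x) / x\<^sup>2"
  have "has_bochner_integral lborel (\<lambda>t. ((1 - t) * cos (t * x)) * indicator {0..1} t) (?F 1 - ?F 0)"
    using assms
    by (intro has_bochner_integral_FTC_Icc_real)
       (auto intro!: derivative_eq_intros continuous_intros simp: field_simps power2_eq_square)
  then have "has_bochner_integral lborel
      (\<lambda>t. (max 0 (1 - \<bar>t\<bar>) * cos (t * x)) * indicator {0..1} t) (?F 1 - ?F 0)"
    by (rule has_bochner_integral_cong[THEN iffD1, rotated 3]) (auto simp: indicator_def)
  then have "has_bochner_integral lborel (\<lambda>t. max 0 (1 - \<bar>t\<bar>) * cos (t * x)) (2 * (?F 1 - ?F 0))"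
    by (intro has_bochner_integral_even[where a = 1]) auto
  also have "2 * (?F 1 - ?F 0) = 2 * (1 - cos x) / x\<^sup>2"
    by (simp add: diff_divide_distrib)
  finally show ?thesis
    by (rule has_bochner_integral_integral_eq)
qed

text \<open>Building block of the cubic spline below; \<open>?F\<close> results from three
  integrations by parts.\<close>

lemma integral_truncated_cube_cos:
  fixes x a :: real
  assumes "x \<noteq> 0" "a > 0"
  shows "has_bochner_integral lborel (\<lambda>t. (max 0 (a - \<bar>t\<bar>))^3 * cos (t * x))
    (12 * cos (a * x) / x^4 + 6 * a\<^sup>2 / x\<^sup>2 - 12 / x^4)"
proof -
  let ?F = "\<lambda>t. (a - t)^3 * sin (t * x) / x - 3 * (a - t)^2 * cos (t * x) / x\<^sup>2
     - 6 * (a - t) * sin (t * x) / x^3 + 6 * cos (t * x) / x^4"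
  have D: "(?F has_real_derivative (a - t)^3 * cos (t * x)) (at t)" for t
    using assms(1)
    by (auto intro!: derivative_eq_intros) (simp add: field_simps eval_nat_numeral)
  have "has_bochner_integral lborel (\<lambda>t. ((a - t)^3 * cos (t * x)) * indicator {0..a} t) (?F a - ?F 0)"
    using assms D
    by (intro has_bochner_integral_FTC_Icc_real) (auto intro!: continuous_intros)
  then have "has_bochner_integral lborel
      (\<lambda>t. ((max 0 (a - \<bar>t\<bar>))^3 * cos (t * x)) * indicator {0..a} t) (?F a - ?F 0)"
    by (rule has_bochner_integral_cong[THEN iffD1, rotated 3]) (auto simp: indicator_def)
  then have "has_bochner_integral lborel (\<lambda>t. (max 0 (a - \<bar>t\<bar>))^3 * cos (t * x)) (2 * (?F a - ?F 0))"
    by (intro has_bochner_integral_even[where a = a]) auto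
  also have "2 * (?F a - ?F 0) = 12 * cos (a * x) / x^4 + 6 * a\<^sup>2 / x\<^sup>2 - 12 / x^4"
    by (simp add: field_simps)
  finally show ?thesis .
qed

text \<open>The cubic B-spline with knots -2, ..., 2 in truncated powers, that is, the convolution
  of the tent function with itself. Its transform is therefore the square of that of the tent:
  nonnegative and of order x^-4, while the support grows only to [-2, 2].\<close>

definition cubic_spline :: "real \<Rightarrow> real" where
  "cubic_spline t = ((max 0 (2 - \<bar>t\<bar>))^3 - 4 * (max 0 (1 - \<bar>t\<bar>))^3) / 6"

lemma cubic_spline_measurable[measurable]: "cubic_spline \<in> borel_measurable borel"
  unfolding cubic_spline_def by measurable

lemma cubic_spline_even: "cubic_spline (- t) = cubic_spline t"
  by (simp add: cubic_spline_def)

lemma abs_cubic_spline_le: "\<bar>cubic_spline t\<bar> \<le> 2 * indicator {-2..2} t"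
proof (cases "\<bar>t\<bar> \<le> 2")
  case True
  define p q where "p = (max 0 (2 - \<bar>t\<bar>))^3" and "q = (max 0 (1 - \<bar>t\<bar>))^3"
  have "p \<le> 2^3" "q \<le> 1^3" unfolding p_def q_def by (rule power_mono; simp)+
  moreover have "p \<ge> 0" "q \<ge> 0" by (auto simp: p_def q_def)
  ultimately have "\<bar>(p - 4 * q) / 6\<bar> \<le> 2" by (simp add: abs_le_iff)
  with True show ?thesis by (auto simp: cubic_spline_def indicator_def p_def q_def abs_le_iff)
qed (auto simp: cubic_spline_def indicator_def)

lemma integral_cubic_spline_cos:
  assumes "x \<noteq> 0"
  shows "(LINT t|lborel. cubic_spline t * cos (t * x)) = 4 * (1 - cos x)\<^sup>2 / x^4"
proof -
  have "has_bochner_integral lborel (\<lambda>t. ((max 0 (2 - \<bar>t\<bar>))^3 * cos (t * x) - 4 * ((max 0 (1 - \<bar>t\<bar>))^3 * cos (t * x))) / 6)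
     (((12 * cos (2 * x) / x^4 + 6 * 2\<^sup>2 / x\<^sup>2 - 12 / x^4) - 4 * (12 * cos (1 * x) / x^4 + 6 * 1\<^sup>2 / x\<^sup>2 - 12 / x^4)) / 6)"
    by (intro has_bochner_integral_divide_zero has_bochner_integral_diff has_bochner_integral_mult_right integral_truncated_cube_cos assms) auto
  then have "(LINT t|lborel. cubic_spline t * cos (t * x)) = 
     (((12 * cos (2 * x) / x^4 + 6 * 2\<^sup>2 / x\<^sup>2 - 12 / x^4) - 4 * (12 * cos (1 * x) / x^4 + 6 * 1\<^sup>2 / x\<^sup>2 - 12 / x^4)) / 6)"
    unfolding cubic_spline_def times_divide_eq_left left_diff_distrib mult.assoc
    by (rule has_bochner_integral_integral_eq)
  \<comment> \<open>The x^-2 terms cancel because 6 * 2^2 = 4 * 6; the double-angle formula leaves a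
    square.\<close>
  also have "\<dots> = 4 * (1 - cos x)\<^sup>2 / x^4"
    by (simp only: cos_double_cos) (simp add: power2_eq_square add_divide_distrib diff_divide_distrib algebra_simps)
  finally show ?thesis .
qed

lemma integrable_cubic_spline: "integrable lborel cubic_spline"
proof (rule Bochner_Integration.integrable_bound)
  show "integrable lborel (\<lambda>t::real. 2 * indicator {-2..2} t :: real)" by simp
qed (use abs_cubic_spline_le in auto)

section \<open>Cauchy majorants for Gaussian integrals\<close>

lemma has_bochner_integral_inverse_1_plus_square:
  "has_bochner_integral lborel (\<lambda>x::real. 1 / (1 + x\<^sup>2)) pi"
  using integrable_inverse_1_plus_square LBINT_inverse_1_plus_square
  by (simp add: has_bochner_integral_iff set_integrable_def interval_lebesgue_integral_def
      set_lebesgue_integral_def divide_inverse)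

lemma has_bochner_integral_cauchy_scaled:
  fixes s :: real
  assumes "s > 0"
  shows "has_bochner_integral lborel (\<lambda>t. 1 / (1 + (s * t)\<^sup>2)) (pi / s)"
proof -
  have "has_bochner_integral lborel (\<lambda>t. 1 / (1 + (0 + s * t)\<^sup>2)) (pi /\<^sub>R \<bar>s\<bar>)"
    using assms has_bochner_integral_inverse_1_plus_square
    by (subst lborel_has_bochner_integral_real_affine_iff[symmetric]) auto
  then show ?thesis using assms by (simp add: divide_inverse mult.commute)
qed

text \<open>The source of every factor 1/s in the Berry--Esseen part. The factor exp (- (s t)^2 / 3)
  of a characteristic function enters only through an integrable majorant in the variable s t, and
  \<open>exp_neg_square_bounds\<close> provides majorants of this shape.\<close>

lemma integral_le_cauchy:
  fixes f :: "real \<Rightarrow> real"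
  assumes "s > 0" and "f \<in> borel_measurable borel"
    and "\<And>t. 0 \<le> f t" "\<And>t. f t \<le> c / (1 + (s * t)\<^sup>2)"
  shows "integrable lborel f" "(LINT t|lborel. f t) \<le> c * pi / s"
proof -
  have *: "has_bochner_integral lborel (\<lambda>t. c * (1 / (1 + (s * t)\<^sup>2))) (c * (pi / s))"
    by (intro has_bochner_integral_mult_right has_bochner_integral_cauchy_scaled assms)
  then have i: "integrable lborel (\<lambda>t. c * (1 / (1 + (s * t)\<^sup>2)))"
    and e: "(LINT t|lborel. c * (1 / (1 + (s * t)\<^sup>2))) = c * pi / s"
    unfolding has_bochner_integral_iff by simp_all
  show "integrable lborel f"
    by (rule Bochner_Integration.integrable_bound[OF i])
       (use assms(2) order_trans[OF assms(4) abs_ge_self] in \<open>auto simp: assms(3)\<close>)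
  from integral_mono[OF this i] assms(4) e show "(LINT t|lborel. f t) \<le> c * pi / s"
    by simp
qed

lemma exp_neg_square_bounds:
  fixes u :: real
  shows "exp (- u\<^sup>2 / 3) \<le> 3 / (1 + u\<^sup>2)" "u\<^sup>2 * exp (- u\<^sup>2 / 3) \<le> 18 / (1 + u\<^sup>2)"
proof -
  have p: "1 + u\<^sup>2 > 0" by (simp add: add_pos_nonneg)
  have a: "exp (u\<^sup>2 / 3) \<ge> 1 + u\<^sup>2 / 3" by (rule exp_ge_add_one_self)
  have b: "exp (u\<^sup>2 / 3) \<ge> 1 + u\<^sup>2 / 3 + (u\<^sup>2 / 3)\<^sup>2 / 2"
    by (rule exp_lower_Taylor_quadratic) simp
  have e: "exp (- u\<^sup>2 / 3) = 1 / exp (u\<^sup>2 / 3)" using exp_minus[of "u\<^sup>2 / 3"] by (simp add: inverse_eq_divide)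
  show "exp (- u\<^sup>2 / 3) \<le> 3 / (1 + u\<^sup>2)"
    unfolding e using p a by (simp add: field_simps)
  have "u\<^sup>2 * (1 + u\<^sup>2) \<le> 18 * exp (u\<^sup>2 / 3)"
      proof -
    have "u\<^sup>2 * (1 + u\<^sup>2) = u\<^sup>2 + (u\<^sup>2)\<^sup>2" by (simp add: power2_eq_square algebra_simps)
    moreover have "18 * exp (u\<^sup>2 / 3) \<ge> 18 + 6 * u\<^sup>2 + (u\<^sup>2)\<^sup>2"
      using b by (simp add: power_divide)
    ultimately show ?thesis using zero_le_power2[of u] by linarith
  qed
  then show "u\<^sup>2 * exp (- u\<^sup>2 / 3) \<le> 18 / (1 + u\<^sup>2)"
    unfolding e using p by (simp add: field_simps)
qed

text \<open>Kept as an integral: the closed form 2 (1 - cos x) / x^2 evaluates to 0 at the origin,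
  which is not the value of the kernel, and Fubini uses the integral at every point.\<close>

definition fejer :: "real \<Rightarrow> real" where
  "fejer x = (LINT t|lborel. max 0 (1 - \<bar>t\<bar>) * cos (t * x))"

text \<open>
  The fourth-order decay of this kernel makes its second moment finite; with the Fejer kernel
  the smoothing error of an interval would not be integrable.
\<close>

definition jackson :: "real \<Rightarrow> real" where
  "jackson x = (LINT t|lborel. cubic_spline t * cos (t * x))"

section \<open>Positivity, decay and mass of the two kernels\<close>

lemma integrable_tent: "integrable lborel (\<lambda>t::real. max 0 (1 - \<bar>t\<bar>))"
proof (rule Bochner_Integration.integrable_bound)
  show "integrable lborel (\<lambda>t::real. indicator {-1..1} t :: real)" by simp
qed (auto simp: indicator_def)

lemma fejer_eq: "x \<noteq> 0 \<Longrightarrow> fejer x = 2 * (1 - cos x) / x\<^sup>2"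
  unfolding fejer_def by (rule integral_tent_cos)

lemma fejer_nonneg: "fejer x \<ge> 0"
proof (cases "x = 0")
  case True then show ?thesis
    by (simp add: fejer_def integral_nonneg_AE)
qed (simp add: fejer_eq)

lemma jackson_eq: "x \<noteq> 0 \<Longrightarrow> jackson x = 4 * (1 - cos x)\<^sup>2 / x^4"
  unfolding jackson_def by (rule integral_cubic_spline_cos)

text \<open>The second kernel is shifted by half a period, so that it is large where the first one vanishes.\<close>

lemma fejer_pair_ge: "4 / (\<bar>x\<bar> + pi)\<^sup>2 \<le> fejer x + fejer (x - pi)"
proof (cases "x = 0 \<or> x = pi")
  case True
  have p: "pi > 0" by simp
  have q: "fejer pi = 4 / pi\<^sup>2" "fejer (- pi) = 4 / pi\<^sup>2" using p by (simp_all add: fejer_eq)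
  have "4 / (\<bar>x\<bar> + pi)\<^sup>2 \<le> 4 / pi\<^sup>2"
    by (intro divide_left_mono power_mono) (auto intro!: mult_pos_pos zero_less_power add_nonneg_pos)
  moreover have "4 / pi\<^sup>2 \<le> fejer x + fejer (x - pi)"
    using True fejer_nonneg[of 0] q by auto
  ultimately show ?thesis by linarith
next
  case False
  define m where "m = (\<bar>x\<bar> + pi)\<^sup>2"
  have m: "m > 0" "x\<^sup>2 \<le> m" "(x - pi)\<^sup>2 \<le> m"
  proof -
    have "\<bar>x\<bar> + pi > 0" "\<bar>x\<bar> \<le> \<bar>\<bar>x\<bar> + pi\<bar>" "\<bar>x - pi\<bar> \<le> \<bar>\<bar>x\<bar> + pi\<bar>"
      using pi_gt_zero by linarith+
    then show "m > 0" "x\<^sup>2 \<le> m" "(x - pi)\<^sup>2 \<le> m"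
      unfolding m_def by (auto simp only: abs_le_square_iff zero_less_power)
  qed
  have c: "0 \<le> 2 * (1 + cos x)" using add_left_mono[OF cos_ge_minus_one[of x], of 1]
    by (intro mult_nonneg_nonneg) simp_all
  \<comment> \<open>As cos (x - pi) = - cos x, the two numerators add up to 4, and \<open>m\<close>
    dominates both denominators.\<close>
  have "4 / m = 2 * (1 - cos x) / m + 2 * (1 + cos x) / m"
    by (simp add: add_divide_distrib[symmetric])
  also have "2 * (1 - cos x) / m \<le> 2 * (1 - cos x) / x\<^sup>2"
    using m False by (intro divide_left_mono) (auto intro!: mult_pos_pos)
  also have "2 * (1 + cos x) / m \<le> 2 * (1 + cos x) / (x - pi)\<^sup>2"
    using m False by (intro divide_left_mono c) (auto intro!: mult_pos_pos)
  finally show ?thesis using False by (simp add: m_def fejer_eq)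
qed

lemma jackson_nonneg: "jackson x \<ge> 0" if "x \<noteq> 0"
  using that by (simp add: jackson_eq)

lemma borel_measurable_cos_transform [measurable]:
  fixes k :: "real \<Rightarrow> real"
  assumes [measurable]: "k \<in> borel_measurable borel"
  shows "(\<lambda>x. LINT t|lborel. k t * cos (t * x)) \<in> borel_measurable borel"
  by measurable

lemma borel_measurable_fejer [measurable]: "fejer \<in> borel_measurable borel"
  unfolding fejer_def by measurable

lemma borel_measurable_jackson [measurable]: "jackson \<in> borel_measurable borel"
  unfolding jackson_def by measurable

lemma abs_cos_transform_le:
  fixes k :: "real \<Rightarrow> real"
  assumes k: "integrable lborel k"
  shows "\<bar>LINT t|lborel. k t * cos (t * x)\<bar> \<le> (LINT t|lborel. \<bar>k t\<bar>)"
proof -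
  have c: "integrable lborel (\<lambda>t. k t * cos (t * x))"
    by (rule Bochner_Integration.integrable_bound[OF k]) (use k in \<open>auto simp: abs_mult mult_left_le\<close>)
  have "\<bar>LINT t|lborel. k t * cos (t * x)\<bar> \<le> (LINT t|lborel. \<bar>k t * cos (t * x)\<bar>)"
    by (rule integral_abs_bound)
  also have "\<dots> \<le> (LINT t|lborel. \<bar>k t\<bar>)"
    using integrable_abs[OF c] integrable_abs[OF k] by (intro integral_mono) (auto simp: abs_mult mult_left_le)
  finally show ?thesis .
qed

lemma abs_jackson_le: "\<bar>jackson x\<bar> \<le> 8"
proof -
  have "\<bar>jackson x\<bar> \<le> (LINT t|lborel. \<bar>cubic_spline t\<bar>)"
    unfolding jackson_def by (rule abs_cos_transform_le[OF integrable_cubic_spline])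
  also have "\<dots> \<le> (LINT t|lborel. 2 * indicator {-2..2::real} t)"
    using abs_cubic_spline_le integrable_cubic_spline by (intro integral_mono) auto
  also have "\<dots> = 8" by simp
  finally show ?thesis .
qed

text \<open>The weight is, up to the factor 4, the reciprocal of the lower bound in
  \<open>fejer_pair_ge\<close>; the two are matched in \<open>indicator_jackson_smoothing\<close>. A
  kernel of order u^-4 still leaves an integrable u^-2 after multiplication by it.\<close>

lemma jackson_decay: "\<bar>(\<bar>u\<bar> + pi)\<^sup>2 * jackson u\<bar> \<le> 1000 / (1 + u\<^sup>2)"
proof (cases "\<bar>u\<bar> \<le> 1")
  case True
  have "(\<bar>u\<bar> + pi)\<^sup>2 \<le> (1 + 4)\<^sup>2" using True pi_less_4 by (intro power_mono) auto
  then have "(\<bar>u\<bar> + pi)\<^sup>2 * \<bar>jackson u\<bar> \<le> 25 * 8"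
    using abs_jackson_le[of u] by (intro mult_mono) auto
  moreover have "200 \<le> 1000 / (1 + u\<^sup>2)"
  proof -
    have "u\<^sup>2 \<le> 1" using True by (simp add: abs_square_le_1)
    moreover have "1 + u\<^sup>2 > 0" by (simp add: add_pos_nonneg)
    ultimately show ?thesis by (simp add: field_simps)
  qed
  ultimately show ?thesis by (simp add: abs_mult)
next
  case False
  then have u: "u \<noteq> 0" "u\<^sup>2 \<ge> 1" using one_le_power[of "\<bar>u\<bar>" 2] by auto
  have "(\<bar>u\<bar> + pi)\<^sup>2 \<le> (5 * \<bar>u\<bar>)\<^sup>2" using False pi_less_4 by (intro power_mono) auto
  then have a: "(\<bar>u\<bar> + pi)\<^sup>2 \<le> 25 * u\<^sup>2" by (simp add: power_mult_distrib)
  have "(1 - cos u)\<^sup>2 \<le> 2\<^sup>2" using cos_ge_minus_one[of u] by (intro power_mono) auto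
  then have b: "\<bar>jackson u\<bar> \<le> 16 / u^4"
    using u by (simp add: jackson_eq divide_right_mono)
  have "(\<bar>u\<bar> + pi)\<^sup>2 * \<bar>jackson u\<bar> \<le> (25 * u\<^sup>2) * (16 / u^4)"
    by (intro mult_mono a b) auto
  also have "\<dots> = 400 / u\<^sup>2" using u by (simp add: power2_eq_square power4_eq_xxxx)
  also have "\<dots> \<le> 1000 / (1 + u\<^sup>2)"
  proof -
    have "1 + u\<^sup>2 > 0" by (simp add: add_pos_nonneg)
    then show ?thesis using u by (simp add: field_simps)
  qed
  finally show ?thesis by (simp add: abs_mult)
qed

lemma integrable_jackson_moment: "integrable lborel (\<lambda>u. (\<bar>u\<bar> + pi)\<^sup>2 * jackson u)"
proof (rule Bochner_Integration.integrable_bound)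
  show "integrable lborel (\<lambda>u::real. 1000 * (1 / (1 + u\<^sup>2)))"
    using has_bochner_integral_inverse_1_plus_square
    by (intro integrable_mult_right) (auto simp: has_bochner_integral_iff)
qed (use jackson_decay in auto)

lemma integrable_jackson: "integrable lborel jackson"
proof (rule Bochner_Integration.integrable_bound[OF integrable_jackson_moment])
  have "1 \<le> (\<bar>u\<bar> + pi)\<^sup>2" for u
    using pi_gt3 one_le_power[of "\<bar>u\<bar> + pi" 2] by auto
  then show "AE u in lborel. norm (jackson u) \<le> norm ((\<bar>u\<bar> + pi)\<^sup>2 * jackson u)"
    by (auto simp: abs_mult mult_le_cancel_right1)
qed auto

text \<open>The kernel is not normalised. Its mass is a divisor in
  \<open>berry_esseen_const\<close>, so positivity is all that matters. On [pi/2, pi] the cosine is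
  nonpositive, hence the closed form is positive there.\<close>

lemma integral_jackson_pos: "(LINT u|lborel. jackson u) > 0"
proof -
  have nn: "AE u in lborel. 0 \<le> jackson u"
    using AE_lborel_singleton[of 0] by eventually_elim (rule jackson_nonneg)
  have "(LINT u|lborel. jackson u) \<noteq> 0"
  proof
    assume "(LINT u|lborel. jackson u) = 0"
    then have "AE u in lborel. jackson u = 0"
      using integral_nonneg_eq_0_iff_AE[OF integrable_jackson nn] by simp
    then have "AE u in lborel. u \<notin> {pi/2..pi}"
    proof eventually_elim
      case (elim u)
      show ?case
      proof
        assume u: "u \<in> {pi/2..pi}"
        then have "cos u \<le> cos (pi/2)" by (subst cos_mono_le_eq) auto
        then have "jackson u > 0" using u pi_gt_zero
          by (subst jackson_eq) (auto intro!: divide_pos_pos)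
        with elim show False by simp
      qed
    qed
    then have "emeasure lborel {pi/2..pi} = 0"
      by (subst (asm) AE_iff_measurable[of "{pi/2..pi}"]) auto
    then show False by simp
  qed
  moreover have "(LINT u|lborel. jackson u) \<ge> 0" by (rule integral_nonneg_AE[OF nn])
  ultimately show ?thesis by simp
qed

section \<open>A Berry--Esseen bound\<close>

text \<open>A Parseval identity: averaging a kernel against the law sees the characteristic function
  only on the support of \<open>k\<close>. This is why estimates for |t| \<le> 2 suffice.\<close>

lemma (in real_distribution) expectation_cos_transform:
  fixes k :: "real \<Rightarrow> real"
  assumes ev: "\<And>t. k (- t) = k t" and k: "integrable lborel k"
  shows "complex_of_real (expectation (\<lambda>x. LINT t|lborel. k t * cos (t * (x - y)))) =
    (CLINT t|lborel. k t * iexp (- t * y) * char M t)"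
proof -
  have km[measurable]: "k \<in> borel_measurable borel" using k by auto
  interpret P: pair_sigma_finite M lborel ..
  let ?f = "\<lambda>x t. complex_of_real (k t) * iexp (t * (x - y))"
  have n: "norm (?f x t) = \<bar>k t\<bar>" for x t by (simp add: norm_mult)
  have ki: "integrable lborel (\<lambda>t. ?f x t)" for x
    by (rule Bochner_Integration.integrable_bound[OF k]) (use n in auto)
  have int: "integrable (M \<Otimes>\<^sub>M lborel) (case_prod ?f)"
    by (rule P.Fubini_integrable) (use ki n in \<open>auto simp: split_beta'\<close>)
  have "complex_of_real (expectation (\<lambda>x. LINT t|lborel. k t * cos (t * (x - y)))) =
      (CLINT x|M. CLINT t|lborel. ?f x t)"
    by (subst integral_even_iexp[OF ev k]) (simp add: integral_complex_of_real)
  also have "\<dots> = (CLINT t|lborel. CLINT x|M. ?f x t)"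
    by (rule P.Fubini_integral[OF int, symmetric])
  also have "\<dots> = (CLINT t|lborel. k t * iexp (- t * y) * char M t)"
  proof (intro Bochner_Integration.integral_cong refl)
    fix t
    have "(CLINT x|M. ?f x t) = (CLINT x|M. (k t * iexp (- t * y)) * iexp (t * x))"
      by (intro Bochner_Integration.integral_cong refl) (simp add: algebra_simps exp_diff exp_minus divide_inverse)
    also have "\<dots> = (k t * iexp (- t * y)) * char M t"
      unfolding char_def by (rule integral_mult_right_zero)
    finally show "(CLINT x|M. ?f x t) = k t * iexp (- t * y) * char M t" .
  qed
  finally show ?thesis .
qed

lemma (in real_distribution) expectation_fejer_le:
  assumes s: "s > 0" and g: "\<And>t. \<bar>t\<bar> \<le> 2 \<Longrightarrow> norm (char M t) \<le> exp (- (s * t)\<^sup>2 / 3)"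
  shows "expectation (\<lambda>x. fejer (x - y)) \<le> 3 * pi / s"
proof -
  let ?f = "\<lambda>t. norm (complex_of_real (max 0 (1 - \<bar>t\<bar>)) * iexp (- t * y) * char M t)"
  have e: "expectation (\<lambda>x. fejer (x - y)) \<le> 
      norm (CLINT t|lborel. complex_of_real (max 0 (1 - \<bar>t\<bar>)) * iexp (- t * y) * char M t)"
    unfolding fejer_def
    by (subst expectation_cos_transform[symmetric]) (auto intro!: integrable_tent)
  have f: "?f t \<le> 3 / (1 + (s * t)\<^sup>2)" for t
  proof (cases "\<bar>t\<bar> \<le> 1")
    case True
    have "?f t \<le> norm (char M t)"
    proof -
      have "norm (complex_of_real (max 0 (1 - \<bar>t\<bar>))) \<le> 1" unfolding norm_of_real by auto
      then show ?thesis
        by (simp only: norm_mult norm_exp_i_times mult_1_right mult_left_le_one_le norm_ge_zero)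
    qed
    also have "\<dots> \<le> 3 / (1 + (s * t)\<^sup>2)"
      using g[of t] True exp_neg_square_bounds(1)[of "s * t"] by auto
    finally show ?thesis .
  next
    case False
    then have "max 0 (1 - \<bar>t\<bar>) = 0" by auto
    then show ?thesis by (simp)
  qed
  have "(LINT t|lborel. ?f t) \<le> 3 * pi / s"
    by (rule integral_le_cauchy(2)[OF s]) (use f in auto)
  with e show ?thesis
    using integral_norm_bound[of lborel "\<lambda>t. complex_of_real (max 0 (1 - \<bar>t\<bar>)) * iexp (- t * y) * char M t"]
    by linarith
qed

lemma abs_fejer_le: "\<bar>fejer x\<bar> \<le> 2"
proof -
  have "\<bar>fejer x\<bar> \<le> (LINT t|lborel. \<bar>max 0 (1 - \<bar>t\<bar>) :: real\<bar>)"
    unfolding fejer_def by (rule abs_cos_transform_le[OF integrable_tent])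
  also have "\<dots> \<le> (LINT t|lborel. indicator {-1..1::real} t)"
    using integrable_abs[OF integrable_tent] by (intro integral_mono) (auto split: split_indicator)
  finally show ?thesis by simp
qed

text \<open>A concentration bound: the mass near any point \<open>y\<close>, at scale 1, is of order
  1/s. Two shifted Fejer kernels dominate the weight, and the expectation of each is an integral of
  the characteristic function. It will control the endpoints of an interval, where smoothing
  errs.\<close>

lemma (in real_distribution) expectation_inverse_square_le:
  assumes s: "s > 0" and g: "\<And>t. \<bar>t\<bar> \<le> 2 \<Longrightarrow> norm (char M t) \<le> exp (- (s * t)\<^sup>2 / 3)"
  shows "expectation (\<lambda>x. 1 / (\<bar>x - y\<bar> + pi)\<^sup>2) \<le> 2 * pi / s"
proof -
  have [simp, intro]: "integrable M (\<lambda>x. fejer (x - y))" for y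
    by (rule integrable_const_bound[where B = 2]) (use abs_fejer_le in auto)
  have "(\<bar>x\<bar> + pi)\<^sup>2 \<ge> 1" for x :: real
    using pi_gt3 one_le_power[of "\<bar>x\<bar> + pi" 2] by auto
  then have i: "integrable M (\<lambda>x. 4 / (\<bar>x - y\<bar> + pi)\<^sup>2)"
    by (intro integrable_const_bound[where B = 4]) (auto simp: divide_le_eq)
  have "4 * expectation (\<lambda>x. 1 / (\<bar>x - y\<bar> + pi)\<^sup>2) = expectation (\<lambda>x. 4 / (\<bar>x - y\<bar> + pi)\<^sup>2)"
    by (subst integral_mult_right_zero[symmetric]) simp
  also have "\<dots> \<le> expectation (\<lambda>x. fejer (x - y) + fejer (x - (y + pi)))"
    using fejer_pair_ge[of "x - y" for x]
    by (intro integral_mono Bochner_Integration.integrable_add i) (auto simp: diff_diff_eq)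
  also have "\<dots> \<le> 3 * pi / s + 3 * pi / s"
    using add_mono[OF expectation_fejer_le[OF assms, of y] expectation_fejer_le[OF assms, of "y + pi"]]
    by (subst Bochner_Integration.integral_add) auto
  also have "\<dots> \<le> 4 * (2 * pi / s)" using s by (simp add: field_simps)
  finally show ?thesis by simp
qed

text \<open>A Chebyshev-type estimate: the second moment of the kernel converts the smoothing error
  into weights centred at the two endpoints, which is the form that
  \<open>expectation_inverse_square_le\<close> can average. The factor \<open>A\<close> accounts for
  the missing normalisation.\<close>

lemma indicator_jackson_smoothing:
  fixes L x :: real
  defines "A \<equiv> LINT u|lborel. jackson u"
    and "B \<equiv> LINT u|lborel. (\<bar>u\<bar> + pi)\<^sup>2 * jackson u"
  shows "\<bar>A * indicator {0..L} x - (LINT z|lborel. indicator {0..L} z * jackson (x - z))\<bar>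
     \<le> B * (1 / (\<bar>x\<bar> + pi)\<^sup>2 + 1 / (\<bar>x - L\<bar> + pi)\<^sup>2)"
proof -
  let ?c = "1 / (\<bar>x\<bar> + pi)\<^sup>2 + 1 / (\<bar>x - L\<bar> + pi)\<^sup>2"
  have "\<bar>w\<bar> + pi > 0" for w :: real using pi_gt_zero abs_ge_zero[of w] by linarith
  then have pos: "0 < (\<bar>w\<bar> + pi)\<^sup>2" for w :: real by (rule zero_less_power)
  have ge: "1 \<le> (1 / (\<bar>w\<bar> + pi)\<^sup>2) * (\<bar>u\<bar> + pi)\<^sup>2" if "\<bar>w\<bar> \<le> \<bar>u\<bar>" for u w
    using that pos[of w] by (simp add: le_divide_eq power_mono)
  have "(LINT z|lborel. indicator {0..L} z * jackson (x - z)) =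
      (LINT u|lborel. indicator {0..L} (x - u) * jackson u)"
    using lborel_integral_real_affine[of "-1" "\<lambda>z. indicator {0..L} z * jackson (x - z)" x] by simp
  moreover have "A * indicator {0..L} x = (LINT u|lborel. indicator {0..L} x * jackson u)"
    unfolding A_def by (simp add: mult.commute)
  moreover have i1: "integrable lborel (\<lambda>u. indicator {0..L} x * jackson u)"
    by (intro integrable_mult_right integrable_jackson)
  moreover have i2: "integrable lborel (\<lambda>u. indicator {0..L} (x - u) * jackson u)"
    by (rule Bochner_Integration.integrable_bound[OF integrable_jackson]) (auto simp: indicator_def)
  ultimately have "A * indicator {0..L} x - (LINT z|lborel. indicator {0..L} z * jackson (x - z)) =
      (LINT u|lborel. indicator {0..L} x * jackson u - indicator {0..L} (x - u) * jackson u)"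
    by simp
  then have "\<bar>A * indicator {0..L} x - (LINT z|lborel. indicator {0..L} z * jackson (x - z))\<bar> \<le>
      (LINT u|lborel. \<bar>indicator {0..L} x * jackson u - indicator {0..L} (x - u) * jackson u\<bar>)"
    by (simp only: integral_abs_bound)
  also have "\<dots> \<le> (LINT u|lborel. ?c * ((\<bar>u\<bar> + pi)\<^sup>2 * jackson u))"
  proof (rule integral_mono_AE)
    show "AE u in lborel. \<bar>indicator {0..L} x * jackson u - indicator {0..L} (x - u) * jackson u\<bar>
        \<le> ?c * ((\<bar>u\<bar> + pi)\<^sup>2 * jackson u)"
      using AE_lborel_singleton[of 0]
    proof eventually_elim
      case (elim u)
      \<comment> \<open>A shift by \<open>u\<close> changes the indicator only if it crosses an endpoint, i.e. \<open>|u| \<ge> |x|\<close> or \<open>|u| \<ge> |x - L|\<close>.\<close>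
      have "\<bar>indicator {0..L} x - indicator {0..L} (x - u) :: real\<bar> \<le> ?c * (\<bar>u\<bar> + pi)\<^sup>2"
      proof (cases "x \<in> {0..L} \<longleftrightarrow> x - u \<in> {0..L}")
        case True
        then have "\<bar>indicator {0..L} x - indicator {0..L} (x - u) :: real\<bar> = 0" by (auto simp: indicator_def)
        then show ?thesis by simp
      next
        case False
        then have "\<bar>x\<bar> \<le> \<bar>u\<bar> \<or> \<bar>x - L\<bar> \<le> \<bar>u\<bar>" by auto
        then have "1 \<le> ?c * (\<bar>u\<bar> + pi)\<^sup>2"
        proof
          assume "\<bar>x\<bar> \<le> \<bar>u\<bar>"
          from ge[OF this] show ?thesis
            unfolding distrib_right by (rule add_increasing2[rotated]) auto
        next
          assume "\<bar>x - L\<bar> \<le> \<bar>u\<bar>"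
          from ge[OF this] show ?thesis
            unfolding distrib_right by (rule add_increasing[rotated]) auto
        qed
        then show ?thesis by (auto simp: indicator_def)
      qed
      then have "\<bar>indicator {0..L} x - indicator {0..L} (x - u) :: real\<bar> * jackson u
          \<le> (?c * (\<bar>u\<bar> + pi)\<^sup>2) * jackson u"
        using jackson_nonneg[OF elim] by (rule mult_right_mono)
      then show ?case using jackson_nonneg[OF elim]
        by (simp add: left_diff_distrib[symmetric] abs_mult mult.assoc)
    qed
  qed (use i1 i2 integrable_jackson_moment in auto)
  also have "\<dots> = B * ?c" unfolding B_def by (simp add: mult.commute)
  finally show ?thesis .
qed

text \<open>Uniform in \<open>L\<close>, because the oscillating antiderivative has modulus 1/|t|.
  The factor |t| is kept on the left so that t = 0 is included.\<close>

lemma norm_integral_iexp_le: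
  fixes t L :: real
  assumes "L \<ge> 0"
  shows "norm (CLINT z|lborel. complex_of_real (indicator {0..L} z) * iexp (- t * z)) * \<bar>t\<bar> \<le> 2"
proof (cases "t = 0")
  case False
  let ?F = "\<lambda>z. \<i> / t * iexp (- t * z)"
  have "(CLINT z|lborel. indicator {0..L} z *\<^sub>R iexp (- t * z)) = ?F L - ?F 0"
  proof (rule integral_FTC_Icc[OF assms])
    fix z
    have "((\<lambda>z. complex_of_real (- t * z)) has_vector_derivative complex_of_real (- t)) (at z within {0..L})"
      by (auto intro!: derivative_eq_intros)
    then have "((\<lambda>z. \<i> * complex_of_real (- t * z)) has_vector_derivative \<i> * complex_of_real (- t)) (at z within {0..L})"
      by (rule has_vector_derivative_mult_right)
    from field_vector_diff_chain_within[OF this DERIV_subset[OF DERIV_exp]]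
    have "((\<lambda>z. iexp (- t * z)) has_vector_derivative \<i> * complex_of_real (- t) * iexp (- t * z)) (at z within {0..L})"
      by (simp add: o_def)
    from has_vector_derivative_mult_right[OF this, of "\<i> / t"]
    show "(?F has_vector_derivative iexp (- t * z)) (at z within {0..L})"
      using False by (simp add: field_simps)
  qed (auto intro!: continuous_intros)
  then have eq: "(CLINT z|lborel. complex_of_real (indicator {0..L} z) * iexp (- t * z)) = ?F L - ?F 0"
    by (simp add: scaleR_conv_of_real)
  have n: "norm (?F z) = 1 / \<bar>t\<bar>" for z by (simp add: norm_mult norm_divide)
  have "norm (CLINT z|lborel. complex_of_real (indicator {0..L} z) * iexp (- t * z)) \<le> norm (?F L) + norm (?F 0)"
    unfolding eq by (rule norm_triangle_ineq4)
  also have "\<dots> = 2 / \<bar>t\<bar>" unfolding n by simp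
  finally show ?thesis using False by (simp add: field_simps)
qed simp

text \<open>Fubini turns the difference into an integral over [-2, 2] of the spline, the difference
  of characteristic functions and the transform of the interval. The extra factor |t| in hypothesis
  \<open>d\<close> cancels the singularity 1/|t| of the last one, so no dependence on
  \<open>L\<close> remains. The constant is 72 = 2 * 2 * 18: the bounds for the spline, for the
  transform of the interval and for the Gaussian factor.\<close>

lemma smoothed_interval_difference:
  fixes s L :: real
  assumes M: "real_distribution M" and N: "real_distribution N" and s: "s > 0" and L: "L \<ge> 0"
    and d: "\<And>t. \<bar>t\<bar> \<le> 2 \<Longrightarrow> norm (char M t - char N t) \<le> (s * t)\<^sup>2 * \<bar>t\<bar> * exp (- (s * t)\<^sup>2 / 3)"
  shows "\<bar>(LINT x|M. LINT z|lborel. indicator {0..L} z * jackson (x - z)) -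
      (LINT x|N. LINT z|lborel. indicator {0..L} z * jackson (x - z))\<bar> \<le> 72 * pi / s"
proof -
  have jb: "\<bar>indicator {0..L} z * jackson u\<bar> \<le> 8 * indicator {0..L} z" for z u :: real
    using abs_jackson_le by (auto simp: indicator_def)
  have swap: "(LINT x|Q. LINT z|lborel. indicator {0..L} z * jackson (x - z)) =
      (LINT z|lborel. indicator {0..L} z * (LINT x|Q. jackson (x - z)))"
    and int: "integrable lborel (\<lambda>z. indicator {0..L} z * (LINT x|Q. jackson (x - z)))"
    if Q: "real_distribution Q" for Q
  proof -
    interpret real_distribution Q by fact
    interpret P: pair_sigma_finite Q lborel ..
    let ?f = "\<lambda>x z. indicator {0..L} z * jackson (x - z)"
    have i8: "integrable lborel (\<lambda>z::real. 8 * indicator {0..L} z :: real)"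
      by (intro integrable_mult_right integrable_real_indicator) (auto simp: emeasure_lborel_Icc_eq)
    have ib: "integrable lborel (\<lambda>z. ?f x z)" for x
      by (rule Bochner_Integration.integrable_bound[OF i8]) (use jb in auto)
    have "integrable Q (\<lambda>x. LINT z|lborel. norm (?f x z))"
    proof (rule integrable_const_bound)
      show "AE x in Q. norm (LINT z|lborel. norm (?f x z)) \<le> (LINT z|lborel. 8 * indicator {0..L} z)"
      proof (rule AE_I2)
        fix x
        have "(LINT z|lborel. norm (?f x z)) \<le> (LINT z|lborel. 8 * indicator {0..L} z)"
          using jb ib[of x] i8 by (intro integral_mono) auto
        then show "norm (LINT z|lborel. norm (?f x z)) \<le> (LINT z|lborel. 8 * indicator {0..L} z)"
          by (simp add: integral_nonneg_AE)
      qed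
    qed measurable
    then have i: "integrable (Q \<Otimes>\<^sub>M lborel) (case_prod ?f)"
      by (intro P.Fubini_integrable) (use ib in \<open>auto simp: split_beta'\<close>)
    show "(LINT x|Q. LINT z|lborel. ?f x z) =
      (LINT z|lborel. indicator {0..L} z * (LINT x|Q. jackson (x - z)))"
      using P.Fubini_integral[OF i] by simp
    show "integrable lborel (\<lambda>z. indicator {0..L} z * (LINT x|Q. jackson (x - z)))"
      using P.integrable_snd[OF i] by simp
  qed
  let ?D = "\<lambda>t. char M t - char N t"
  let ?g = "\<lambda>z t. complex_of_real (indicator {0..L} z) * (complex_of_real (cubic_spline t) * iexp (- t * z) * ?D t)"
  interpret M: real_distribution M by fact
  interpret N: real_distribution N by fact
  have D2: "norm (?D t) \<le> 2" for t
    using norm_triangle_ineq4[of "char M t" "char N t"] M.cmod_char_le_1[of t] N.cmod_char_le_1[of t] by linarith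
  have cD: "integrable lborel (\<lambda>t. complex_of_real (cubic_spline t) * iexp (- t * z) * char Q t)"
    if "real_distribution Q" for Q z
  proof -
    interpret real_distribution Q by fact
    show ?thesis
      by (rule Bochner_Integration.integrable_bound[OF integrable_cubic_spline])
         (use cmod_char_le_1 in \<open>auto simp: norm_mult mult_left_le\<close>)
  qed
  have g1: "norm (?g z t) \<le> indicator {0..L} z * (4 * indicator {-2..2} t)" for z t
  proof -
    have "\<bar>cubic_spline t\<bar> * norm (?D t) \<le> (2 * indicator {-2..2} t) * 2"
      by (intro mult_mono abs_cubic_spline_le D2) auto
    then show ?thesis by (auto simp: norm_mult indicator_def)
  qed
  have i4: "integrable lborel (\<lambda>t::real. 4 * indicator {-2..2} t :: real)" by simp
  have gi: "integrable lborel (?g z)" for z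
    by (rule Bochner_Integration.integrable_bound[where f = "\<lambda>t::real. indicator {0..L} z * (4 * indicator {-2..2} t) :: real"])
       (use g1 order_trans[OF g1 abs_ge_self] in \<open>auto simp del: abs_mult\<close>)
  have "integrable lborel (\<lambda>z. LINT t|lborel. norm (?g z t))"
  proof (rule Bochner_Integration.integrable_bound)
    show "integrable lborel (\<lambda>z::real. indicator {0..L} z * 16 :: real)"
      by (intro integrable_mult_left integrable_real_indicator) (auto simp: emeasure_lborel_Icc_eq)
    show "AE z in lborel. norm (LINT t|lborel. norm (?g z t)) \<le> norm (indicator {0..L} z * 16 :: real)"
    proof (rule AE_I2)
      fix z :: real
      have "(LINT t|lborel. norm (?g z t)) \<le> (LINT t|lborel. indicator {0..L} z * (4 * indicator {-2..2::real} t))"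
        by (rule integral_mono) (use g1 gi[of z] i4 in auto)
      also have "\<dots> = indicator {0..L} z * 16" by simp
      finally show "norm (LINT t|lborel. norm (?g z t)) \<le> norm (indicator {0..L} z * 16 :: real)"
        by (simp add: integral_nonneg_AE)
    qed
  qed measurable
  then have i: "integrable (lborel \<Otimes>\<^sub>M lborel) (case_prod ?g)"
    by (intro lborel_pair.Fubini_integrable) (use gi in \<open>auto simp: split_beta'\<close>)
  have H: "complex_of_real (indicator {0..L} z * (LINT x|M. jackson (x - z)) - indicator {0..L} z * (LINT x|N. jackson (x - z)))
     = (CLINT t|lborel. ?g z t)" for z
  proof -
    have "complex_of_real ((LINT x|M. jackson (x - z)) - (LINT x|N. jackson (x - z))) =
      (CLINT t|lborel. complex_of_real (cubic_spline t) * iexp (- t * z) * char M t -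
         complex_of_real (cubic_spline t) * iexp (- t * z) * char N t)"
      unfolding jackson_def of_real_diff
      by (subst M.expectation_cos_transform N.expectation_cos_transform;
          (rule cubic_spline_even integrable_cubic_spline)?)+
         (rule Bochner_Integration.integral_diff[symmetric]; intro cD M N)
    then show ?thesis
      by (simp add: right_diff_distrib[symmetric])
  qed
  have "complex_of_real ((LINT x|M. LINT z|lborel. indicator {0..L} z * jackson (x - z)) -
      (LINT x|N. LINT z|lborel. indicator {0..L} z * jackson (x - z))) =
      complex_of_real (LINT z|lborel. indicator {0..L} z * (LINT x|M. jackson (x - z)) - indicator {0..L} z * (LINT x|N. jackson (x - z)))"
    by (simp add: swap M N Bochner_Integration.integral_diff[OF int[OF M] int[OF N]])
  also have "\<dots> = (CLINT z|lborel. CLINT t|lborel. ?g z t)"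
    by (subst integral_complex_of_real[symmetric]) (simp only: H)
  also have "\<dots> = (CLINT t|lborel. CLINT z|lborel. ?g z t)"
    by (rule lborel_pair.Fubini_integral[OF i, symmetric])
  finally have e: "complex_of_real ((LINT x|M. LINT z|lborel. indicator {0..L} z * jackson (x - z)) -
      (LINT x|N. LINT z|lborel. indicator {0..L} z * jackson (x - z))) = (CLINT t|lborel. CLINT z|lborel. ?g z t)" .
  have b: "norm (CLINT z|lborel. ?g z t) \<le> 72 / (1 + (s * t)\<^sup>2)" for t
  proof (cases "\<bar>t\<bar> \<le> 2")
    case True
    have "(CLINT z|lborel. ?g z t) = (CLINT z|lborel. (complex_of_real (cubic_spline t) * ?D t) * (complex_of_real (indicator {0..L} z) * iexp (- t * z)))"
      by (intro Bochner_Integration.integral_cong) (auto simp: mult_ac)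
    also have "norm \<dots> = \<bar>cubic_spline t\<bar> * (norm (?D t) * norm (CLINT z|lborel. complex_of_real (indicator {0..L} z) * iexp (- t * z)))"
      by (subst integral_mult_right_zero) (simp add: norm_mult)
    also have "\<dots> \<le> 2 * ((s * t)\<^sup>2 * exp (- (s * t)\<^sup>2 / 3) * 2)"
    proof (rule mult_mono)
      show "\<bar>cubic_spline t\<bar> \<le> 2" by (rule order_trans[OF abs_cubic_spline_le]) (simp add: indicator_def)
      have "norm (?D t) * norm (CLINT z|lborel. complex_of_real (indicator {0..L} z) * iexp (- t * z)) \<le>
        ((s * t)\<^sup>2 * \<bar>t\<bar> * exp (- (s * t)\<^sup>2 / 3)) * norm (CLINT z|lborel. complex_of_real (indicator {0..L} z) * iexp (- t * z))"
        by (intro mult_right_mono d True) auto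
      also have "\<dots> = ((s * t)\<^sup>2 * exp (- (s * t)\<^sup>2 / 3)) * (norm (CLINT z|lborel. complex_of_real (indicator {0..L} z) * iexp (- t * z)) * \<bar>t\<bar>)"
        by (simp only: mult_ac)
      also have "\<dots> \<le> ((s * t)\<^sup>2 * exp (- (s * t)\<^sup>2 / 3)) * 2"
        by (intro mult_left_mono norm_integral_iexp_le L) auto
      finally show "norm (?D t) * norm (CLINT z|lborel. complex_of_real (indicator {0..L} z) * iexp (- t * z)) \<le> (s * t)\<^sup>2 * exp (- (s * t)\<^sup>2 / 3) * 2" .
    qed auto
    also have "\<dots> \<le> 4 * (18 / (1 + (s * t)\<^sup>2))"
      using exp_neg_square_bounds(2)[of "s * t"] by simp
    finally show ?thesis by simp
  next
    case False
    then have "cubic_spline t = 0" using abs_cubic_spline_le[of t] by (auto split: split_indicator_asm)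
    then show ?thesis by simp
  qed
  have gm: "(\<lambda>t. CLINT z|lborel. ?g z t) \<in> borel_measurable borel" by measurable
  have "(LINT t|lborel. norm (CLINT z|lborel. ?g z t)) \<le> 72 * pi / s"
    by (rule integral_le_cauchy(2)[OF s]) (use b gm in auto)
  then have "norm (CLINT t|lborel. CLINT z|lborel. ?g z t) \<le> 72 * pi / s"
    using integral_norm_bound[of lborel "\<lambda>t. CLINT z|lborel. ?g z t"] by linarith
  then show ?thesis unfolding e[symmetric] norm_of_real .
qed

text \<open>The term 72 pi is the smoothed difference, 8 pi times the moment is the smoothing error
  4 pi for each of the two laws, and the denominator is the mass of the kernel.\<close>

definition berry_esseen_const :: real where
  "berry_esseen_const = (72 * pi + 8 * pi * (LINT u|lborel. (\<bar>u\<bar> + pi)\<^sup>2 * jackson u)) / (LINT u|lborel. jackson u)"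

lemma jackson_moment_nonneg: "(LINT u|lborel. (\<bar>u\<bar> + pi)\<^sup>2 * jackson u) \<ge> 0"
proof (rule integral_nonneg_AE)
  show "AE u in lborel. 0 \<le> (\<bar>u\<bar> + pi)\<^sup>2 * jackson u"
    using AE_lborel_singleton[of 0] by eventually_elim (auto intro!: mult_nonneg_nonneg jackson_nonneg)
qed

lemma berry_esseen_const_pos: "berry_esseen_const > 0"
  unfolding berry_esseen_const_def
  by (intro divide_pos_pos integral_jackson_pos add_pos_nonneg mult_nonneg_nonneg jackson_moment_nonneg) auto

lemma (in real_distribution) interval_smoothing:
  assumes s: "s > 0" and g: "\<And>t. \<bar>t\<bar> \<le> 2 \<Longrightarrow> norm (char M t) \<le> exp (- (s * t)\<^sup>2 / 3)"
  shows "\<bar>(LINT u|lborel. jackson u) * measure M {0..L} -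
      (LINT x|M. LINT z|lborel. indicator {0..L} z * jackson (x - z))\<bar>
    \<le> (LINT u|lborel. (\<bar>u\<bar> + pi)\<^sup>2 * jackson u) * (4 * pi / s)"
proof -
  let ?A = "LINT u|lborel. jackson u" and ?B = "LINT u|lborel. (\<bar>u\<bar> + pi)\<^sup>2 * jackson u"
  let ?S = "\<lambda>x. LINT z|lborel. indicator {0..L} z * jackson (x - z)"
  have sq: "(\<bar>x\<bar> + pi)\<^sup>2 \<ge> 1" for x :: real
    using pi_gt3 one_le_power[of "\<bar>x\<bar> + pi" 2] by auto
  then have i: "integrable M (\<lambda>x. 1 / (\<bar>x - y\<bar> + pi)\<^sup>2)" for y
    by (intro integrable_const_bound[where B = 1]) (auto simp: divide_le_eq)
  have i2: "integrable M (\<lambda>x. ?B * (1 / (\<bar>x - 0\<bar> + pi)\<^sup>2 + 1 / (\<bar>x - L\<bar> + pi)\<^sup>2))"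
    by (intro integrable_mult_right Bochner_Integration.integrable_add i)
  have sm: "\<bar>?A * indicator {0..L} x - ?S x\<bar> \<le> ?B * (1 / (\<bar>x - 0\<bar> + pi)\<^sup>2 + 1 / (\<bar>x - L\<bar> + pi)\<^sup>2)" for x
    using indicator_jackson_smoothing[of L x] by simp
  have i3: "integrable M (\<lambda>x. ?A * indicator {0..L} x - ?S x)"
    by (rule Bochner_Integration.integrable_bound[OF i2]) (use sm in \<open>auto intro: order_trans[OF _ abs_ge_self]\<close>)
  have i4: "integrable M (\<lambda>x. ?A * indicator {0..L} x)"
    by (intro integrable_mult_right integrable_real_indicator) (auto simp: emeasure_eq_measure)
  have "integrable M (\<lambda>x. ?A * indicator {0..L} x - (?A * indicator {0..L} x - ?S x))"
    by (rule Bochner_Integration.integrable_diff[OF i4 i3])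
  then have i5: "integrable M ?S" by simp
  have "?A * measure M {0..L} - (LINT x|M. ?S x) = (LINT x|M. ?A * indicator {0..L} x - ?S x)"
    by (subst Bochner_Integration.integral_diff[OF i4 i5]) simp
  then have "\<bar>?A * measure M {0..L} - (LINT x|M. ?S x)\<bar> \<le> (LINT x|M. \<bar>?A * indicator {0..L} x - ?S x\<bar>)"
    by (simp only: integral_abs_bound)
  also have "\<dots> \<le> (LINT x|M. ?B * (1 / (\<bar>x - 0\<bar> + pi)\<^sup>2 + 1 / (\<bar>x - L\<bar> + pi)\<^sup>2))"
    by (intro integral_mono integrable_abs i3 i2 sm)
  also have "\<dots> =
      ?B * ((LINT x|M. 1 / (\<bar>x - 0\<bar> + pi)\<^sup>2) + (LINT x|M. 1 / (\<bar>x - L\<bar> + pi)\<^sup>2))"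
    by (simp only: integral_mult_right_zero Bochner_Integration.integral_add[OF i i])
  also have "\<dots> \<le> ?B * (2 * pi / s + 2 * pi / s)"
    by (intro mult_left_mono add_mono expectation_inverse_square_le[OF s g] jackson_moment_nonneg)
  finally show ?thesis by simp
qed

text \<open>Symmetric in \<open>M\<close> and \<open>N\<close>: that neither law concentrates near
  the endpoints follows from the decay of its characteristic function, so no density of
  \<open>N\<close> is involved.\<close>

lemma kolmogorov_distance_le:
  fixes s L :: real
  assumes M: "real_distribution M" and N: "real_distribution N" and s: "s > 0" and L: "L \<ge> 0"
    and gM: "\<And>t. \<bar>t\<bar> \<le> 2 \<Longrightarrow> norm (char M t) \<le> exp (- (s * t)\<^sup>2 / 3)"
    and gN: "\<And>t. \<bar>t\<bar> \<le> 2 \<Longrightarrow> norm (char N t) \<le> exp (- (s * t)\<^sup>2 / 3)"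
    and d: "\<And>t. \<bar>t\<bar> \<le> 2 \<Longrightarrow> norm (char M t - char N t) \<le> (s * t)\<^sup>2 * \<bar>t\<bar> * exp (- (s * t)\<^sup>2 / 3)"
  shows "\<bar>measure M {0..L} - measure N {0..L}\<bar> \<le> berry_esseen_const / s"
proof -
  let ?A = "LINT u|lborel. jackson u" and ?B = "LINT u|lborel. (\<bar>u\<bar> + pi)\<^sup>2 * jackson u"
  let ?S = "\<lambda>Q. LINT x|Q. LINT z|lborel. indicator {0..L} z * jackson (x - z)"
  have 1: "\<bar>?S M - ?S N\<bar> \<le> 72 * pi / s"
    by (rule smoothed_interval_difference[OF M N s L d])
  have 2: "\<bar>?A * measure M {0..L} - ?S M\<bar> \<le> ?B * (4 * pi / s)"
    by (rule real_distribution.interval_smoothing[OF M s gM])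
  have 3: "\<bar>?A * measure N {0..L} - ?S N\<bar> \<le> ?B * (4 * pi / s)"
    by (rule real_distribution.interval_smoothing[OF N s gN])
  have "\<bar>m - n\<bar> \<le> p + q + r" if "\<bar>a - b\<bar> \<le> p" "\<bar>m - a\<bar> \<le> q" "\<bar>n - b\<bar> \<le> r" for a b m n p q r :: real
    using that by linarith
  note * = this[OF 1 2 3]
  have "?A * \<bar>measure M {0..L} - measure N {0..L}\<bar> = \<bar>?A * measure M {0..L} - ?A * measure N {0..L}\<bar>"
    using integral_jackson_pos by (simp add: abs_mult flip: right_diff_distrib)
  also have "\<dots> \<le> 72 * pi / s + ?B * (4 * pi / s) + ?B * (4 * pi / s)"
    by (rule *)
  also have "\<dots> = ?A * (berry_esseen_const / s)"
    using integral_jackson_pos s by (simp add: berry_esseen_const_def field_simps)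
  finally show ?thesis using integral_jackson_pos by (simp only: mult_le_cancel_left_pos)
qed

section \<open>Exponentially weighted half-lines as mixtures of intervals\<close>

lemma nn_integral_exponential_atLeast:
  fixes h a :: real
  assumes h: "h > 0"
  shows "(\<integral>\<^sup>+L. ennreal (h * exp (- h * L)) * indicator {a..} L \<partial>lborel) = ennreal (exp (- h * a))"
proof -
  have "((\<lambda>L. exp (- h * L)) \<longlongrightarrow> 0) at_top"
    using h by (auto intro!: exp_at_bot[THEN filterlim_compose] filterlim_tendsto_pos_mult_at_top filterlim_ident
        simp: filterlim_uminus_at_bot)
  then have lim: "((\<lambda>L. - exp (- h * L)) \<longlongrightarrow> 0) at_top"
    using tendsto_minus by fastforce
  have "(\<integral>\<^sup>+L. ennreal (h * exp (- h * L)) * indicator {a..} L \<partial>lborel) = ennreal (0 - (- exp (- h * a)))"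
    by (rule nn_integral_FTC_atLeast[OF _ _ _ lim]) (use h in \<open>auto intro!: derivative_eq_intros\<close>)
  then show ?thesis by simp
qed

text \<open>Layer-cake formula: exp (- h x) is the integral of h exp (- h L) over L \<ge> x.\<close>

lemma (in real_distribution) nn_integral_exp_tail:
  fixes h :: real
  assumes h: "h > 0"
  shows "(\<integral>\<^sup>+x. ennreal (exp (- h * x)) * indicator {0..} x \<partial>M) =
    (\<integral>\<^sup>+L. ennreal (h * exp (- h * L)) * indicator {0..} L * emeasure M {0..L} \<partial>lborel)"
proof -
  interpret P: pair_sigma_finite M lborel ..
  let ?f = "\<lambda>x L. ennreal (h * exp (- h * L)) * indicator {0..} L * indicator {0..L} x"
  have 1: "(\<integral>\<^sup>+L. ?f x L \<partial>lborel) = ennreal (exp (- h * x)) * indicator {0..} x" for x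
  proof (cases "x \<ge> 0")
    case True
    note nn_integral_exponential_atLeast[OF h, of x]
    moreover have "?f x L = ennreal (h * exp (- h * L)) * indicator {x..} L" for L
      using True by (auto simp: indicator_def)
    ultimately show ?thesis using True by simp
  qed (auto simp: indicator_def intro!: nn_integral_zero')
  have "(\<integral>\<^sup>+x. ennreal (exp (- h * x)) * indicator {0..} x \<partial>M) = (\<integral>\<^sup>+x. \<integral>\<^sup>+L. ?f x L \<partial>lborel \<partial>M)"
    by (simp only: 1)
  also have "\<dots> = (\<integral>\<^sup>+L. \<integral>\<^sup>+x. ?f x L \<partial>M \<partial>lborel)"
  proof (rule P.Fubini'[symmetric])
    have "Measurable.pred (M \<Otimes>\<^sub>M lborel) (\<lambda>p. 0 \<le> fst p \<and> fst p \<le> snd p)" by measurable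
    then show "(\<lambda>(x, L). ?f x L) \<in> borel_measurable (M \<Otimes>\<^sub>M lborel)"
      by (simp add: split_beta' indicator_def) 
  qed
  also have "\<dots> = (\<integral>\<^sup>+L. ennreal (h * exp (- h * L)) * indicator {0..} L * emeasure M {0..L} \<partial>lborel)"
    by (intro nn_integral_cong) (simp add: nn_integral_cmult)
  finally show ?thesis .
qed

text \<open>The weights h exp (- h L) have total mass 1, so the error \<open>c\<close> passes
  through unchanged, whatever \<open>h\<close> is. The one-sided form is applied in both
  directions.\<close>

lemma exp_tail_mono:
  fixes h c :: real
  assumes M: "real_distribution M" and N: "real_distribution N" and h: "h > 0"
    and c: "\<And>L. L \<ge> 0 \<Longrightarrow> measure M {0..L} \<le> measure N {0..L} + c" and "c \<ge> 0"
  shows "(LINT x|M. exp (- h * x) * indicator {0..} x) \<le> (LINT x|N. exp (- h * x) * indicator {0..} x) + c"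
proof -
  interpret M: real_distribution M by fact
  interpret N: real_distribution N by fact
  have enn: "(\<integral>\<^sup>+x. ennreal (exp (- h * x)) * indicator {0..} x \<partial>Q) = ennreal (LINT x|Q. exp (- h * x) * indicator {0..} x)"
    if "real_distribution Q" for Q
  proof -
    interpret real_distribution Q by fact
    have "integrable Q (\<lambda>x. exp (- h * x) * indicator {0..} x)"
      using h by (intro integrable_const_bound[where B = 1]) (auto simp: indicator_def)
    then have "ennreal (LINT x|Q. exp (- h * x) * indicator {0..} x) = (\<integral>\<^sup>+x. ennreal (exp (- h * x) * indicator {0..} x) \<partial>Q)"
      by (intro nn_integral_eq_integral[symmetric]) auto
    then show ?thesis by (simp add: ennreal_mult' ennreal_indicator)
  qed
  have one: "(\<integral>\<^sup>+L. ennreal (h * exp (- h * L)) * indicator {0..} L \<partial>lborel) = 1"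
    using nn_integral_exponential_atLeast[OF h, of 0] by simp
  have mN: "(\<lambda>L. emeasure N {0..L}) \<in> borel_measurable borel"
    unfolding N.emeasure_eq_measure
    by (intro measurable_compose[OF _ measurable_ennreal] borel_measurable_mono)
       (auto intro!: monoI N.finite_measure_mono)
  have "ennreal (LINT x|M. exp (- h * x) * indicator {0..} x) =
     (\<integral>\<^sup>+L. ennreal (h * exp (- h * L)) * indicator {0..} L * emeasure M {0..L} \<partial>lborel)"
    using enn[OF M] M.nn_integral_exp_tail[OF h] by simp
  also have "\<dots> \<le> (\<integral>\<^sup>+L. ennreal (h * exp (- h * L)) * indicator {0..} L * emeasure N {0..L} +
      ennreal c * (ennreal (h * exp (- h * L)) * indicator {0..} L) \<partial>lborel)"
  proof (rule nn_integral_mono)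
    fix L :: real
    have "emeasure M {0..L} \<le> emeasure N {0..L} + ennreal c" if "L \<ge> 0"
      using c[OF that] \<open>c \<ge> 0\<close>
      by (simp add: M.emeasure_eq_measure N.emeasure_eq_measure flip: ennreal_plus)
    then have "ennreal (h * exp (- h * L)) * indicator {0..} L * emeasure M {0..L} \<le>
      ennreal (h * exp (- h * L)) * indicator {0..} L * (emeasure N {0..L} + ennreal c)"
      by (cases "L \<ge> 0") (auto simp: indicator_def intro!: mult_left_mono)
    then show "ennreal (h * exp (- h * L)) * indicator {0..} L * emeasure M {0..L} \<le>
      ennreal (h * exp (- h * L)) * indicator {0..} L * emeasure N {0..L} +
      ennreal c * (ennreal (h * exp (- h * L)) * indicator {0..} L)"
      by (simp add: distrib_left mult_ac)
  qed
  also have "\<dots> = (\<integral>\<^sup>+L. ennreal (h * exp (- h * L)) * indicator {0..} L * emeasure N {0..L} \<partial>lborel) +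
      ennreal c * (\<integral>\<^sup>+L. ennreal (h * exp (- h * L)) * indicator {0..} L \<partial>lborel)"
    using mN by (subst nn_integral_add) (auto simp: nn_integral_cmult)
  also have "\<dots> = ennreal ((LINT x|N. exp (- h * x) * indicator {0..} x) + c)"
    using \<open>c \<ge> 0\<close>
    by (simp only: one enn[OF N] N.nn_integral_exp_tail[OF h, symmetric] mult_1_right)
       (rule ennreal_plus[symmetric]; simp add: integral_nonneg_AE)
  finally show ?thesis
    using \<open>c \<ge> 0\<close> by (subst (asm) ennreal_le_iff) (auto intro!: add_nonneg_nonneg integral_nonneg_AE)
qed

section \<open>Cumulant expansion in the class\<close>

lemma open_norm_mult_less_1: "open {z::complex. norm z * \<tau> < 1}"
  by (intro open_Collect_less continuous_intros)

lemma prob_space_scale_variance: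
  fixes c :: real
  assumes F: "real_distribution F"
  shows "prob_space.expectation (distr F borel (\<lambda>x. c * x)) (\<lambda>x. x) = c * prob_space.expectation F (\<lambda>x. x)"
    and "prob_space.variance (distr F borel (\<lambda>x. c * x)) (\<lambda>x. x) = c\<^sup>2 * prob_space.variance F (\<lambda>x. x)"
proof -
  interpret real_distribution F by fact
  show 1: "prob_space.expectation (distr F borel (\<lambda>x. c * x)) (\<lambda>x. x) = c * expectation (\<lambda>x. x)"
    by (subst integral_distr) auto
  show "prob_space.variance (distr F borel (\<lambda>x. c * x)) (\<lambda>x. x) = c\<^sup>2 * variance (\<lambda>x. x)"
    unfolding 1 by (subst integral_distr) (auto simp: right_diff_distrib[symmetric] power_mult_distrib)
qed

lemma class_A1_scale:
  assumes F: "F \<in> class_A1 \<tau>" and c: "c \<noteq> 0"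
  shows "distr F borel (\<lambda>x. c * x) \<in> class_A1 (\<bar>c\<bar> * \<tau>)"
proof -
  from F obtain \<phi> where rd: "real_distribution F" and ll: "is_log_laplace \<tau> F \<phi>"
    and d3: "\<And>z. norm z * \<tau> < 1 \<Longrightarrow> norm ((deriv ^^ 3) \<phi> z) \<le> \<tau> * prob_space.variance F (\<lambda>x. x)"
    by (auto simp: class_A1_def)
  interpret real_distribution F by fact
  let ?G = "distr F borel (\<lambda>x. c * x)" and ?\<phi> = "\<lambda>z. \<phi> (complex_of_real c * z)"
  let ?S = "{z::complex. norm z * \<tau> < 1}" and ?T = "{z::complex. norm z * (\<bar>c\<bar> * \<tau>) < 1}"
  have hol: "\<phi> holomorphic_on ?S"
    using ll open_norm_mult_less_1 by (auto simp: is_log_laplace_def analytic_on_open)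
  have img: "complex_of_real c * z \<in> ?S" if "z \<in> ?T" for z
    using that by (simp add: norm_mult mult_ac)
  have "?\<phi> holomorphic_on ?T"
    using holomorphic_on_compose_gen[of "\<lambda>z. complex_of_real c * z" ?T \<phi> ?S] hol img
    by (auto simp: o_def intro!: holomorphic_intros)
  then have an: "?\<phi> analytic_on ?T"
    using open_norm_mult_less_1 by (simp add: analytic_on_open)
  have "is_log_laplace (\<bar>c\<bar> * \<tau>) ?G ?\<phi>"
    unfolding is_log_laplace_def
  proof (intro conjI allI impI an)
    show "?\<phi> 0 = 0" using ll by (simp add: is_log_laplace_def)
    fix z :: complex assume "norm z * (\<bar>c\<bar> * \<tau>) < 1"
    then have "complex_of_real c * z \<in> ?S" using img by simp
    then have *: "integrable F (\<lambda>x. exp (complex_of_real c * z * complex_of_real x))"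
      "exp (\<phi> (complex_of_real c * z)) = laplace_transform F (complex_of_real c * z)"
      using ll by (auto simp: is_log_laplace_def)
    show "integrable ?G (\<lambda>x. exp (z * complex_of_real x))"
      using *(1) by (subst integrable_distr_eq) (auto simp: mult_ac)
    show "exp (?\<phi> z) = laplace_transform ?G z"
      using *(2) by (simp add: laplace_transform_def integral_distr mult_ac)
  qed
  moreover have "norm ((deriv ^^ 3) ?\<phi> z) \<le> \<bar>c\<bar> * \<tau> * prob_space.variance ?G (\<lambda>x. x)"
    if z: "norm z * (\<bar>c\<bar> * \<tau>) < 1" for z
  proof -
    have "(deriv ^^ 3) ?\<phi> z = complex_of_real c ^ 3 * (deriv ^^ 3) \<phi> (complex_of_real c * z)"
    proof (rule higher_deriv_compose_linear[OF hol])
      show "open ?T" "open ?S" by (rule open_norm_mult_less_1)+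
      show "z \<in> ?T" using z by simp
    qed (rule img)
    then have "norm ((deriv ^^ 3) ?\<phi> z) \<le> \<bar>c\<bar> ^ 3 * (\<tau> * variance (\<lambda>x. x))"
      using d3[of "complex_of_real c * z"] img[of z] z
      by (auto simp: norm_mult norm_power intro!: mult_left_mono)
    also have "\<dots> = \<bar>c\<bar> * \<tau> * (c\<^sup>2 * variance (\<lambda>x. x))"
      by (simp add: power3_eq_cube power2_eq_square mult_ac)
    finally show ?thesis by (subst prob_space_scale_variance(2)[OF rd])
  qed
  moreover have "real_distribution ?G" by simp
  ultimately show ?thesis unfolding class_A1_def by auto
qed

section \<open>Identification of the first two cumulants\<close>

lemma eq_0_if_le_small:
  fixes a :: "'a::real_normed_vector"
  assumes "\<And>h::real. 0 < h \<Longrightarrow> h \<le> 1 \<Longrightarrow> norm a \<le> C * h"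
  shows "a = 0"
proof (rule ccontr)
  assume "a \<noteq> 0"
  then have n: "norm a > 0" by simp
  have "norm a \<le> C" using assms[of 1] by simp
  with n have "C > 0" by linarith
  define h where "h = min 1 (norm a / (2 * C))"
  have "0 < h" "h \<le> 1" using n \<open>C > 0\<close> by (auto simp: h_def)
  from assms[OF this] have "norm a \<le> C * h" .
  also have "C * h \<le> C * (norm a / (2 * C))" using \<open>C > 0\<close> by (intro mult_left_mono) (auto simp: h_def)
  finally show False using n \<open>C > 0\<close> by simp
qed

text \<open>Comparing expansions identifies the derivatives at 0 without differentiating under the
  integral. The error of exp z = 1 + z is of order |\<phi>|^2, that is h^2, which suffices for
  \<open>a = 0\<close>; once \<open>a = 0\<close>, it is of order h^4, and the coefficients of h^2
  can be compared.\<close>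

lemma log_expansion_coefficients:
  fixes \<phi> :: "real \<Rightarrow> complex" and a b c :: complex
  assumes "C \<ge> 0"
    and phi: "\<And>h. 0 < h \<Longrightarrow> h \<le> 1 \<Longrightarrow> norm (\<phi> h - (a * h + b * h\<^sup>2 / 2)) \<le> C * h ^ 3"
    and ex: "\<And>h. 0 < h \<Longrightarrow> h \<le> 1 \<Longrightarrow> norm (exp (\<phi> h) - (1 + c * h\<^sup>2 / 2)) \<le> C * h ^ 3"
  shows "a = 0" "b = c"
proof -
  define D where "D = norm a + norm b + C"
  have D: "D \<ge> 0" using assms(1) by (simp add: D_def)
  have hp: "h ^ 3 \<le> h\<^sup>2" "h\<^sup>2 \<le> h" "h ^ 4 \<le> h ^ 3" if "0 < h" "h \<le> 1" for h :: real
    using that power_decreasing[of 2 3 h] power_decreasing[of 1 2 h] power_decreasing[of 3 4 h] by auto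
  have q: "norm (exp z - 1 - z) \<le> exp D * (norm z)\<^sup>2" if "norm z \<le> D" for z :: complex
  proof -
    have "norm (exp z - (\<Sum>i\<le>1. z ^ i / fact i)) \<le> exp (norm z) * norm z ^ Suc 1 / fact 1"
      by (rule Taylor_exp_field)
    then have "norm (exp z - 1 - z) \<le> exp (norm z) * (norm z)\<^sup>2"
      by (simp add: diff_diff_eq numeral_2_eq_2)
    also have "\<dots> \<le> exp D * (norm z)\<^sup>2" using that by (intro mult_right_mono) auto
    finally show ?thesis .
  qed
  have ph: "norm (\<phi> h) \<le> norm a * h + (norm b + C) * h\<^sup>2" if h: "0 < h" "h \<le> 1" for h
  proof -
    have "norm (\<phi> h) \<le> norm (\<phi> h - (a * h + b * h\<^sup>2 / 2)) + norm (a * h + b * h\<^sup>2 / 2)"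
      using norm_triangle_ineq[of "\<phi> h - (a * h + b * h\<^sup>2 / 2)" "a * h + b * h\<^sup>2 / 2"] by simp
    also have "\<dots> \<le> C * h ^ 3 + (norm (a * h) + norm (b * h\<^sup>2 / 2))"
      by (intro add_mono phi h norm_triangle_ineq)
    also have "\<dots> \<le> C * h\<^sup>2 + (norm a * h + norm b * h\<^sup>2)"
      using h hp[OF h] assms(1) by (intro add_mono mult_left_mono) (auto simp: norm_mult norm_divide norm_power)
    finally show ?thesis by (simp add: algebra_simps)
  qed
  have key: "norm (a * h + (b - c) * h\<^sup>2 / 2) \<le> 2 * C * h ^ 3 + exp D * (norm (\<phi> h))\<^sup>2"
    if h: "0 < h" "h \<le> 1" for h
  proof -
    have "norm (\<phi> h) \<le> norm a * h + (norm b + C) * h\<^sup>2" by (rule ph[OF h])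
    also have "\<dots> \<le> norm a * 1 + (norm b + C) * 1"
      using h hp[OF h] assms(1) by (intro add_mono mult_left_mono) auto
    finally have "norm (\<phi> h) \<le> D" by (simp add: D_def)
    from q[OF this] phi[OF h] ex[OF h]
    have "norm (exp (\<phi> h) - 1 - \<phi> h) + norm (\<phi> h - (a * h + b * h\<^sup>2 / 2)) + norm (exp (\<phi> h) - (1 + c * h\<^sup>2 / 2))
      \<le> exp D * (norm (\<phi> h))\<^sup>2 + C * h ^ 3 + C * h ^ 3" by linarith
    moreover have tri: "norm (x - y - z) \<le> norm x + norm y + norm z" for x y z :: complex
      using norm_triangle_ineq4[of "x - y" z] norm_triangle_ineq4[of x y] by linarith
    have eq: "a * h + (b - c) * h\<^sup>2 / 2 = (exp (\<phi> h) - (1 + c * h\<^sup>2 / 2)) - (exp (\<phi> h) - 1 - \<phi> h) - (\<phi> h - (a * h + b * h\<^sup>2 / 2))"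
      by (simp add: field_simps)
    have "norm (a * h + (b - c) * h\<^sup>2 / 2) \<le> norm (exp (\<phi> h) - (1 + c * h\<^sup>2 / 2)) + norm (exp (\<phi> h) - 1 - \<phi> h) + norm (\<phi> h - (a * h + b * h\<^sup>2 / 2))"
      by (subst eq) (rule tri)
    ultimately show ?thesis by (simp add: algebra_simps)
  qed
  show a: "a = 0"
  proof (rule eq_0_if_le_small)
    fix h :: real assume h: "0 < h" "h \<le> 1"
    have "norm (\<phi> h) \<le> norm a * h + (norm b + C) * h"
    proof -
      have "(norm b + C) * h\<^sup>2 \<le> (norm b + C) * h"
        using hp(2)[OF h] assms(1) by (intro mult_left_mono) auto
      then show ?thesis using ph[OF h] by linarith
    qed
    also have "\<dots> = D * h" by (simp add: D_def algebra_simps)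
    finally have "(norm (\<phi> h))\<^sup>2 \<le> (D * h)\<^sup>2" by (intro power_mono) auto
    then have 1: "exp D * (norm (\<phi> h))\<^sup>2 \<le> exp D * D\<^sup>2 * h\<^sup>2" by (simp add: power_mult_distrib)
    have 2: "2 * C * h ^ 3 \<le> 2 * C * h\<^sup>2" using hp[OF h] assms(1) by (intro mult_left_mono) auto
    have "norm a * h = norm ((a * h + (b - c) * h\<^sup>2 / 2) - (b - c) * h\<^sup>2 / 2)"
      using h by (simp add: norm_mult)
    also have "\<dots> \<le> norm (a * h + (b - c) * h\<^sup>2 / 2) + norm ((b - c) * h\<^sup>2 / 2)"
      by (rule norm_triangle_ineq4)
    also have "\<dots> \<le> norm (a * h + (b - c) * h\<^sup>2 / 2) + norm (b - c) * h\<^sup>2"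
      by (simp add: norm_mult norm_divide norm_power)
    finally have "norm a * h \<le> 2 * C * h\<^sup>2 + exp D * D\<^sup>2 * h\<^sup>2 + norm (b - c) * h\<^sup>2"
      using key[OF h, folded of_real_power] 1 2 by linarith
    then have "norm a * h \<le> (2 * C + exp D * D\<^sup>2 + norm (b - c)) * h * h"
      by (simp add: algebra_simps power2_eq_square)
    then show "norm a \<le> (2 * C + exp D * D\<^sup>2 + norm (b - c)) * h"
      using h by simp
  qed
  have "b - c = 0"
  proof (rule eq_0_if_le_small)
    fix h :: real assume h: "0 < h" "h \<le> 1"
    have "norm (\<phi> h) \<le> D * h\<^sup>2" using ph[OF h] a by (simp add: D_def)
    then have "(norm (\<phi> h))\<^sup>2 \<le> (D * h\<^sup>2)\<^sup>2" by (intro power_mono) auto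
    also have "\<dots> = D\<^sup>2 * h ^ 4" by (simp add: power_mult_distrib flip: power_mult)
    also have "\<dots> \<le> D\<^sup>2 * h ^ 3" using hp[OF h] by (intro mult_left_mono) auto
    finally have "exp D * (norm (\<phi> h))\<^sup>2 \<le> exp D * (D\<^sup>2 * h ^ 3)" by simp
    moreover have "norm ((b - c) * h\<^sup>2 / 2) = norm (b - c) * h\<^sup>2 / 2"
      by (simp add: norm_mult norm_divide norm_power)
    moreover have "norm ((b - c) * h\<^sup>2 / 2) \<le> 2 * C * h ^ 3 + exp D * (norm (\<phi> h))\<^sup>2"
      using key[OF h] a by simp
    moreover have "m \<le> 2 * (p + F)" if "E \<le> F" "N = m / 2" "N \<le> p + E" for E F N m p :: real
      using that by simp
    ultimately have "norm (b - c) * h\<^sup>2 \<le> 2 * (2 * C * h ^ 3 + exp D * (D\<^sup>2 * h ^ 3))"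
      by blast
    also have "\<dots> = (2 * (2 * C + exp D * D\<^sup>2)) * h * h\<^sup>2"
      by (simp add: algebra_simps power2_eq_square power3_eq_cube)
    finally have "norm (b - c) * h\<^sup>2 \<le> (2 * (2 * C + exp D * D\<^sup>2)) * h * h\<^sup>2" .
    then show "norm (b - c) \<le> (2 * (2 * C + exp D * D\<^sup>2)) * h"
      using h by simp
  qed
  then show "b = c" by simp
qed

lemma has_field_derivative_real_on_reals:
  fixes f :: "complex \<Rightarrow> complex" and x :: real
  assumes D: "(f has_field_derivative D) (at (of_real x))"
    and "e > 0" and re: "\<And>y. \<bar>y - x\<bar> < e \<Longrightarrow> f (of_real y) \<in> \<real>"
  shows "D \<in> \<real>"
proof -
  have "((\<lambda>h. (f (of_real x + h) - f (of_real x)) / h) \<longlongrightarrow> D) (at 0)"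
    using D by (simp add: DERIV_def)
  moreover have "filterlim (complex_of_real) (at 0) (at 0)"
    by (auto simp: filterlim_at intro!: tendsto_eq_intros eventually_at_filter[THEN iffD2])
  ultimately have lim: "((\<lambda>h. (f (of_real x + of_real h) - f (of_real x)) / of_real h) \<longlongrightarrow> D) (at (0::real))"
    by (rule filterlim_compose)
  show ?thesis
  proof (rule Lim_in_closed_set[OF closed_complex_Reals _ _ lim])
    show "\<forall>\<^sub>F h in at (0::real). (f (of_real x + of_real h) - f (of_real x)) / of_real h \<in> \<real>"
      unfolding eventually_at
    proof (intro exI[of _ e] conjI ballI impI \<open>e > 0\<close>)
      fix h :: real assume "h \<noteq> 0 \<and> dist h 0 < e"
      then have "f (of_real (x + h)) \<in> \<real>" "f (of_real x) \<in> \<real>"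
        using \<open>e > 0\<close> by (auto intro!: re simp del: of_real_add)
      then show "(f (of_real x + of_real h) - f (of_real x)) / of_real h \<in> \<real>"
        by (auto intro!: Reals_divide Reals_diff)
    qed
  qed simp
qed

lemma laplace_transform_of_real:
  assumes F: "real_distribution F" and i: "integrable F (\<lambda>x. exp (complex_of_real h * complex_of_real x))"
  shows "integrable F (\<lambda>x. exp (h * x))"
    and "laplace_transform F (complex_of_real h) = complex_of_real (LINT x|F. exp (h * x))"
    and "(LINT x|F. exp (h * x)) > 0"
proof -
  interpret real_distribution F by fact
  have e: "exp (complex_of_real h * complex_of_real x) = complex_of_real (exp (h * x))" for x
    by (simp add: exp_of_real[symmetric])
  have i': "complex_integrable F (\<lambda>x. complex_of_real (exp (h * x)))" using i by (simp only: e)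
  then show int: "integrable F (\<lambda>x. exp (h * x))"
    by (simp only: complex_of_real_integrable_eq)
  show "laplace_transform F (complex_of_real h) = complex_of_real (LINT x|F. exp (h * x))"
    unfolding laplace_transform_def e by (rule integral_complex_of_real)
  have "(LINT x|F. exp (h * x)) \<noteq> 0"
  proof
    assume "(LINT x|F. exp (h * x)) = 0"
    then have "AE x in F. exp (h * x) = 0"
      using integral_nonneg_eq_0_iff_AE[OF int] by auto
    then show False by simp
  qed
  moreover have "(LINT x|F. exp (h * x)) \<ge> 0" by (rule integral_nonneg_AE) simp
  ultimately show "(LINT x|F. exp (h * x)) > 0" by linarith
qed

lemma exp_quadratic_remainder:
  fixes u :: real
  shows "\<bar>exp u - (1 + u + u\<^sup>2 / 2)\<bar> \<le> \<bar>u\<bar> ^ 3 / 2 * exp \<bar>u\<bar>"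
proof -
  have "norm (exp u - (\<Sum>i\<le>2. u ^ i / fact i)) \<le> exp (norm u) * norm u ^ Suc 2 / fact 2"
    by (rule Taylor_exp_field)
  then show ?thesis by (simp add: numeral_2_eq_2 eval_nat_numeral algebra_simps)
qed

lemma power3_le_exp: "x ^ 3 \<le> 6 * exp x" if "x \<ge> 0" for x :: real
proof -
  have "(\<Sum>n<4. x ^ n /\<^sub>R fact n) \<le> exp x"
    unfolding exp_def using that by (intro sum_le_suminf summable_exp_generic) auto
  then have "1 + x + x\<^sup>2 / 2 + x ^ 3 / 6 \<le> exp x" by (simp add: eval_nat_numeral fact_numeral)
  then show ?thesis using that zero_le_power2[of x] by linarith
qed

text \<open>\<open>C\<close> depends on \<open>F\<close>. This does no harm: the expansion only
  identifies mean and variance as coefficients at 0 and enters no quantitative bound.\<close>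

lemma real_laplace_expansion:
  assumes F: "real_distribution F"
    and i2: "integrable F (\<lambda>x. exp (2 * x))" "integrable F (\<lambda>x. exp (- 2 * x))"
    and mean: "prob_space.expectation F (\<lambda>x. x) = 0"
  obtains C where "C \<ge> 0"
    "\<And>h. \<bar>h\<bar> \<le> 1 \<Longrightarrow> \<bar>(LINT x|F. exp (h * x)) - (1 + prob_space.variance F (\<lambda>x. x) * h\<^sup>2 / 2)\<bar> \<le> C * \<bar>h\<bar> ^ 3"
proof -
  interpret real_distribution F by fact
  have ie: "integrable F (\<lambda>x. exp (2 * \<bar>x\<bar>))"
  proof (rule Bochner_Integration.integrable_bound)
    show "integrable F (\<lambda>x. exp (2 * x) + exp (- 2 * x))" by (intro Bochner_Integration.integrable_add i2)
    have "exp (2 * \<bar>x\<bar>) \<le> exp (2 * x) + exp (- 2 * x)" for x :: real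
      by (cases "x \<ge> 0") auto
    then show "AE x in F. norm (exp (2 * \<bar>x\<bar>)) \<le> norm (exp (2 * x) + exp (- 2 * x))"
      by (auto intro: order_trans[OF _ abs_ge_self])
  qed auto
  have b1: "\<bar>x\<bar> \<le> exp (2 * \<bar>x\<bar>)" for x :: real
    using exp_ge_add_one_self[of "2 * \<bar>x\<bar>"] by linarith
  have b2: "x\<^sup>2 \<le> exp (2 * \<bar>x\<bar>)" for x :: real
  proof -
    have "1 + 2 * \<bar>x\<bar> + 2 * x\<^sup>2 \<le> exp (2 * \<bar>x\<bar>)"
      using exp_lower_Taylor_quadratic[of "2 * \<bar>x\<bar>"] by (simp add: power_mult_distrib)
    then show ?thesis using zero_le_power2[of x] abs_ge_zero[of x] by linarith
  qed
  have ix: "integrable F (\<lambda>x. x)"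
    by (rule Bochner_Integration.integrable_bound[OF ie]) (use b1 in auto)
  have ix2: "integrable F (\<lambda>x. x\<^sup>2)"
    by (rule Bochner_Integration.integrable_bound[OF ie]) (use b2 in auto)
  have ih: "integrable F (\<lambda>x. exp (h * x))" if "\<bar>h\<bar> \<le> 1" for h
  proof (rule Bochner_Integration.integrable_bound[OF ie])
    have "h * x \<le> 2 * \<bar>x\<bar>" for x
    proof -
      have "h * x \<le> \<bar>h\<bar> * \<bar>x\<bar>" by (metis abs_ge_self abs_mult)
      also have "\<dots> \<le> 2 * \<bar>x\<bar>" using that by (intro mult_right_mono) auto
      finally show ?thesis .
    qed
    then show "AE x in F. norm (exp (h * x)) \<le> norm (exp (2 * \<bar>x\<bar>))" by simp
  qed auto
  define C where "C = 3 * expectation (\<lambda>x. exp (2 * \<bar>x\<bar>))"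
  show thesis
  proof (rule that[of C])
    show "C \<ge> 0" by (simp add: C_def integral_nonneg_AE)
    fix h :: real assume h: "\<bar>h\<bar> \<le> 1"
    let ?r = "\<lambda>x. exp (h * x) - (1 + h * x + (h * x)\<^sup>2 / 2)"
    have ir: "integrable F ?r"
      using ih[OF h] ix ix2 by (auto simp: power_mult_distrib)
    have "(LINT x|F. ?r x) = (LINT x|F. exp (h * x)) - (1 + variance (\<lambda>x. x) * h\<^sup>2 / 2)"
      using ih[OF h] ix ix2 prob_space by (simp add: power_mult_distrib mean mult.commute)
    moreover have "\<bar>LINT x|F. ?r x\<bar> \<le> (LINT x|F. \<bar>?r x\<bar>)" by (rule integral_abs_bound)
    moreover have "(LINT x|F. \<bar>?r x\<bar>) \<le> (LINT x|F. (3 * \<bar>h\<bar> ^ 3) * exp (2 * \<bar>x\<bar>))"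
    proof (rule integral_mono)
      fix x
      have "\<bar>?r x\<bar> \<le> \<bar>h * x\<bar> ^ 3 / 2 * exp \<bar>h * x\<bar>" by (rule exp_quadratic_remainder)
      also have "\<dots> \<le> \<bar>h * x\<bar> ^ 3 / 2 * exp \<bar>x\<bar>"
        using h by (intro mult_left_mono) (auto simp: abs_mult mult_left_le_one_le)
      also have "\<dots> = \<bar>h\<bar> ^ 3 / 2 * (\<bar>x\<bar> ^ 3 * exp \<bar>x\<bar>)" by (simp add: abs_mult power_mult_distrib)
      also have "\<dots> \<le> \<bar>h\<bar> ^ 3 / 2 * ((6 * exp \<bar>x\<bar>) * exp \<bar>x\<bar>)"
        by (intro mult_left_mono mult_right_mono power3_le_exp) auto
      also have "\<dots> = (3 * \<bar>h\<bar> ^ 3) * exp (2 * \<bar>x\<bar>)" by (simp flip: exp_add)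
      finally show "\<bar>?r x\<bar> \<le> (3 * \<bar>h\<bar> ^ 3) * exp (2 * \<bar>x\<bar>)" .
    qed (use ir ie in auto)
    ultimately show "\<bar>(LINT x|F. exp (h * x)) - (1 + variance (\<lambda>x. x) * h\<^sup>2 / 2)\<bar> \<le> C * \<bar>h\<bar> ^ 3"
      by (simp add: C_def mult_ac)
  qed
qed

text \<open>\<open>K\<close>, \<open>m\<close>, \<open>w\<close> are the logarithm of the transform
  and its first two derivatives on the real axis. This is what the sequel uses of the class. All
  remainders carry the factor \<open>v\<close>, because the third derivative is bounded by v/8; |h|,
  |t| \<le> 2 keeps h + i t inside the disc of radius 8.\<close>

lemma class_A1_cumulant_expansion:
  assumes F: "F \<in> class_A1 (1 / 8)" and mean: "prob_space.expectation F (\<lambda>x. x) = 0"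
    and v: "v = prob_space.variance F (\<lambda>x. x)"
  obtains K m w :: "real \<Rightarrow> real" where
    "\<And>h. \<bar>h\<bar> \<le> 2 \<Longrightarrow> integrable F (\<lambda>x. exp (h * x))"
    "\<And>h. \<bar>h\<bar> \<le> 2 \<Longrightarrow> (LINT x|F. exp (h * x)) = exp (K h)"
    "\<And>h. \<bar>h\<bar> \<le> 2 \<Longrightarrow> \<bar>K h - v * h\<^sup>2 / 2\<bar> \<le> v * \<bar>h\<bar> ^ 3 / 16"
    "\<And>h. \<bar>h\<bar> \<le> 2 \<Longrightarrow> \<bar>m h - v * h\<bar> \<le> v * h\<^sup>2 / 8"
    "\<And>h. \<bar>h\<bar> \<le> 2 \<Longrightarrow> \<bar>w h - v\<bar> \<le> v * \<bar>h\<bar> / 8"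
    "\<And>h t. \<bar>h\<bar> \<le> 2 \<Longrightarrow> \<bar>t\<bar> \<le> 2 \<Longrightarrow>
       integrable F (\<lambda>x. exp (Complex h t * complex_of_real x)) \<and>
       (\<exists>R. norm R \<le> v * \<bar>t\<bar> ^ 3 / 16 \<and>
         laplace_transform F (Complex h t) = exp (K h) * exp (\<i> * (t * m h) - t\<^sup>2 * w h / 2 + R))"
proof -
  from F obtain \<phi> where rd: "real_distribution F" and ll: "is_log_laplace (1 / 8) F \<phi>"
    and d3: "\<And>z. norm z < 8 \<Longrightarrow> norm ((deriv ^^ 3) \<phi> z) \<le> v / 8"
    by (auto simp: class_A1_def v)
  interpret real_distribution F by fact
  let ?S = "ball (0::complex) 8"
  have Seq: "{z::complex. norm z * (1 / 8) < 1} = ?S" by auto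
  have hol: "\<phi> holomorphic_on ?S" and \<phi>0: "\<phi> 0 = 0"
    using ll by (auto simp: is_log_laplace_def Seq analytic_imp_holomorphic simp del: times_divide_eq_right mult_1_right)
  have L: "integrable F (\<lambda>x. exp (z * complex_of_real x))" "exp (\<phi> z) = laplace_transform F z" if "z \<in> ?S" for z
    using ll that by (auto simp: is_log_laplace_def)
  define d where "d n = (deriv ^^ n) \<phi>" for n
  have D: "(d n has_field_derivative d (Suc n) z) (at z)" if "z \<in> ?S" for n z
    using holomorphic_derivI[OF holomorphic_higher_deriv[OF hol open_ball] open_ball that] by (simp add: d_def)
  \<comment> \<open>Taylor expansion of the k-th derivative, always stopped at the third derivative
    of \<phi>.\<close>
  have tay: "norm (d k z - (\<Sum>i\<le>n. d (i + k) a * (z - a) ^ i / fact i)) \<le> v / 8 * norm (z - a) ^ Suc n / fact n"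
    if "n + k = 2" "z \<in> ?S" "a \<in> ?S" for n k z a
  proof -
    have "norm (d (0 + k) z - (\<Sum>i\<le>n. d (i + k) a * (z - a) ^ i / fact i)) \<le> v / 8 * norm (z - a) ^ Suc n / fact n"
    proof (rule complex_Taylor[where S = ?S and f = "\<lambda>i. d (i + k)"])
      fix i x assume "x \<in> ?S"
      then show "(d (i + k) has_field_derivative d (Suc i + k) x) (at x within ?S)"
        using D[of x "i + k"] by (auto intro: DERIV_subset)
    next
      fix x assume "x \<in> ?S"
      moreover have "Suc n + k = 3" using that by simp
      ultimately show "norm (d (Suc n + k) x) \<le> v / 8"
        using d3[of x] unfolding d_def by (metis mem_ball_0)
    qed (use that in auto)
    then show ?thesis by simp
  qed
  have inS: "complex_of_real h \<in> ?S" if "\<bar>h\<bar> < 8" for h using that by simp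
  have t0: "norm (\<phi> z - (\<phi> a + d 1 a * (z - a) + d 2 a * (z - a)\<^sup>2 / 2)) \<le> v * norm (z - a) ^ 3 / 16"
    if "z \<in> ?S" "a \<in> ?S" for z a
    using tay[of 2 0 z a] that by (simp add: d_def numeral_2_eq_2 eval_nat_numeral algebra_simps)
  have t1: "norm (d 1 z - (d 1 a + d 2 a * (z - a))) \<le> v * norm (z - a) ^ 2 / 8"
    if "z \<in> ?S" "a \<in> ?S" for z a
    using tay[of 1 1 z a] that by (simp add: numeral_2_eq_2 power2_eq_square)
  have t2: "norm (d 2 z - d 2 a) \<le> v * norm (z - a) / 8"
    if "z \<in> ?S" "a \<in> ?S" for z a
    using tay[of 0 2 z a] that by (simp add: numeral_2_eq_2)
  have rl: "integrable F (\<lambda>x. exp (h * x))" "exp (\<phi> h) = complex_of_real (LINT x|F. exp (h * x))" "(LINT x|F. exp (h * x)) > 0"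
    if "\<bar>h\<bar> < 8" for h :: real
    using laplace_transform_of_real[OF rd L(1)[OF inS[OF that]]] L(2)[OF inS[OF that]] by auto
  have v0: "v \<ge> 0" unfolding v by simp
  obtain C where C: "C \<ge> 0"
    "\<And>h. \<bar>h\<bar> \<le> 1 \<Longrightarrow> \<bar>(LINT x|F. exp (h * x)) - (1 + v * h\<^sup>2 / 2)\<bar> \<le> C * \<bar>h\<bar> ^ 3"
    using real_laplace_expansion[OF rd rl(1)[of 2] rl(1)[of "-2"] mean] unfolding v by auto
  have coeff: "d 1 0 = 0" "d 2 0 = complex_of_real v"
  proof -
    have *: "norm (\<phi> (complex_of_real h) - (d 1 0 * h + d 2 0 * h\<^sup>2 / 2)) \<le> (v / 16 + C) * h ^ 3"
      "norm (exp (\<phi> (complex_of_real h)) - (1 + complex_of_real v * h\<^sup>2 / 2)) \<le> (v / 16 + C) * h ^ 3"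
      if h: "0 < h" "h \<le> 1" for h
    proof -
      have a: "v * h ^ 3 / 16 \<le> (v / 16 + C) * h ^ 3" "C * h ^ 3 \<le> (v / 16 + C) * h ^ 3"
        using C(1) v0 h by (auto simp: algebra_simps)
      have "norm (\<phi> (complex_of_real h) - (d 1 0 * h + d 2 0 * h\<^sup>2 / 2)) \<le> v * h ^ 3 / 16"
        using t0[of "complex_of_real h" 0] h \<phi>0 by simp
      from this a(1) show "norm (\<phi> (complex_of_real h) - (d 1 0 * h + d 2 0 * h\<^sup>2 / 2)) \<le> (v / 16 + C) * h ^ 3"
        by (rule order_trans)
      have "exp (\<phi> (complex_of_real h)) - (1 + complex_of_real v * h\<^sup>2 / 2) =
        complex_of_real ((LINT x|F. exp (h * x)) - (1 + v * h\<^sup>2 / 2))"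
        using rl(2)[of h] h by simp
      moreover have "\<bar>(LINT x|F. exp (h * x)) - (1 + v * h\<^sup>2 / 2)\<bar> \<le> C * h ^ 3"
        using C(2)[of h] h by simp
      note order_trans[OF this a(2)]
      ultimately show "norm (exp (\<phi> (complex_of_real h)) - (1 + complex_of_real v * h\<^sup>2 / 2)) \<le> (v / 16 + C) * h ^ 3"
        by (simp only: norm_of_real)
    qed
    show "d 1 0 = 0" "d 2 0 = complex_of_real v"
      by (rule log_expansion_coefficients[where \<phi> = "\<lambda>h. \<phi> (complex_of_real h)" and C = "v / 16 + C", OF _ *];
          use C(1) v0 in simp)+
  qed
  \<comment> \<open>Reality of exp \<phi> on the axis determines \<phi> there only modulo multiples
    of pi i. Differentiating exp \<phi> and dividing by it yields reality of the derivative without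
    fixing the branch.\<close>
  have re1: "d 1 (complex_of_real h) \<in> \<real>" if h: "\<bar>h\<bar> < 8" for h
  proof -
    have "((\<lambda>z. exp (\<phi> z)) has_field_derivative exp (\<phi> h) * d 1 h) (at (complex_of_real h))"
      using D[of "complex_of_real h" 0] h by (auto intro!: derivative_eq_intros simp: d_def)
    then have "exp (\<phi> h) * d 1 h \<in> \<real>"
    proof (rule has_field_derivative_real_on_reals[where e = "8 - \<bar>h\<bar>"])
      fix y assume "\<bar>y - h\<bar> < 8 - \<bar>h\<bar>"
      then have "\<bar>y\<bar> < 8" by linarith
      then show "exp (\<phi> (complex_of_real y)) \<in> \<real>" using rl(2)[of y] by simp
    qed (use h in auto)
    then have "exp (\<phi> h) * d 1 h / exp (\<phi> h) \<in> \<real>"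
      using rl(2)[OF h] by (intro Reals_divide) auto
    then show ?thesis by simp
  qed
  have re2: "d 2 (complex_of_real h) \<in> \<real>" if h: "\<bar>h\<bar> < 8" for h
  proof (rule has_field_derivative_real_on_reals[where e = "8 - \<bar>h\<bar>" and f = "d 1"])
    show "(d 1 has_field_derivative d 2 (complex_of_real h)) (at (complex_of_real h))"
      using D[of "complex_of_real h" 1] h by (simp add: numeral_2_eq_2)
    fix y assume "\<bar>y - h\<bar> < 8 - \<bar>h\<bar>"
    then have "\<bar>y\<bar> < 8" by linarith
    then show "d 1 (complex_of_real y) \<in> \<real>" by (rule re1)
  qed (use h in auto)
  define K m w where "K h = Re (\<phi> (complex_of_real h))" and "m h = Re (d 1 (complex_of_real h))"
    and "w h = Re (d 2 (complex_of_real h))" for h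
  have mw: "d 1 (complex_of_real h) = complex_of_real (m h)" "d 2 (complex_of_real h) = complex_of_real (w h)"
    if "\<bar>h\<bar> < 8" for h
    using re1[OF that] re2[OF that] by (simp_all add: m_def w_def of_real_Re)
  have Kexp: "(LINT x|F. exp (h * x)) = exp (K h)" if h: "\<bar>h\<bar> < 8" for h
  proof -
    have "norm (exp (\<phi> h)) = (LINT x|F. exp (h * x))"
      using rl(2,3)[OF h] by (simp only: norm_of_real)
    then show ?thesis by (simp add: K_def)
  qed
  show thesis
  proof (rule that[of K m w])
    fix h :: real assume "\<bar>h\<bar> \<le> 2"
    then have h: "\<bar>h\<bar> < 8" by simp
    show "integrable F (\<lambda>x. exp (h * x))" by (rule rl(1)[OF h])
    show "(LINT x|F. exp (h * x)) = exp (K h)" by (rule Kexp[OF h])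
    have "complex_of_real (K h - v * h\<^sup>2 / 2) = complex_of_real (Re (\<phi> h - complex_of_real v * (complex_of_real h)\<^sup>2 / 2))"
      by (simp add: K_def flip: of_real_power)
    then have "\<bar>K h - v * h\<^sup>2 / 2\<bar> \<le> norm (\<phi> h - complex_of_real v * (complex_of_real h)\<^sup>2 / 2)"
      using abs_Re_le_cmod[of "\<phi> h - complex_of_real v * (complex_of_real h)\<^sup>2 / 2"] by (simp only: of_real_eq_iff)
    then show "\<bar>K h - v * h\<^sup>2 / 2\<bar> \<le> v * \<bar>h\<bar> ^ 3 / 16"
      using t0[of "complex_of_real h" 0] h by (simp add: coeff coeff(1)[unfolded One_nat_def] \<phi>0)
    have "\<bar>m h - v * h\<bar> = norm (d 1 (complex_of_real h) - complex_of_real v * h)"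
      using mw(1)[OF h] by (simp flip: of_real_mult of_real_diff)
    then show "\<bar>m h - v * h\<bar> \<le> v * h\<^sup>2 / 8"
      using t1[of "complex_of_real h" 0] h by (simp add: coeff coeff(1)[unfolded One_nat_def])
    have "\<bar>w h - v\<bar> = norm (d 2 (complex_of_real h) - complex_of_real v)"
      using mw(2)[OF h] by (simp flip: of_real_mult of_real_diff)
    then show "\<bar>w h - v\<bar> \<le> v * \<bar>h\<bar> / 8"
      using t2[of "complex_of_real h" 0] h by (simp add: coeff coeff(1)[unfolded One_nat_def])
  next
    fix h t :: real assume ht: "\<bar>h\<bar> \<le> 2" "\<bar>t\<bar> \<le> 2"
    then have h: "\<bar>h\<bar> < 8" by simp
    have z: "Complex h t \<in> ?S"
      using ht cmod_le[of "Complex h t"] by simp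
    have zt: "Complex h t = complex_of_real h + \<i> * t" by (simp add: complex_eq_iff)
    show "integrable F (\<lambda>x. exp (Complex h t * complex_of_real x)) \<and>
       (\<exists>R. norm R \<le> v * \<bar>t\<bar> ^ 3 / 16 \<and>
         laplace_transform F (Complex h t) = exp (K h) * exp (\<i> * (t * m h) - t\<^sup>2 * w h / 2 + R))"
    proof (intro conjI exI L(1)[OF z])
      let ?R = "\<phi> (Complex h t) - (\<phi> h + d 1 h * (\<i> * t) + d 2 h * (\<i> * t)\<^sup>2 / 2)"
      show "norm ?R \<le> v * \<bar>t\<bar> ^ 3 / 16"
        using t0[OF z inS[OF h]] by (simp add: zt norm_mult)
      have eq: "\<phi> (Complex h t) = \<phi> h + (\<i> * (t * m h) - t\<^sup>2 * w h / 2 + ?R)"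
        by (simp add: mw[OF h] mw(1)[OF h, unfolded One_nat_def] power_mult_distrib algebra_simps)
      have "laplace_transform F (Complex h t) = exp (\<phi> h) * exp (\<i> * (t * m h) - t\<^sup>2 * w h / 2 + ?R)"
        unfolding L(2)[OF z, symmetric] exp_add[symmetric, of "\<phi> h"] by (rule arg_cong[OF eq])
      then show "laplace_transform F (Complex h t) = exp (K h) * exp (\<i> * (t * m h) - t\<^sup>2 * w h / 2 + ?R)"
        using rl(2)[OF h] Kexp[OF h] by simp
    qed
  qed
qed

section \<open>Tails of the normal distribution\<close>

text \<open>The normal tail at a + q with the factor exp (- a^2 / 2) taken out. At q = 0 it is the
  Mills ratio divided by sqrt (2 pi), and also what undoing the tilt produces for a centred normal
  law.\<close>

definition normal_laplace_tail :: "real \<Rightarrow> real \<Rightarrow> real" where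
  "normal_laplace_tail a q = (LINT u|lborel. std_normal_density u * exp (- a * u) * indicator {q..} u)"

lemma std_normal_density_shift:
  "std_normal_density (u + c) = std_normal_density u * exp (- c * u) * exp (- c\<^sup>2 / 2)"
  by (simp add: std_normal_density_def exp_add[symmetric] power2_eq_square field_simps)

lemma integrable_normal_exp: "integrable lborel (\<lambda>u. std_normal_density u * exp (- a * u))"
proof -
  have "integrable lborel (\<lambda>u. std_normal_density (a + 1 * u))"
    using lborel_integrable_real_affine[of std_normal_density 1 a] by simp
  then have "integrable lborel (\<lambda>u. exp (a\<^sup>2 / 2) * std_normal_density (u + a))"
    by (intro integrable_mult_right) (simp add: add.commute)
  moreover have "exp (a\<^sup>2 / 2) * std_normal_density (u + a) = std_normal_density u * exp (- a * u)" for u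
  proof -
    have "exp (a\<^sup>2 / 2) * exp (- a\<^sup>2 / 2) = 1" by (simp flip: exp_add)
    then show ?thesis unfolding std_normal_density_shift by (simp only: mult_ac mult_1_right)
  qed
  ultimately show ?thesis by simp
qed

lemma integrable_normal_exp_indicator:
  "integrable lborel (\<lambda>u. std_normal_density u * exp (- a * u) * indicator {q..} u)"
  by (rule Bochner_Integration.integrable_bound[OF integrable_normal_exp[of a]]) (auto simp: indicator_def)

lemma normal_laplace_tail_nonneg: "normal_laplace_tail a q \<ge> 0"
  unfolding normal_laplace_tail_def by (intro integral_nonneg_AE) auto

lemma measure_std_normal_tail:
  "measure std_normal_distribution {a + q..} = exp (- a\<^sup>2 / 2) * normal_laplace_tail a q"
proof -
  have "measure std_normal_distribution {a + q..} = (LINT x|std_normal_distribution. indicator {a + q..} x)"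
    by simp
  also have "\<dots> = (LINT x|lborel. std_normal_density x * indicator {a + q..} x)"
    by (subst integral_density) auto
  also have "\<dots> = (LINT u|lborel. std_normal_density (a + u) * indicator {a + q..} (a + u))"
    using lborel_integral_real_affine[of 1 "\<lambda>x. std_normal_density x * indicator {a + q..} x" a] by simp
  also have "\<dots> = (LINT u|lborel. exp (- a\<^sup>2 / 2) * (std_normal_density u * exp (- a * u) * indicator {q..} u))"
    using std_normal_density_shift[of _ a]
    by (intro Bochner_Integration.integral_cong) (auto simp: add.commute indicator_def)
  finally show ?thesis by (simp only: integral_mult_right_zero normal_laplace_tail_def)
qed

lemma normal_laplace_tail_shift:
  "normal_laplace_tail a (q + c) =
    (LINT x|lborel. std_normal_density (x + c) * exp (- a * (x + c)) * indicator {q..} x)"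
  "integrable lborel (\<lambda>x. std_normal_density (x + c) * exp (- a * (x + c)) * indicator {q..} x)"
proof -
  have e: "std_normal_density (c + 1 * x) * exp (- a * (c + 1 * x)) * indicator {q + c..} (c + 1 * x) =
      std_normal_density (x + c) * exp (- a * (x + c)) * indicator {q..} x" for x
    by (auto simp: add.commute indicator_def)
  show "normal_laplace_tail a (q + c) =
    (LINT x|lborel. std_normal_density (x + c) * exp (- a * (x + c)) * indicator {q..} x)"
    using lborel_integral_real_affine[of 1 "\<lambda>u. std_normal_density u * exp (- a * u) * indicator {q + c..} u" c]
    unfolding normal_laplace_tail_def e by simp
  show "integrable lborel (\<lambda>x. std_normal_density (x + c) * exp (- a * (x + c)) * indicator {q..} x)"
    using lborel_integrable_real_affine[OF integrable_normal_exp_indicator[of a "q + c"], of 1 c]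
    by (simp only: e)
qed

text \<open>Two shifts for two kinds of error: \<open>p\<close> gains additive mass from the window
  of length \<open>p\<close> just left of 0, and \<open>q\<close> gains a factor. The loss is q^2
  rather than q^2 / 2 because on that window (x - q)^2 is estimated by 2 p^2 + 2 q^2.\<close>

lemma normal_laplace_tail_ge:
  assumes "a \<ge> 0" "p \<ge> 0" "q \<ge> 0"
  shows "normal_laplace_tail a (- (p + q)) \<ge>
    exp (a * q - q\<^sup>2) * (normal_laplace_tail a 0 + p * (exp (- p\<^sup>2) / sqrt (2 * pi)))"
proof -
  let ?f = "\<lambda>x. exp (a * q - q\<^sup>2) * (std_normal_density x * exp (- a * x) * indicator {0..} x
      + exp (- p\<^sup>2) / sqrt (2 * pi) * indicator {-p..<0} x)"
  let ?g = "\<lambda>x. std_normal_density (x + (- q)) * exp (- a * (x + (- q))) * indicator {-p..} x"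
  have i1: "integrable lborel (\<lambda>x. exp (- p\<^sup>2) / sqrt (2 * pi) * indicator {-p..<0} x)"
    by (intro integrable_mult_right integrable_real_indicator) (auto simp: assms)
  have "exp (a * q - q\<^sup>2) * (normal_laplace_tail a 0 + p * (exp (- p\<^sup>2) / sqrt (2 * pi))) = (LINT x|lborel. ?f x)"
    unfolding normal_laplace_tail_def integral_mult_right_zero
      Bochner_Integration.integral_add[OF integrable_normal_exp_indicator i1]
    using assms by simp
  also have "\<dots> \<le> (LINT x|lborel. ?g x)"
  proof (rule integral_mono)
    show "integrable lborel ?f"
      by (intro integrable_mult_right Bochner_Integration.integrable_add integrable_normal_exp_indicator i1)
    show "integrable lborel ?g" by (rule normal_laplace_tail_shift)
    fix x
    have d: "std_normal_density (x + (- q)) * exp (- a * (x + (- q))) =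
        exp (- (x + (- q))\<^sup>2 / 2 - a * x + a * q) / sqrt (2 * pi)"
      by (simp add: std_normal_density_def exp_add[symmetric] algebra_simps)
    note d' = d[unfolded add_uminus_conv_diff mult_minus_left]
    consider "x \<ge> 0" | "- p \<le> x" "x < 0" | "x < - p" by linarith
    then show "?f x \<le> ?g x"
    proof cases
      case 1
      have "(a * q - q\<^sup>2) + (- x\<^sup>2 / 2 - a * x) \<le> - (x + (- q))\<^sup>2 / 2 - a * x + a * q"
      proof -
        have "(x + (- q))\<^sup>2 = x\<^sup>2 - 2 * (x * q) + q\<^sup>2" by (simp add: power2_eq_square algebra_simps)
        then show ?thesis using mult_nonneg_nonneg[OF 1 assms(3)] zero_le_power2[of q] by linarith
      qed
      then have "exp (a * q - q\<^sup>2) * exp (- x\<^sup>2 / 2 - a * x) / sqrt (2 * pi) \<le> exp (- (x + (- q))\<^sup>2 / 2 - a * x + a * q) / sqrt (2 * pi)"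
        by (intro divide_right_mono) (simp_all flip: exp_add)
      moreover have "std_normal_density x * exp (- a * x) = exp (- x\<^sup>2 / 2 - a * x) / sqrt (2 * pi)"
        by (simp add: std_normal_density_def exp_add[symmetric])
      ultimately show ?thesis using 1 assms by (simp add: d d')
    next
      case 2
      have "(x + (- q))\<^sup>2 \<le> (p + q)\<^sup>2"
        using 2 assms by (intro power2_le_iff_abs_le[THEN iffD2]) auto
      also have "\<dots> \<le> 2 * p\<^sup>2 + 2 * q\<^sup>2"
        using zero_le_power2[of "p - q"] by (simp add: power2_eq_square algebra_simps)
      finally have "(x + (- q))\<^sup>2 \<le> 2 * p\<^sup>2 + 2 * q\<^sup>2" .
      moreover have "a * x \<le> 0" using 2 assms by (simp add: mult_nonneg_nonpos)
      ultimately have "(a * q - q\<^sup>2) + (- p\<^sup>2) \<le> - (x + (- q))\<^sup>2 / 2 - a * x + a * q" by linarith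
      then have "exp (a * q - q\<^sup>2) * exp (- p\<^sup>2) / sqrt (2 * pi) \<le> exp (- (x + (- q))\<^sup>2 / 2 - a * x + a * q) / sqrt (2 * pi)"
        by (intro divide_right_mono) (simp_all flip: exp_add)
      then show ?thesis using 2 by (simp add: d d')
    next
      case 3
      then show ?thesis using assms by auto
    qed
  qed
  also have "\<dots> = normal_laplace_tail a (- p + (- q))"
    by (rule normal_laplace_tail_shift(1)[symmetric])
  finally show ?thesis by simp
qed

text \<open>Counterpart for shifts to the right. The mass removed from the window [0, p) is weighted
  by exp (- a p), so it is of order \<open>p\<close> only while a p stays bounded.\<close>

lemma normal_laplace_tail_le:
  assumes "a \<ge> 0" "p \<ge> 0" "q \<ge> 0"
  shows "normal_laplace_tail a (p + q) \<le>
    exp (- a * q) * (normal_laplace_tail a 0 - p * (exp (- a * p - p\<^sup>2 / 2) / sqrt (2 * pi)))"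
proof -
  let ?f = "\<lambda>x. exp (- a * q) * (std_normal_density x * exp (- a * x) * indicator {0..} x
      - exp (- a * p - p\<^sup>2 / 2) / sqrt (2 * pi) * indicator {0..<p} x)"
  let ?g = "\<lambda>x. std_normal_density (x + q) * exp (- a * (x + q)) * indicator {p..} x"
  have i1: "integrable lborel (\<lambda>x. exp (- a * p - p\<^sup>2 / 2) / sqrt (2 * pi) * indicator {0..<p} x)"
    by (intro integrable_mult_right integrable_real_indicator) (auto simp: assms)
  have dx: "std_normal_density x * exp (- a * x) = exp (- a * x - x\<^sup>2 / 2) / sqrt (2 * pi)" for x
    by (simp add: std_normal_density_def exp_add[symmetric])
  have "normal_laplace_tail a (p + q) = (LINT x|lborel. ?g x)"
    by (rule normal_laplace_tail_shift)
  also have "\<dots> \<le> (LINT x|lborel. ?f x)"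
  proof (rule integral_mono)
    show "integrable lborel ?f"
      by (intro integrable_mult_right Bochner_Integration.integrable_diff integrable_normal_exp_indicator i1)
    show "integrable lborel ?g" by (rule normal_laplace_tail_shift)
    fix x
    consider "x < 0" | "0 \<le> x" "x < p" | "x \<ge> p" by linarith
    then show "?g x \<le> ?f x"
    proof cases
      case 2
      have "a * x \<le> a * p" "x\<^sup>2 \<le> p\<^sup>2" using 2 assms by (auto intro!: mult_left_mono power_mono)
      then have "- a * p - p\<^sup>2 / 2 \<le> - a * x - x\<^sup>2 / 2" by simp
      then have "exp (- a * p - p\<^sup>2 / 2) / sqrt (2 * pi) \<le> std_normal_density x * exp (- a * x)"
        unfolding dx by (intro divide_right_mono) simp_all
      then show ?thesis using 2 by simp
    next
      case 3
      have "- a * (x + q) - (x + q)\<^sup>2 / 2 \<le> - a * q + (- a * x - x\<^sup>2 / 2)"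
        using 3 assms mult_nonneg_nonneg[of x q] zero_le_power2[of q] by (simp add: power2_eq_square algebra_simps)
      then have "exp (- a * (x + q) - (x + q)\<^sup>2 / 2) / sqrt (2 * pi) \<le> exp (- a * q) * exp (- a * x - x\<^sup>2 / 2) / sqrt (2 * pi)"
        by (intro divide_right_mono) (simp_all flip: exp_add)
      then show ?thesis using 3 assms by (simp only: dx) simp
    qed (use assms in auto)
  qed
  also have "\<dots> = exp (- a * q) * (normal_laplace_tail a 0 - p * (exp (- a * p - p\<^sup>2 / 2) / sqrt (2 * pi)))"
    unfolding normal_laplace_tail_def integral_mult_right_zero
      Bochner_Integration.integral_diff[OF integrable_normal_exp_indicator i1]
    using assms by simp
  finally show ?thesis .
qed

lemma std_normal_density_le_1: "std_normal_density u \<le> 1"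
proof -
  have "1 \<le> sqrt (2 * pi)" using pi_gt3 by (intro real_le_rsqrt) simp
  moreover have "exp (- u\<^sup>2 / 2) \<le> 1" by simp
  ultimately show ?thesis unfolding std_normal_density_def
    using mult_mono[of "1 / sqrt (2 * pi)" 1 "exp (- u\<^sup>2 / 2)" 1] by simp
qed

text \<open>Serves to replace the tilted variance \<open>w\<close> by \<open>v\<close>. The
  quadratic decay in \<open>m\<close> is essential: there |a - b| is of order h^2 sqrt v and m^2 of
  order h^2 v, so \<open>h\<close> cancels and an error of order 1/sqrt v remains.\<close>

lemma normal_laplace_tail_lipschitz:
  assumes m: "0 < m" "m \<le> a" "m \<le> b"
  shows "\<bar>normal_laplace_tail a 0 - normal_laplace_tail b 0\<bar> \<le> 7 * pi * \<bar>a - b\<bar> / m\<^sup>2"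
proof -
  let ?n = "std_normal_density"
  let ?d = "\<lambda>u. ?n u * exp (- a * u) * indicator {0..} u - ?n u * exp (- b * u) * indicator {0..} u"
  have key: "\<bar>exp (- a * u) - exp (- b * u)\<bar> \<le> (7 * \<bar>a - b\<bar> / m) / (1 + (m * u)\<^sup>2)" if u: "u \<ge> 0" for u
  proof -
    have lip: "exp (- x) - exp (- y) \<le> (y - x) * exp (- x)" for x y :: real
    proof -
      have "1 + (x - y) \<le> exp (x - y)" by (rule exp_ge_add_one_self)
      then have "(1 + (x - y)) * exp (- x) \<le> exp (x - y) * exp (- x)" by (rule mult_right_mono) simp
      also have "\<dots> = exp (- y)" by (simp flip: exp_add)
      finally show ?thesis by (simp add: algebra_simps)
    qed
    have "\<bar>exp (- a * u) - exp (- b * u)\<bar> \<le> \<bar>a - b\<bar> * u * exp (- m * u)"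
    proof (cases "a \<le> b")
      case True
      have "exp (- (a * u)) - exp (- (b * u)) \<le> (b * u - a * u) * exp (- (a * u))" by (rule lip)
      also have "\<dots> \<le> (b * u - a * u) * exp (- (m * u))"
        using True u m by (intro mult_left_mono) (auto simp: mult_right_mono)
      finally show ?thesis using True u by (simp add: algebra_simps mult_right_mono)
    next
      case False
      have "exp (- (b * u)) - exp (- (a * u)) \<le> (a * u - b * u) * exp (- (b * u))" by (rule lip)
      also have "\<dots> \<le> (a * u - b * u) * exp (- (m * u))"
        using False u m by (intro mult_left_mono) (auto simp: mult_right_mono)
      finally show ?thesis using False u by (simp add: algebra_simps mult_right_mono abs_minus_commute)
    qed
    also have "\<dots> = \<bar>a - b\<bar> / m * ((m * u) * exp (- (m * u)))" using m by simp
    also have "\<dots> \<le> \<bar>a - b\<bar> / m * (7 / (1 + (m * u)\<^sup>2))"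
    proof (rule mult_left_mono)
      define y where "y = m * u"
      have y: "y \<ge> 0" using m u by (simp add: y_def)
      have 1: "y \<le> exp y" using exp_ge_add_one_self[of y] by linarith
      have "y ^ 3 \<le> 6 * exp y" by (rule power3_le_exp[OF y])
      with 1 have "y * (1 + y\<^sup>2) \<le> 7 * exp y" by (simp add: power2_eq_square power3_eq_cube algebra_simps)
      moreover have "1 + y\<^sup>2 > 0" by (simp add: add_pos_nonneg)
      ultimately have "y / exp y \<le> 7 / (1 + y\<^sup>2)" by (simp add: field_simps)
      then show "(m * u) * exp (- (m * u)) \<le> 7 / (1 + (m * u)\<^sup>2)"
        by (simp add: y_def exp_minus divide_inverse)
    qed (use m in auto)
    finally show ?thesis by (simp add: mult.commute)
  qed
  have "\<bar>normal_laplace_tail a 0 - normal_laplace_tail b 0\<bar> = \<bar>LINT u|lborel. ?d u\<bar>"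
    unfolding normal_laplace_tail_def
    by (simp only: Bochner_Integration.integral_diff[OF integrable_normal_exp_indicator integrable_normal_exp_indicator])
  also have "\<dots> \<le> (LINT u|lborel. \<bar>?d u\<bar>)" by (rule integral_abs_bound)
  also have "\<dots> \<le> (7 * \<bar>a - b\<bar> / m) * pi / m"
  proof (rule integral_le_cauchy(2)[OF m(1)])
    fix u
    show "\<bar>?d u\<bar> \<le> (7 * \<bar>a - b\<bar> / m) / (1 + (m * u)\<^sup>2)"
    proof (cases "u \<ge> 0")
      case True
      then have "\<bar>?d u\<bar> = ?n u * \<bar>exp (- a * u) - exp (- b * u)\<bar>"
        by (simp add: abs_mult flip: right_diff_distrib)
      also have "\<dots> \<le> 1 * \<bar>exp (- a * u) - exp (- b * u)\<bar>"
        by (intro mult_right_mono std_normal_density_le_1) auto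
      also have "\<dots> \<le> (7 * \<bar>a - b\<bar> / m) / (1 + (m * u)\<^sup>2)"
        using key[OF True] by simp
      finally show ?thesis .
    qed (use m in auto)
  qed auto
  also have "\<dots> = 7 * pi * \<bar>a - b\<bar> / m\<^sup>2" by (simp add: power2_eq_square)
  finally show ?thesis .
qed

section \<open>Esscher transform and tail comparison\<close>

text \<open>A push-forward instead of a density, so that s = 0 is the point mass at 0 and needs no
  separate treatment.\<close>

definition scaled_normal :: "real \<Rightarrow> real measure" where
  "scaled_normal s = distr std_normal_distribution borel (\<lambda>x. s * x)"

lemma real_distribution_scaled_normal: "real_distribution (scaled_normal s)"
proof -
  interpret real_distribution std_normal_distribution by (rule real_dist_normal_dist)
  show ?thesis unfolding scaled_normal_def by (rule real_distribution_distr) simp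
qed

lemma char_scaled_normal: "char (scaled_normal s) t = exp (- (s * t)\<^sup>2 / 2)"
proof -
  have "char (scaled_normal s) t = char std_normal_distribution (s * t)"
    unfolding char_def scaled_normal_def
    by (subst integral_distr) (auto simp: mult_ac)
  then show ?thesis by (simp add: char_std_normal_distribution)
qed

text \<open>
  A probability measure only if \<open>k\<close> is the logarithm of \<open>\<integral> exp (h x) F(dx)\<close>; it is centred if \<open>m\<close> is
  the derivative of that logarithm.
\<close>

definition tilted_distribution :: "real measure \<Rightarrow> real \<Rightarrow> real \<Rightarrow> real \<Rightarrow> real measure" where
  "tilted_distribution F h k m = distr (density F (\<lambda>x. ennreal (exp (h * x - k)))) borel (\<lambda>x. x - m)"

context
  fixes F :: "real measure" and h k m :: real
  assumes F: "real_distribution F"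
    and int: "integrable F (\<lambda>x. exp (h * x))" and k: "(LINT x|F. exp (h * x)) = exp k"
begin

interpretation real_distribution F by (rule F)

lemma real_distribution_tilted: "real_distribution (tilted_distribution F h k m)"
proof -
  have "emeasure (density F (\<lambda>x. ennreal (exp (h * x - k)))) (space F) =
      (\<integral>\<^sup>+x. ennreal (exp (- k) * exp (h * x)) \<partial>F)"
    by (subst emeasure_density) (auto intro!: nn_integral_cong simp: exp_diff exp_minus divide_inverse mult.commute)
  also have "\<dots> = ennreal (LINT x|F. exp (- k) * exp (h * x))"
    using int by (intro nn_integral_eq_integral) auto
  also have "\<dots> = ennreal (exp (- k) * exp k)" by (simp only: integral_mult_right_zero k)
  also have "\<dots> = 1" by (simp flip: exp_add)
  finally have "prob_space (density F (\<lambda>x. ennreal (exp (h * x - k))))"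
    by (intro prob_spaceI) simp
  then show ?thesis
    unfolding tilted_distribution_def
    by (intro prob_space.real_distribution_distr) auto
qed

lemma char_tilted:
  "char (tilted_distribution F h k m) t = exp (- (\<i> * (t * m)) - k) * laplace_transform F (Complex h t)"
proof -
  have "char (tilted_distribution F h k m) t = (CLINT x|F. exp (h * x - k) *\<^sub>R iexp (t * (x - m)))"
    unfolding char_def tilted_distribution_def
    by (subst integral_distr, simp, simp, subst integral_density) auto
  also have "\<dots> = (CLINT x|F. exp (- (\<i> * (t * m)) - k) * exp (Complex h t * complex_of_real x))"
  proof (intro Bochner_Integration.integral_cong refl)
    fix x
    have "Complex h t = complex_of_real h + \<i> * t" by (simp add: complex_eq_iff)
    then show "exp (h * x - k) *\<^sub>R iexp (t * (x - m)) = exp (- (\<i> * (t * m)) - k) * exp (Complex h t * complex_of_real x)"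
      by (simp add: scaleR_conv_of_real exp_of_real[symmetric] exp_add[symmetric] algebra_simps)
  qed
  finally show ?thesis by (simp add: laplace_transform_def)
qed

text \<open>The factor exp (- h x) cancels the density of the tilt up to a constant, so the weighted
  half-line of the tilted law is an ordinary tail of \<open>F\<close>.\<close>

lemma tilted_exp_tail:
  "(LINT x|tilted_distribution F h k m. exp (- h * x) * indicator {0..} x) = exp (h * m - k) * measure F {m..}"
proof -
  have "(LINT x|tilted_distribution F h k m. exp (- h * x) * indicator {0..} x) =
      (LINT x|F. exp (h * x - k) *\<^sub>R (exp (- h * (x - m)) * indicator {0..} (x - m)))"
    unfolding tilted_distribution_def
    by (subst integral_distr, simp, simp, subst integral_density) auto
  also have "\<dots> = (LINT x|F. exp (h * m - k) * indicator {m..} x)"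
    by (intro Bochner_Integration.integral_cong refl)
       (auto simp: indicator_def exp_add[symmetric] algebra_simps)
  finally show ?thesis by simp
qed

end

lemma scaled_normal_exp_tail:
  assumes s: "s > 0"
  shows "(LINT x|scaled_normal s. exp (- h * x) * indicator {0..} x) = normal_laplace_tail (h * s) 0"
proof -
  have "(LINT x|scaled_normal s. exp (- h * x) * indicator {0..} x) =
      (LINT u|lborel. std_normal_density u *\<^sub>R (exp (- h * (s * u)) * indicator {0..} (s * u)))"
    unfolding scaled_normal_def
    by (subst integral_distr, simp, simp, subst integral_density) auto
  also have "\<dots> = normal_laplace_tail (h * s) 0"
    unfolding normal_laplace_tail_def using s
    by (intro Bochner_Integration.integral_cong refl) (auto simp: indicator_def zero_le_mult_iff mult_ac)
  finally show ?thesis .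
qed

text \<open>Since 1/2 - 1/7 > 1/3, the perturbation costs only a part of the Gaussian decay.\<close>

lemma normal_perturbation_bounds:
  fixes x :: real and R :: complex
  assumes R: "norm R \<le> x\<^sup>2 / 7"
  shows "norm (exp (- complex_of_real (x\<^sup>2 / 2) + R)) \<le> exp (- x\<^sup>2 / 3)"
    and "norm (exp (- complex_of_real (x\<^sup>2 / 2) + R) - exp (- complex_of_real (x\<^sup>2 / 2))) \<le> norm R * exp (- x\<^sup>2 / 3)"
proof -
  have b: "exp (- (x\<^sup>2 / 2) + norm R) \<le> exp (- x\<^sup>2 / 3)"
    unfolding exp_le_cancel_iff using R zero_le_power2[of x] by linarith
  have "Re R \<le> norm R" by (rule complex_Re_le_cmod)
  then have "norm (exp (- complex_of_real (x\<^sup>2 / 2) + R)) \<le> exp (- (x\<^sup>2 / 2) + norm R)"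
    unfolding norm_exp_eq_Re by simp
  with b show "norm (exp (- complex_of_real (x\<^sup>2 / 2) + R)) \<le> exp (- x\<^sup>2 / 3)" by linarith
  have "norm (exp R - (\<Sum>i\<le>0. R ^ i / fact i)) \<le> exp (norm R) * (norm R ^ Suc 0) / fact 0"
    by (rule Taylor_exp_field)
  then have t: "norm (exp R - 1) \<le> exp (norm R) * norm R" by simp
  have n: "norm (exp (- complex_of_real (x\<^sup>2 / 2))) = exp (- (x\<^sup>2 / 2))"
    by (simp add: norm_exp_eq_Re)
  have "exp (- complex_of_real (x\<^sup>2 / 2) + R) - exp (- complex_of_real (x\<^sup>2 / 2)) = exp (- complex_of_real (x\<^sup>2 / 2)) * (exp R - 1)"
    by (simp only: exp_add right_diff_distrib mult_1_right)
  then have "norm (exp (- complex_of_real (x\<^sup>2 / 2) + R) - exp (- complex_of_real (x\<^sup>2 / 2))) = exp (- (x\<^sup>2 / 2)) * norm (exp R - 1)"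
    by (simp only: norm_mult n)
  also have "\<dots> \<le> exp (- (x\<^sup>2 / 2)) * (exp (norm R) * norm R)"
    by (intro mult_left_mono t) simp
  also have "\<dots> = exp (- (x\<^sup>2 / 2) + norm R) * norm R" by (simp only: exp_add mult_ac)
  also have "\<dots> \<le> exp (- x\<^sup>2 / 3) * norm R" by (intro mult_right_mono b) simp
  finally show "norm (exp (- complex_of_real (x\<^sup>2 / 2) + R) - exp (- complex_of_real (x\<^sup>2 / 2))) \<le> norm R * exp (- x\<^sup>2 / 3)"
    by (simp add: mult.commute)
qed

text \<open>The comparison law has the variance \<open>w\<close> of the tilted law, not
  \<open>v\<close>: otherwise the exponents would already differ by a term of order v h t^2, which
  is not of the required order v |t|^3.\<close>

lemma tilted_tail_bound:
  fixes F :: "real measure" and h k m w v :: real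
  assumes F: "real_distribution F" and h: "0 < h" "h \<le> 1" and v: "v > 0"
    and int: "integrable F (\<lambda>x. exp (h * x))" and k: "(LINT x|F. exp (h * x)) = exp k"
    and w: "\<bar>w - v\<bar> \<le> v * h / 8"
    and L: "\<And>t. \<bar>t\<bar> \<le> 2 \<Longrightarrow> \<exists>R. norm R \<le> v * \<bar>t\<bar> ^ 3 / 16 \<and>
         laplace_transform F (Complex h t) = exp k * exp (\<i> * (t * m) - t\<^sup>2 * w / 2 + R)"
  shows "\<bar>exp (h * m - k) * measure F {m..} - normal_laplace_tail (h * sqrt w) 0\<bar> \<le> berry_esseen_const / sqrt w"
proof -
  have "v * h \<le> v * 1" using h v by (intro mult_left_mono) auto
  with w have w7: "v \<le> 8 / 7 * w" by linarith
  then have wpos: "w > 0" using v by linarith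
  define s where "s = sqrt w"
  have s: "s > 0" "s\<^sup>2 = w" using wpos by (simp_all add: s_def)
  let ?T = "tilted_distribution F h k m"
  have c: "\<exists>R. norm R \<le> (s * t)\<^sup>2 * \<bar>t\<bar> / 14 \<and> char ?T t = exp (- complex_of_real ((s * t)\<^sup>2 / 2) + R)"
    if t: "\<bar>t\<bar> \<le> 2" for t
  proof -
    obtain R where R: "norm R \<le> v * \<bar>t\<bar> ^ 3 / 16"
      "laplace_transform F (Complex h t) = exp k * exp (\<i> * (t * m) - t\<^sup>2 * w / 2 + R)"
      using L[OF t] by blast
    have "norm R \<le> (8 / 7 * w) * \<bar>t\<bar> ^ 3 / 16"
      using R(1) mult_right_mono[OF w7, of "\<bar>t\<bar> ^ 3"] by simp
    also have "\<dots> = (s * t)\<^sup>2 * \<bar>t\<bar> / 14"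
      using s(2) by (simp add: power_mult_distrib power2_eq_square power3_eq_cube)
    finally have "norm R \<le> (s * t)\<^sup>2 * \<bar>t\<bar> / 14" .
    moreover have "char ?T t = exp (- complex_of_real ((s * t)\<^sup>2 / 2) + R)"
    proof -
      have "char ?T t = exp (- (\<i> * (t * m)) - k) * (exp (complex_of_real k) * exp (\<i> * (t * m) - t\<^sup>2 * w / 2 + R))"
        unfolding char_tilted[OF F int k] R(2) by (simp only: exp_of_real)
      also have "\<dots> = exp (- complex_of_real ((s * t)\<^sup>2 / 2) + R)"
        by (simp add: exp_add[symmetric] power_mult_distrib s(2) mult.commute)
      finally show ?thesis .
    qed
    ultimately show ?thesis by blast
  qed
  have N: "char (scaled_normal s) t = exp (- complex_of_real ((s * t)\<^sup>2 / 2))" for t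
    unfolding char_scaled_normal by (simp flip: exp_of_real)
  \<comment> \<open>With |t| \<le> 2 the cubic remainder becomes the fraction 1/7 of (s t)^2 that
    \<open>normal_perturbation_bounds\<close> tolerates.\<close>
  have "norm R \<le> (s * t)\<^sup>2 / 7" if "norm R \<le> (s * t)\<^sup>2 * \<bar>t\<bar> / 14" "\<bar>t\<bar> \<le> 2" for R :: complex and t
    using mult_left_mono[OF that(2), of "(s * t)\<^sup>2"] that(1) by simp
  note bnd = normal_perturbation_bounds[OF this]
  have cM: "norm (char ?T t) \<le> exp (- (s * t)\<^sup>2 / 3)" if t: "\<bar>t\<bar> \<le> 2" for t
    using c[OF t] bnd(1)[OF _ t] by auto
  have cN: "norm (char (scaled_normal s) t) \<le> exp (- (s * t)\<^sup>2 / 3)" for t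
    using normal_perturbation_bounds(1)[of 0 "s * t"] by (simp add: N)
  have cD: "norm (char ?T t - char (scaled_normal s) t) \<le> (s * t)\<^sup>2 * \<bar>t\<bar> * exp (- (s * t)\<^sup>2 / 3)"
    if t: "\<bar>t\<bar> \<le> 2" for t
  proof -
    obtain R where R: "norm R \<le> (s * t)\<^sup>2 * \<bar>t\<bar> / 14" "char ?T t = exp (- complex_of_real ((s * t)\<^sup>2 / 2) + R)"
      using c[OF t] by blast
    have "norm (char ?T t - char (scaled_normal s) t) \<le> norm R * exp (- (s * t)\<^sup>2 / 3)"
      unfolding R(2) N by (rule bnd(2)[OF R(1) t])
    also have "\<dots> \<le> ((s * t)\<^sup>2 * \<bar>t\<bar>) * exp (- (s * t)\<^sup>2 / 3)"
    proof (rule mult_right_mono)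
      have "0 \<le> (s * t)\<^sup>2 * \<bar>t\<bar>" by simp
      with R(1) show "norm R \<le> (s * t)\<^sup>2 * \<bar>t\<bar>" by linarith
    qed simp
    finally show ?thesis .
  qed
  have T: "real_distribution ?T" by (rule real_distribution_tilted[OF F int k])
  note S = real_distribution_scaled_normal[of s]
  have K: "\<bar>measure ?T {0..l} - measure (scaled_normal s) {0..l}\<bar> \<le> berry_esseen_const / s" if "l \<ge> 0" for l
    using kolmogorov_distance_le[OF T S s(1) that] cM cN cD by blast
  have b0: "berry_esseen_const / s \<ge> 0" using berry_esseen_const_pos s by simp
  have "(LINT x|?T. exp (- h * x) * indicator {0..} x) \<le> (LINT x|scaled_normal s. exp (- h * x) * indicator {0..} x) + berry_esseen_const / s"
    by (rule exp_tail_mono[OF T S h(1) _ b0]) (use K in \<open>force simp: abs_le_iff\<close>)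
  moreover have "(LINT x|scaled_normal s. exp (- h * x) * indicator {0..} x) \<le> (LINT x|?T. exp (- h * x) * indicator {0..} x) + berry_esseen_const / s"
    by (rule exp_tail_mono[OF S T h(1) _ b0]) (use K in \<open>force simp: abs_le_iff\<close>)
  ultimately show ?thesis
    unfolding tilted_exp_tail[OF F int k] scaled_normal_exp_tail[OF s(1)] by (simp add: s_def abs_le_iff)
qed

text \<open>Equal to 8 (2 B + 4) with B the Berry--Esseen constant: 2 B from sqrt w \<ge> sqrt v /
  2, 4 from replacing \<open>w\<close> by \<open>v\<close>, and 8 because the normal density gains
  only 1/8 per unit of shift. The same constant limits the tilt and the variance.\<close>

definition sandwich_const :: real where
  "sandwich_const = 16 * berry_esseen_const + 32"

text \<open>The shift is q = p + q'. The part p = C / sqrt v absorbs the additive error, and q' =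
  sqrt v h^2 absorbs the factor exp (v h^3 / 4) from the exponent. The hypotheses on
  \<open>h\<close> and \<open>v\<close> say that, for a = h sqrt v, a p = h C \<le> 1/2 and p \<le>
  1, so the density near the threshold stays bounded below.\<close>

lemma tail_sandwich:
  fixes F :: "real measure" and h k m w v :: real
  defines "q \<equiv> sandwich_const / sqrt v + sqrt v * h\<^sup>2"
  assumes F: "real_distribution F"
    and h: "0 < h" "h \<le> 1 / (2 * sandwich_const)" and v: "v \<ge> sandwich_const\<^sup>2"
    and int: "integrable F (\<lambda>x. exp (h * x))" and k: "(LINT x|F. exp (h * x)) = exp k"
    and kv: "\<bar>k - v * h\<^sup>2 / 2\<bar> \<le> v * h ^ 3 / 16"
    and mv: "\<bar>m - v * h\<bar> \<le> v * h\<^sup>2 / 8"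
    and w: "\<bar>w - v\<bar> \<le> v * h / 8"
    and L: "\<And>t. \<bar>t\<bar> \<le> 2 \<Longrightarrow> \<exists>R. norm R \<le> v * \<bar>t\<bar> ^ 3 / 16 \<and>
         laplace_transform F (Complex h t) = exp k * exp (\<i> * (t * m) - t\<^sup>2 * w / 2 + R)"
  shows "measure F {m..} \<le> measure std_normal_distribution {h * sqrt v - q..}"
    and "measure std_normal_distribution {h * sqrt v + q..} \<le> measure F {m..}"
proof -
  have C32: "sandwich_const \<ge> 32" using berry_esseen_const_pos by (simp add: sandwich_const_def)
  then have C0: "sandwich_const > 0" by simp
  have h1: "h \<le> 1 / 64"
  proof -
    have "1 / (2 * sandwich_const) \<le> 1 / 64" using C32 by (intro divide_left_mono) auto
    with h show ?thesis by linarith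
  qed
  have vpos: "v > 0" using v C0 zero_less_power[OF C0, of 2] by linarith
  define r where "r = sqrt v"
  have r: "r > 0" "r\<^sup>2 = v" using vpos by (simp_all add: r_def)
  have rC: "r \<ge> sandwich_const" using v C0 unfolding r_def by (intro real_le_rsqrt)
  define a where "a = h * r"
  define p where "p = sandwich_const / r"
  define q' where "q' = r * h\<^sup>2"
  have q: "q = p + q'" by (simp add: q_def p_def q'_def r_def)
  have pos: "a \<ge> 0" "p \<ge> 0" "q' \<ge> 0" using h r C0 by (auto simp: a_def p_def q'_def)
  have p1: "p \<le> 1" using rC r by (simp add: p_def)
  have ap: "a * p \<le> 1 / 2"
  proof -
    have "a * p = h * sandwich_const" using r by (simp add: a_def p_def)
    also have "\<dots> \<le> (1 / (2 * sandwich_const)) * sandwich_const" using h C0 by (intro mult_right_mono) auto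
    finally show ?thesis using C0 by simp
  qed
  have p2: "p\<^sup>2 \<le> 1" using pos p1 by (simp add: power_le_one)
  \<comment> \<open>Numerically 3 * 2.6 < 8, with 3 for e and 2.6 for sqrt (2 pi).\<close>
  have e8: "1 / 8 \<le> exp (- x) / sqrt (2 * pi)" if "x \<le> 1" for x :: real
  proof -
    have "sqrt (2 * pi) \<le> sqrt ((26/10)\<^sup>2)"
      using pi_less_4 pi_approx by (intro real_sqrt_le_mono) (auto simp: power2_eq_square)
    then have "sqrt (2 * pi) \<le> 26/10" by simp
    moreover have "exp x \<le> 3" using that exp_le exp_le_cancel_iff[of x 1] by linarith
    ultimately have "exp x * sqrt (2 * pi) \<le> 3 * (26/10)" by (intro mult_mono) auto
    then have "exp x * sqrt (2 * pi) \<le> 8" by simp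
    moreover have "0 < exp x * sqrt (2 * pi)" by simp
    ultimately have "1 / 8 \<le> 1 / (exp x * sqrt (2 * pi))" by (intro divide_left_mono) auto
    then show ?thesis by (simp add: exp_minus inverse_eq_divide)
  qed
  define E where "E = 2 * berry_esseen_const + 4"
  have CE: "sandwich_const = 8 * E" by (simp add: sandwich_const_def E_def)
  have Er: "E / r = p * (1 / 8)" by (simp add: p_def CE)
  define X where "X = exp (h * m - k) * measure F {m..}"
  have vh: "v * h \<le> v" using h1 vpos by (simp add: mult_le_cancel_left1)
  with w have w7: "7 / 8 * v \<le> w" "w \<le> 9 / 8 * v" by linarith+
  have wpos: "w > 0" using w7 vpos by linarith
  have sw: "sqrt w \<ge> r / 2"
  proof (rule real_le_rsqrt)
    show "(r / 2)\<^sup>2 \<le> w" using w7 vpos r(2) by (simp add: power_divide)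
  qed
  have b1: "berry_esseen_const / sqrt w \<le> 2 * berry_esseen_const / r"
  proof -
    have "berry_esseen_const / sqrt w \<le> berry_esseen_const / (r / 2)"
      using sw r berry_esseen_const_pos wpos by (intro divide_left_mono) auto
    then show ?thesis by (simp add: mult.commute)
  qed
  \<comment> \<open>|sqrt w - sqrt v| is at most sqrt v h / 8, and both arguments are at least
    \<open>?m\<close>; all powers of \<open>h\<close> cancel in the Lipschitz bound.\<close>
  have b2: "\<bar>normal_laplace_tail (h * sqrt w) 0 - normal_laplace_tail a 0\<bar> \<le> 4 / r"
  proof -
    let ?m = "h * sqrt (7 / 8 * v)"
    have "\<bar>normal_laplace_tail (h * sqrt w) 0 - normal_laplace_tail a 0\<bar> \<le> 7 * pi * \<bar>h * sqrt w - a\<bar> / ?m\<^sup>2"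
      using h w7 vpos by (intro normal_laplace_tail_lipschitz) (auto simp: a_def r_def intro!: mult_left_mono mult_pos_pos)
    also have "\<dots> = 7 * pi * \<bar>h * sqrt w - a\<bar> / (7 / 8 * (h\<^sup>2 * v))"
      using vpos by (simp add: power_mult_distrib)
    also have "\<dots> \<le> 7 * pi * (h\<^sup>2 * r / 8) / (7 / 8 * (h\<^sup>2 * v))"
    proof (intro divide_right_mono mult_left_mono)
      have "\<bar>sqrt w - r\<bar> * r \<le> \<bar>sqrt w - r\<bar> * (sqrt w + r)"
        using wpos by (intro mult_left_mono) auto
      also have "\<dots> = \<bar>(sqrt w - r) * (sqrt w + r)\<bar>"
        using wpos r(1) by (simp add: abs_mult add_nonneg_nonneg)
      also have "\<dots> = \<bar>w - v\<bar>"
        using wpos r(2) by (simp add: algebra_simps power2_eq_square)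
      also have "\<dots> \<le> (r * h / 8) * r" using w r(2) by (simp add: power2_eq_square algebra_simps)
      finally have "\<bar>sqrt w - r\<bar> \<le> r * h / 8" using r(1) by (simp add: mult.commute)
      then have "h * \<bar>sqrt w - r\<bar> \<le> h * (r * h / 8)" using h by (intro mult_left_mono) auto
      moreover have "\<bar>h * sqrt w - a\<bar> = h * \<bar>sqrt w - r\<bar>"
        using h by (simp add: a_def abs_mult flip: right_diff_distrib)
      moreover have "h * (r * h / 8) = h\<^sup>2 * r / 8" by (simp add: power2_eq_square)
      ultimately show "\<bar>h * sqrt w - a\<bar> \<le> h\<^sup>2 * r / 8" by linarith
    qed (use vpos in auto)
    also have "\<dots> = pi / r" using h r by (simp add: r(2)[symmetric] power2_eq_square)
    also have "\<dots> \<le> 4 / r" using pi_less_4 r by (intro divide_right_mono) auto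
    finally show ?thesis .
  qed
  have "\<bar>X - normal_laplace_tail (h * sqrt w) 0\<bar> \<le> berry_esseen_const / sqrt w"
    unfolding X_def using h h1 by (intro tilted_tail_bound[OF F _ _ vpos int k w L]) auto
  with b1 b2 have "\<bar>X - normal_laplace_tail a 0\<bar> \<le> 2 * berry_esseen_const / r + 4 / r" by linarith
  then have X: "\<bar>X - normal_laplace_tail a 0\<bar> \<le> p * (1 / 8)"
    unfolding Er[symmetric] E_def add_divide_distrib by simp
  have PF: "measure F {m..} = exp (k - h * m) * X"
    by (simp add: X_def mult.assoc[symmetric] flip: exp_add)
  \<comment> \<open>h m - k is a Legendre transform with quadratic part v h^2 - v h^2 / 2 = a^2 / 2;
    the cubic errors 1/8 and 1/16 add up to less than 1/4.\<close>
  have ex: "\<bar>(k - h * m) + a\<^sup>2 / 2\<bar> \<le> v * h ^ 3 / 4"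
  proof -
    have "\<bar>h * (m - v * h)\<bar> \<le> h * (v * h\<^sup>2 / 8)"
      using mv h by (simp add: abs_mult)
    then have "\<bar>h * m - v * h\<^sup>2\<bar> \<le> v * h ^ 3 / 8"
      by (simp add: power2_eq_square power3_eq_cube algebra_simps)
    moreover have "a\<^sup>2 = v * h\<^sup>2" by (simp add: a_def power_mult_distrib r(2) mult.commute)
    moreover have "v * h ^ 3 \<ge> 0" using vpos h by simp
    ultimately show ?thesis using kv by linarith
  qed
  \<comment> \<open>The reason for the choice of \<open>q'\<close>: the gain a q' = v h^3 exceeds v
    h^3 / 4 and leaves room for q'^2, which is at most v h^3 / 64.\<close>
  have aq: "a * q' = v * h ^ 3" "q'\<^sup>2 = v * h ^ 4"
    using r(2) by (simp_all add: a_def q'_def power2_eq_square power3_eq_cube power4_eq_xxxx)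
  have h34: "v * h ^ 4 \<le> v * h ^ 3 / 64"
  proof -
    have "(v * h ^ 3) * h \<le> (v * h ^ 3) * (1 / 64)" using vpos h h1 by (intro mult_left_mono) auto
    then show ?thesis by (simp add: power3_eq_cube power4_eq_xxxx mult_ac)
  qed
  have h3: "v * h ^ 3 \<ge> 0" using vpos h by simp
  have ex': "k - h * m \<le> - a\<^sup>2 / 2 + v * h ^ 3 / 4" "- a\<^sup>2 / 2 - v * h ^ 3 / 4 \<le> k - h * m"
    using ex by linarith+
  have X': "X \<le> normal_laplace_tail a 0 + p * (1 / 8)" "normal_laplace_tail a 0 - p * (1 / 8) \<le> X" "0 \<le> X"
    using X by (linarith, linarith, simp add: X_def)
  show "measure F {m..} \<le> measure std_normal_distribution {h * sqrt v - q..}"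
  proof -
    have "measure F {m..} \<le> exp (- a\<^sup>2 / 2 + v * h ^ 3 / 4) * (normal_laplace_tail a 0 + p * (1 / 8))"
      unfolding PF
      by (rule mult_mono[OF exp_le_cancel_iff[THEN iffD2, OF ex'(1)] X'(1) _ X'(3)]) simp
    also have "\<dots> \<le> exp (- a\<^sup>2 / 2 + (a * q' - q'\<^sup>2)) * (normal_laplace_tail a 0 + p * (exp (- p\<^sup>2) / sqrt (2 * pi)))"
    proof (rule mult_mono)
      have "- a\<^sup>2 / 2 + v * h ^ 3 / 4 \<le> - a\<^sup>2 / 2 + (a * q' - q'\<^sup>2)" unfolding aq using h34 h3 by linarith
      then show "exp (- a\<^sup>2 / 2 + v * h ^ 3 / 4) \<le> exp (- a\<^sup>2 / 2 + (a * q' - q'\<^sup>2))" by simp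
      show "normal_laplace_tail a 0 + p * (1 / 8) \<le> normal_laplace_tail a 0 + p * (exp (- p\<^sup>2) / sqrt (2 * pi))"
        by (intro add_left_mono mult_left_mono e8 p2 pos)
      show "0 \<le> normal_laplace_tail a 0 + p * (1 / 8)" using X'(1,3) by linarith
    qed simp
    also have "\<dots> = exp (- a\<^sup>2 / 2) * (exp (a * q' - q'\<^sup>2) * (normal_laplace_tail a 0 + p * (exp (- p\<^sup>2) / sqrt (2 * pi))))"
      by (simp only: exp_add mult.assoc)
    also have "\<dots> \<le> exp (- a\<^sup>2 / 2) * normal_laplace_tail a (- (p + q'))"
      by (intro mult_left_mono normal_laplace_tail_ge pos) simp
    also have "\<dots> = measure std_normal_distribution {a + (- (p + q'))..}"
      by (rule measure_std_normal_tail[symmetric])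
    finally show ?thesis unfolding add_uminus_conv_diff q a_def r_def .
  qed
  show "measure std_normal_distribution {h * sqrt v + q..} \<le> measure F {m..}"
  proof -
    let ?Y = "normal_laplace_tail a 0 - p * (exp (- a * p - p\<^sup>2 / 2) / sqrt (2 * pi))"
    have "1 / 8 \<le> exp (- a * p - p\<^sup>2 / 2) / sqrt (2 * pi)"
      using e8[of "a * p + p\<^sup>2 / 2"] ap p2 by simp
    then have "p * (1 / 8) \<le> p * (exp (- a * p - p\<^sup>2 / 2) / sqrt (2 * pi))"
      by (rule mult_left_mono) (rule pos)
    with X'(2) have YX: "?Y \<le> X" by linarith
    have tl: "normal_laplace_tail a (p + q') \<le> exp (- a * q') * ?Y" by (rule normal_laplace_tail_le[OF pos])
    with normal_laplace_tail_nonneg[of a "p + q'"] have "0 \<le> exp (- a * q') * ?Y" by linarith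
    \<comment> \<open>The sign of \<open>?Y\<close> is read off from the tail bound, whose left side
      is nonnegative; monotonicity of the product needs it.\<close>
    then have Y0: "0 \<le> ?Y" by (simp add: zero_le_mult_iff)
    have "measure std_normal_distribution {a + (p + q')..} = exp (- a\<^sup>2 / 2) * normal_laplace_tail a (p + q')"
      by (rule measure_std_normal_tail)
    also have "\<dots> \<le> exp (- a\<^sup>2 / 2) * (exp (- a * q') * ?Y)"
      by (intro mult_left_mono tl) simp
    also have "\<dots> = exp (- a\<^sup>2 / 2 - a * q') * ?Y"
      by (simp only: exp_add[symmetric] mult.assoc[symmetric]) simp
    also have "\<dots> \<le> exp (k - h * m) * X"
    proof (rule mult_mono[OF _ YX exp_ge_zero Y0])
      have "- a\<^sup>2 / 2 - a * q' \<le> k - h * m" unfolding aq using ex'(2) h3 by linarith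
      then show "exp (- a\<^sup>2 / 2 - a * q') \<le> exp (k - h * m)" by simp
    qed
    finally show ?thesis unfolding PF[symmetric] by (simp only: q a_def r_def)
  qed
qed

section \<open>Quantile coupling\<close>

lemma scaled_normal_mult: "distr (scaled_normal s) borel (\<lambda>x. c * x) = scaled_normal (c * s)"
  unfolding scaled_normal_def by (subst distr_distr) (auto simp: o_def mult.assoc intro!: distr_cong)

lemma normal_distribution_eq_scaled:
  assumes "v \<ge> 0"
  shows "normal_distribution 0 v = scaled_normal (sqrt v)"
proof (cases "v = 0")
  case True
  interpret real_distribution std_normal_distribution by (rule real_dist_normal_dist)
  have "emeasure (scaled_normal 0) A = emeasure (return borel 0) A" if "A \<in> sets borel" for A
    using that emeasure_space_1 by (simp add: scaled_normal_def emeasure_distr indicator_def)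
  then have "scaled_normal 0 = return borel 0"
    by (intro measure_eqI) (auto simp: scaled_normal_def)
  then show ?thesis using True by (simp add: normal_distribution_def)
next
  case False
  define s where "s = sqrt v"
  have s: "s > 0" using assms False by (simp add: s_def)
  interpret real_distribution std_normal_distribution by (rule real_dist_normal_dist)
  have "distributed std_normal_distribution lborel (\<lambda>x. (s * x - 0) / s) std_normal_density"
    using s by (auto simp: distributed_def intro!: measure_eqI simp: emeasure_distr)
  then have "distributed std_normal_distribution lborel (\<lambda>x. s * x) (normal_density 0 s)"
    using normal_standard_normal_convert[OF s, of "\<lambda>x. s * x" 0] by simp
  then have "distr std_normal_distribution lborel (\<lambda>x. s * x) = density lborel (\<lambda>x. ennreal (normal_density 0 s x))"
    by (simp add: distributed_def)
  moreover have "distr std_normal_distribution lborel (\<lambda>x. s * x) = scaled_normal s"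
    unfolding scaled_normal_def by (rule distr_cong) auto
  ultimately show ?thesis using False by (simp add: normal_distribution_def s_def)
qed

lemma measure_scaled_normal_atLeast:
  assumes s: "s > 0"
  shows "measure (scaled_normal s) {s * z..} = measure std_normal_distribution {z..}"
proof -
  have "(\<lambda>x. s * x) -` {s * z..} \<inter> space std_normal_distribution = {z..}"
    using s by (auto simp: mult_le_cancel_left_pos)
  then show ?thesis
    unfolding scaled_normal_def by (subst measure_distr) auto
qed

lemma measure_scaled_normal_atMost:
  "measure (scaled_normal s) {..- z} = measure (scaled_normal s) {z..}"
proof -
  have "distr std_normal_distribution borel (\<lambda>x. - x) = std_normal_distribution"
  proof (rule measure_eqI)
    fix A assume "A \<in> sets (distr std_normal_distribution borel (\<lambda>x. - x))"
    then have [measurable]: "A \<in> sets borel" by simp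
    then have [measurable]: "uminus -` A \<in> sets borel" using measurable_sets[of uminus borel borel A] by simp
    have "emeasure (distr std_normal_distribution borel (\<lambda>x. - x)) A = 
        (\<integral>\<^sup>+x. ennreal (std_normal_density x) * indicator A (- x) \<partial>lborel)"
      by (subst emeasure_distr, simp, simp, subst emeasure_density) (auto intro!: nn_integral_cong simp: indicator_def)
    also have "\<dots> = (\<integral>\<^sup>+x. ennreal (std_normal_density x) * indicator A x \<partial>lborel)"
      by (subst nn_integral_real_affine[where c = "-1" and t = 0]) (auto simp: std_normal_density_def)
    also have "\<dots> = emeasure std_normal_distribution A" by (subst emeasure_density) auto
    finally show "emeasure (distr std_normal_distribution borel (\<lambda>x. - x)) A = emeasure std_normal_distribution A" .
  qed simp
  then have "scaled_normal s = distr (distr std_normal_distribution borel (\<lambda>x. - x)) borel (\<lambda>x. s * x)"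
    by (simp add: scaled_normal_def)
  also have "\<dots> = distr (scaled_normal s) borel (\<lambda>x. - x)"
    unfolding scaled_normal_def by (subst (1 2) distr_distr) (auto simp: o_def)
  finally have "measure (scaled_normal s) {..- z} = measure (distr (scaled_normal s) borel (\<lambda>x. - x)) {..- z}" by simp
  also have "\<dots> = measure (scaled_normal s) ((\<lambda>x. - x) -` {..- z} \<inter> space (scaled_normal s))"
    by (rule measure_distr) (auto simp: scaled_normal_def)
  also have "(\<lambda>x. - x) -` {..- z} \<inter> space (scaled_normal s) = {z..}" by (auto simp: scaled_normal_def)
  finally show ?thesis .
qed

lemma nn_integral_scaled_normal:
  assumes [measurable]: "f \<in> borel_measurable borel"
  shows "(\<integral>\<^sup>+x. f x \<partial>scaled_normal s) = (\<integral>\<^sup>+u. ennreal (std_normal_density u) * f (s * u) \<partial>lborel)"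
  unfolding scaled_normal_def
  by (subst nn_integral_distr, simp, simp, subst nn_integral_density) auto

lemma nn_integral_scaled_normal_exp:
  "(\<integral>\<^sup>+x. ennreal (exp (r * x)) \<partial>scaled_normal s) = ennreal (exp (r\<^sup>2 * s\<^sup>2 / 2))"
proof -
  let ?c = "r * s"
  have "(\<integral>\<^sup>+x. ennreal (exp (r * x)) \<partial>scaled_normal s) =
      (\<integral>\<^sup>+u. ennreal (exp (?c\<^sup>2 / 2)) * ennreal (std_normal_density (- ?c + 1 * u)) \<partial>lborel)"
    by (subst nn_integral_scaled_normal)
       (auto intro!: nn_integral_cong simp: std_normal_density_def exp_add[symmetric] power2_eq_square field_simps simp flip: ennreal_mult)
  also have "\<dots> = ennreal (exp (?c\<^sup>2 / 2)) * (\<integral>\<^sup>+u. ennreal (std_normal_density u) \<partial>lborel)"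
    by (subst nn_integral_cmult, simp, subst (2) nn_integral_real_affine[where c = 1 and t = "- ?c"]) auto
  also have "(\<integral>\<^sup>+u. ennreal (std_normal_density u) \<partial>lborel) = 1"
    by (subst nn_integral_eq_integral) (auto simp: integral_normal_density)
  finally show ?thesis by (simp add: power_mult_distrib)
qed

text \<open>The exponent is half of the critical 1 / (2 s^2): in the standardised variable the
  integrand becomes sqrt 2 times a normal density of variance 2.\<close>

lemma nn_integral_scaled_normal_exp_square:
  assumes s: "s > 0"
  shows "(\<integral>\<^sup>+x. ennreal (exp (x\<^sup>2 / (4 * s\<^sup>2))) \<partial>scaled_normal s) = ennreal (sqrt 2)"
proof -
  have "(\<integral>\<^sup>+x. ennreal (exp (x\<^sup>2 / (4 * s\<^sup>2))) \<partial>scaled_normal s) =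
      (\<integral>\<^sup>+u. ennreal (sqrt 2) * ennreal (normal_density 0 (sqrt 2) u) \<partial>lborel)"
  proof (subst nn_integral_scaled_normal, simp, intro nn_integral_cong)
    fix u :: real
    have e: "(s * u)\<^sup>2 / (4 * s\<^sup>2) = u\<^sup>2 / 4" using s by (simp add: power_mult_distrib)
    have "std_normal_density u * exp (u\<^sup>2 / 4) = sqrt 2 * normal_density 0 (sqrt 2) u"
      by (simp add: normal_density_def exp_add[symmetric] real_sqrt_mult field_simps)
    then show "ennreal (std_normal_density u) * ennreal (exp ((s * u)\<^sup>2 / (4 * s\<^sup>2))) =
        ennreal (sqrt 2) * ennreal (normal_density 0 (sqrt 2) u)"
      unfolding e by (simp flip: ennreal_mult)
  qed
  also have "\<dots> = ennreal (sqrt 2) * (\<integral>\<^sup>+u. ennreal (normal_density 0 (sqrt 2) u) \<partial>lborel)"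
    by (rule nn_integral_cmult) simp
  also have "(\<integral>\<^sup>+u. ennreal (normal_density 0 (sqrt 2) u) \<partial>lborel) = 1"
    by (subst nn_integral_eq_integral) (auto simp: integral_normal_density)
  finally show ?thesis by simp
qed

section \<open>Quantile functions and the transfer of tail comparisons\<close>

text \<open>Meaningful for \<open>0 < \<omega> < 1\<close> only: otherwise the set may be empty or unbounded below.\<close>

definition quantile :: "real measure \<Rightarrow> real \<Rightarrow> real" where
  "quantile D \<omega> = Inf {x. \<omega> \<le> cdf D x}"

abbreviation unit_interval :: "real measure" where
  "unit_interval \<equiv> restrict_space lborel {0<..<1}"

lemma
  assumes "real_distribution D"
  shows quantile_le_iff: "0 < \<omega> \<Longrightarrow> \<omega> < 1 \<Longrightarrow> quantile D \<omega> \<le> x \<longleftrightarrow> \<omega> \<le> measure D {..x}"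
    and measurable_quantile: "quantile D \<in> borel_measurable unit_interval"
    and distr_quantile: "distr unit_interval borel (quantile D) = D"
proof -
  interpret cdf_distribution D using assms by (simp add: cdf_distribution_def)
  have q: "quantile D = I" by (simp add: quantile_def fun_eq_iff)
  show "0 < \<omega> \<Longrightarrow> \<omega> < 1 \<Longrightarrow> quantile D \<omega> \<le> x \<longleftrightarrow> \<omega> \<le> measure D {..x}"
    using pseudoinverse[of \<omega> x] by (simp add: q cdf_def)
  show "quantile D \<in> borel_measurable unit_interval"
    unfolding q using measurable_CI by (simp add: measurable_def space_restrict_space sets_restrict_space)
  show "distr unit_interval borel (quantile D) = D" unfolding q by (rule distr_I_eq_M)
qed

lemma prob_space_unit_interval: "prob_space unit_interval"
  by (auto simp: emeasure_restrict_space space_restrict_space intro!: prob_spaceI)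

context
  fixes F N :: "real measure" and \<omega> :: real
  assumes F: "real_distribution F" and N: "real_distribution N" and \<omega>: "0 < \<omega>" "\<omega> < 1"
begin

interpretation F: real_distribution F by (rule F)
interpretation N: real_distribution N by (rule N)

lemma quantile_transfer_atMost:
  assumes "measure N {..z} \<le> measure F {..m}" "quantile N \<omega> \<le> z"
  shows "quantile F \<omega> \<le> m"
  using assms quantile_le_iff[OF F \<omega>] quantile_le_iff[OF N \<omega>] by simp

text \<open>Strictness places the half-line up to the quantile of \<open>N\<close> in the complement
  of {z..}; thus atoms are allowed in both laws.\<close>

lemma quantile_transfer_atLeast:
  assumes "measure F {m..} \<le> measure N {z..}" "quantile N \<omega> < z"
  shows "quantile F \<omega> \<le> m"
proof -
  have "\<omega> \<le> measure N {..quantile N \<omega>}" using quantile_le_iff[OF N \<omega>, of "quantile N \<omega>"] by simp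
  also have "\<dots> \<le> measure N (- {z..})" using assms by (intro N.finite_measure_mono) auto
  also have "\<dots> = 1 - measure N {z..}" using N.prob_compl[of "{z..}"] by (simp add: Compl_eq_Diff_UNIV)
  also have "\<dots> \<le> 1 - measure F {m..}" using assms by simp
  also have "\<dots> = measure F (- {m..})" using F.prob_compl[of "{m..}"] by (simp add: Compl_eq_Diff_UNIV)
  also have "\<dots> \<le> measure F {..m}" by (intro F.finite_measure_mono) auto
  finally show ?thesis using quantile_le_iff[OF F \<omega>] by simp
qed

end

text \<open>Pure arithmetic: \<open>x\<close> and \<open>y\<close> are the two quantiles, and each
  sandwich locates \<open>x\<close> once \<open>h\<close> is chosen so that its threshold just
  passes \<open>y\<close>. For small \<open>y\<close> no admissible h > 0 passes from below, and the
  lower bound for \<open>x\<close> has to come from the opposite tail through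
  \<open>U'\<close>.\<close>

lemma quantile_close_nonneg:
  fixes x y v C \<epsilon> :: real
  assumes C: "C \<ge> 1" and v: "v \<ge> C\<^sup>2" "8 * C \<le> \<epsilon> * v" and e: "0 < \<epsilon>" "\<epsilon> \<le> 1 / 2"
    and U: "\<And>h. 0 < h \<Longrightarrow> h \<le> \<epsilon> \<Longrightarrow> y < v * h - (C + v * h\<^sup>2) \<Longrightarrow> x \<le> v * h + v * h\<^sup>2"
    and L: "\<And>h. 0 < h \<Longrightarrow> h \<le> \<epsilon> \<Longrightarrow> v * h + (C + v * h\<^sup>2) < y \<Longrightarrow> v * h - v * h\<^sup>2 \<le> x"
    and U': "\<And>h. 0 < h \<Longrightarrow> h \<le> \<epsilon> \<Longrightarrow> - (v * h - (C + v * h\<^sup>2)) < y \<Longrightarrow> - (v * h + v * h\<^sup>2) \<le> x"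
    and y: "0 \<le> y" "y \<le> \<epsilon> * v / 4"
  shows "\<bar>x - y\<bar> \<le> (4 * C + 64) * (1 + y\<^sup>2 / v)"
proof -
  have v0: "v > 0" using C v(1) one_le_power[of C 2] by linarith
  \<comment> \<open>An approximate inverse of h -> v h - v h^2: the correction 4 Y^2 / v in v g(Y)
    compensates v g(Y)^2, so that v g(Y) - v g(Y)^2 \<ge> Y.\<close>
  define g where "g Y = (Y + 4 * Y\<^sup>2 / v) / v" for Y
  have g: "0 < g Y \<and> g Y \<le> \<epsilon> \<and> v * g Y = Y + 4 * Y\<^sup>2 / v \<and> v * (g Y)\<^sup>2 \<le> 4 * Y\<^sup>2 / v"
    if Y: "0 < Y" "Y \<le> \<epsilon> * v / 2" for Y
  proof -
    have "\<epsilon> * v \<le> 1 / 2 * v" using e v0 by (intro mult_right_mono) auto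
    with Y have "4 * Y \<le> v" by linarith
    then have "4 * Y * Y \<le> v * Y" using Y by (intro mult_right_mono) auto
    then have "4 * Y\<^sup>2 / v \<le> Y" using v0 by (simp add: divide_le_eq power2_eq_square mult_ac)
    then have vg: "v * g Y = Y + 4 * Y\<^sup>2 / v" "v * g Y \<le> 2 * Y" using v0 by (auto simp: g_def)
    have gp: "0 < g Y" using Y v0 by (auto simp: g_def intro!: divide_pos_pos add_pos_nonneg)
    have "v * g Y \<le> v * \<epsilon>" using vg(2) Y by (simp add: mult.commute)
    then have "g Y \<le> \<epsilon>" using v0 by simp
    moreover have "(v * g Y)\<^sup>2 \<le> (2 * Y)\<^sup>2" using vg(2) gp v0 by (intro power_mono) auto
    then have "v * (g Y)\<^sup>2 \<le> 4 * Y\<^sup>2 / v" using v0 by (simp add: power2_eq_square field_simps)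
    ultimately show ?thesis using vg gp by simp
  qed
  have Cv: "C\<^sup>2 / v \<le> 1" using v v0 by simp
  have yv: "0 \<le> y\<^sup>2 / v" using v0 by simp
  have goal: "2 * C + 64 + 16 * (y\<^sup>2 / v) \<le> (4 * C + 64) * (1 + y\<^sup>2 / v)"
    "4 * C + 32 + 3 * (y\<^sup>2 / v) \<le> (4 * C + 64) * (1 + y\<^sup>2 / v)"
  proof -
    have "0 \<le> C * (y\<^sup>2 / v)" using C yv by (intro mult_nonneg_nonneg) auto
    then show "2 * C + 64 + 16 * (y\<^sup>2 / v) \<le> (4 * C + 64) * (1 + y\<^sup>2 / v)"
      "4 * C + 32 + 3 * (y\<^sup>2 / v) \<le> (4 * C + 64) * (1 + y\<^sup>2 / v)"
      using C yv unfolding distrib_left distrib_right mult_1_right mult.assoc by linarith+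
  qed
  have up: "x - y \<le> 2 * C + 64 + 16 * (y\<^sup>2 / v)"
  proof -
    \<comment> \<open>One \<open>C\<close> cancels the one in the threshold; the other makes the
      inequality strict.\<close>
    let ?Y = "y + 2 * C"
    have Y: "0 < ?Y" "?Y \<le> \<epsilon> * v / 2" using y C v by linarith+
    have "x \<le> v * g ?Y + v * (g ?Y)\<^sup>2"
      using g[OF Y] C by (intro U) linarith+
    also have "\<dots> \<le> ?Y + 8 * (?Y\<^sup>2 / v)" using g[OF Y] by linarith
    also have "?Y\<^sup>2 / v \<le> (2 * y\<^sup>2 + 8 * C\<^sup>2) / v"
      using v0 zero_le_power2[of "y - 2 * C"]
      by (intro divide_right_mono) (simp_all add: power2_eq_square algebra_simps)
    finally show ?thesis using Cv by (simp add: add_divide_distrib)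
  qed
  have low: "y - x \<le> 4 * C + 32 + 3 * (y\<^sup>2 / v)"
  proof (cases "y - 2 * C - 2 * (y\<^sup>2 / v) > 0")
    case True
    \<comment> \<open>Here v h^2 \<le> y^2 / v, so v h + C + v h^2 stays below \<open>y\<close> by
      at least C + y^2 / v.\<close>
    define h where "h = (y - 2 * C - 2 * (y\<^sup>2 / v)) / v"
    have h: "0 < h" "v * h = y - 2 * C - 2 * (y\<^sup>2 / v)" using True v0 by (auto simp: h_def)
    have vy: "v * h \<le> y" using h C yv by linarith
    then have "(v * h)\<^sup>2 \<le> y\<^sup>2"
      by (rule power_mono) (use h(1) v0 in simp)
    then have h2: "v * h\<^sup>2 \<le> y\<^sup>2 / v" using v0 by (simp add: power2_eq_square field_simps)
    have "v * h \<le> v * \<epsilon>"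
    proof -
      have "\<epsilon> * v \<ge> 0" using e v0 by simp
      then show ?thesis using vy y by (simp add: mult.commute)
    qed
    then have "h \<le> \<epsilon>" using v0 by simp
    from L[OF h(1) this] have "v * h - v * h\<^sup>2 \<le> x" using h h2 C yv by linarith
    then show ?thesis using h h2 C by linarith
  next
    case False
    \<comment> \<open>Now \<open>y\<close> itself is at most 2 C + 2 y^2 / v, and it is enough that
      \<open>x\<close> is not far below 0.\<close>
    have Y: "0 < 2 * C" "2 * C \<le> \<epsilon> * v / 2" using C v by linarith+
    have "- (v * g (2 * C) + v * (g (2 * C))\<^sup>2) \<le> x"
      using g[OF Y] C y by (intro U') linarith+
    moreover have "v * g (2 * C) + v * (g (2 * C))\<^sup>2 \<le> 2 * C + 32 * (C\<^sup>2 / v)"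
      using g[OF Y] by (simp add: power_mult_distrib)
    ultimately show ?thesis using False Cv yv by linarith
  qed
  from up low goal show ?thesis by linarith
qed

lemma quantile_close:
  fixes x y v C \<epsilon> :: real
  assumes C: "C \<ge> 1" and v: "v \<ge> C\<^sup>2" "8 * C \<le> \<epsilon> * v" and e: "0 < \<epsilon>" "\<epsilon> \<le> 1 / 2"
    and U: "\<And>h. 0 < h \<Longrightarrow> h \<le> \<epsilon> \<Longrightarrow> y < v * h - (C + v * h\<^sup>2) \<Longrightarrow> x \<le> v * h + v * h\<^sup>2"
    and L: "\<And>h. 0 < h \<Longrightarrow> h \<le> \<epsilon> \<Longrightarrow> v * h + (C + v * h\<^sup>2) < y \<Longrightarrow> v * h - v * h\<^sup>2 \<le> x"
    and U': "\<And>h. 0 < h \<Longrightarrow> h \<le> \<epsilon> \<Longrightarrow> - (v * h - (C + v * h\<^sup>2)) < y \<Longrightarrow> - (v * h + v * h\<^sup>2) \<le> x"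
    and L': "\<And>h. 0 < h \<Longrightarrow> h \<le> \<epsilon> \<Longrightarrow> y < - (v * h + (C + v * h\<^sup>2)) \<Longrightarrow> x \<le> - (v * h - v * h\<^sup>2)"
    and y: "\<bar>y\<bar> \<le> \<epsilon> * v / 4"
  shows "\<bar>x - y\<bar> \<le> (4 * C + 64) * (1 + y\<^sup>2 / v)"
proof (cases "y \<ge> 0")
  case True
  then show ?thesis using quantile_close_nonneg[OF C v e U L U'] y by simp
next
  case False
  have "\<bar>(- x) - (- y)\<bar> \<le> (4 * C + 64) * (1 + (- y)\<^sup>2 / v)"
  proof (rule quantile_close_nonneg[OF C v e])
    fix h assume "0 < h" "h \<le> \<epsilon>" "- y < v * h - (C + v * h\<^sup>2)"
    then show "- x \<le> v * h + v * h\<^sup>2" using U'[of h] by linarith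
  next
    fix h assume "0 < h" "h \<le> \<epsilon>" "v * h + (C + v * h\<^sup>2) < - y"
    then show "v * h - v * h\<^sup>2 \<le> - x" using L'[of h] by linarith
  next
    fix h assume "0 < h" "h \<le> \<epsilon>" "- (v * h - (C + v * h\<^sup>2)) < - y"
    then show "- (v * h + v * h\<^sup>2) \<le> - x" using U[of h] by linarith
  qed (use False y in auto)
  then show ?thesis by (simp add: abs_minus_commute)
qed

lemma sandwich_const_ge: "sandwich_const \<ge> 32"
  using berry_esseen_const_pos by (simp add: sandwich_const_def)

text \<open>Multiplication by sqrt v turns the standardised shift into C + v h^2; of the point
  \<open>m\<close> only its distance to v h is kept.\<close>

lemma class_A1_tail_sandwich:
  assumes F: "F \<in> class_A1 (1 / 8)" and mean: "prob_space.expectation F (\<lambda>x. x) = 0"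
    and v: "v = prob_space.variance F (\<lambda>x. x)" "v \<ge> sandwich_const\<^sup>2"
    and h: "0 < h" "h \<le> 1 / (2 * sandwich_const)"
  obtains m where "\<bar>m - v * h\<bar> \<le> v * h\<^sup>2"
    "measure F {m..} \<le> measure (scaled_normal (sqrt v)) {v * h - (sandwich_const + v * h\<^sup>2)..}"
    "measure (scaled_normal (sqrt v)) {v * h + (sandwich_const + v * h\<^sup>2)..} \<le> measure F {m..}"
proof -
  let ?C = sandwich_const
  have rd: "real_distribution F" using F by (simp add: class_A1_def)
  obtain K m w :: "real \<Rightarrow> real" where c:
    "\<And>h. \<bar>h\<bar> \<le> 2 \<Longrightarrow> integrable F (\<lambda>x. exp (h * x))"
    "\<And>h. \<bar>h\<bar> \<le> 2 \<Longrightarrow> (LINT x|F. exp (h * x)) = exp (K h)"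
    "\<And>h. \<bar>h\<bar> \<le> 2 \<Longrightarrow> \<bar>K h - v * h\<^sup>2 / 2\<bar> \<le> v * \<bar>h\<bar> ^ 3 / 16"
    "\<And>h. \<bar>h\<bar> \<le> 2 \<Longrightarrow> \<bar>m h - v * h\<bar> \<le> v * h\<^sup>2 / 8"
    "\<And>h. \<bar>h\<bar> \<le> 2 \<Longrightarrow> \<bar>w h - v\<bar> \<le> v * \<bar>h\<bar> / 8"
    "\<And>h t. \<bar>h\<bar> \<le> 2 \<Longrightarrow> \<bar>t\<bar> \<le> 2 \<Longrightarrow>
       integrable F (\<lambda>x. exp (Complex h t * complex_of_real x)) \<and>
       (\<exists>R. norm R \<le> v * \<bar>t\<bar> ^ 3 / 16 \<and>
         laplace_transform F (Complex h t) = exp (K h) * exp (\<i> * (t * m h) - t\<^sup>2 * w h / 2 + R))"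
    using class_A1_cumulant_expansion[OF F mean v(1)] by blast
  have "1 / (2 * ?C) \<le> 1 / 64" using sandwich_const_ge by (intro divide_left_mono) auto
  then have h2: "\<bar>h\<bar> \<le> 2" using h by linarith
  have hh: "\<bar>h\<bar> = h" using h by simp
  have sand: "measure F {m h..} \<le> measure std_normal_distribution {h * sqrt v - (?C / sqrt v + sqrt v * h\<^sup>2)..}"
    "measure std_normal_distribution {h * sqrt v + (?C / sqrt v + sqrt v * h\<^sup>2)..} \<le> measure F {m h..}"
    by (rule tail_sandwich[OF rd h v(2) c(1)[OF h2] c(2)[OF h2] c(3)[OF h2, unfolded hh] c(4)[OF h2]
          c(5)[OF h2, unfolded hh]]; use c(6)[OF h2] in blast)+
  have "?C\<^sup>2 > 0" using sandwich_const_ge by simp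
  then have vp: "v > 0" using v(2) by linarith
  then have sv: "sqrt v > 0" "sqrt v * sqrt v = v" by simp_all
  have e: "sqrt v * (h * sqrt v - (?C / sqrt v + sqrt v * h\<^sup>2)) = v * h - (?C + v * h\<^sup>2)"
    "sqrt v * (h * sqrt v + (?C / sqrt v + sqrt v * h\<^sup>2)) = v * h + (?C + v * h\<^sup>2)"
    using sv vp by (simp_all add: algebra_simps mult.assoc[symmetric])
  show thesis
  proof (rule that[of "m h"])
    have "v * h\<^sup>2 \<ge> 0" using vp by simp
    then show "\<bar>m h - v * h\<bar> \<le> v * h\<^sup>2" using c(4)[OF h2] by linarith
    show "measure F {m h..} \<le> measure (scaled_normal (sqrt v)) {v * h - (?C + v * h\<^sup>2)..}"
      using sand(1) by (simp only: measure_scaled_normal_atLeast[OF sv(1), symmetric] e)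
    show "measure (scaled_normal (sqrt v)) {v * h + (?C + v * h\<^sup>2)..} \<le> measure F {m h..}"
      using sand(2) by (simp only: measure_scaled_normal_atLeast[OF sv(1), symmetric] e)
  qed
qed

text \<open>Lower tails come from the reflection of \<open>F\<close>, which is in the same class.
  With \<epsilon> = 1 / (2 C), the largest admissible tilt, 8 C \<le> \<epsilon> v reads v \<ge> 16
  C^2, and |y| \<le> \<epsilon> v / 4 is the hypothesis \<open>y\<close>.\<close>

lemma class_A1_quantile_close:
  assumes F: "F \<in> class_A1 (1 / 8)" and mean: "prob_space.expectation F (\<lambda>x. x) = 0"
    and v: "v = prob_space.variance F (\<lambda>x. x)" "v \<ge> 16 * sandwich_const\<^sup>2"
    and \<omega>: "0 < \<omega>" "\<omega> < 1"
    and y: "\<bar>quantile (scaled_normal (sqrt v)) \<omega>\<bar> \<le> v / (8 * sandwich_const)"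
  shows "\<bar>quantile F \<omega> - quantile (scaled_normal (sqrt v)) \<omega>\<bar>
    \<le> (4 * sandwich_const + 64) * (1 + (quantile (scaled_normal (sqrt v)) \<omega>)\<^sup>2 / v)"
proof -
  let ?C = sandwich_const and ?N = "scaled_normal (sqrt v)" and ?G = "distr F borel (\<lambda>x. - 1 * x)"
  have C: "?C \<ge> 32" by (rule sandwich_const_ge)
  have rd: "real_distribution F" using F by (simp add: class_A1_def)
  note N = real_distribution_scaled_normal[of "sqrt v"]
  interpret F: real_distribution F by (rule rd)
  interpret N: real_distribution ?N by (rule N)
  have vC: "v \<ge> ?C\<^sup>2" using v(2) zero_le_power2[of ?C] by linarith
  have G: "?G \<in> class_A1 (1 / 8)" using class_A1_scale[OF F, of "-1"] by simp
  have Gm: "prob_space.expectation ?G (\<lambda>x. x) = 0" "v = prob_space.variance ?G (\<lambda>x. x)"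
    using prob_space_scale_variance[OF rd, of "-1"] mean v(1) by simp_all
  have GF: "measure ?G {m..} = measure F {..- m}" for m
    by (subst measure_distr) (auto intro!: arg_cong[where f = "measure F"])
  show ?thesis
  proof (rule quantile_close[where \<epsilon> = "1 / (2 * ?C)"])
    show "?C \<ge> 1" "v \<ge> ?C\<^sup>2" "0 < 1 / (2 * ?C)" using C vC by auto
    show "1 / (2 * ?C) \<le> 1 / 2" using C by simp
    show "8 * ?C \<le> 1 / (2 * ?C) * v" using v(2) C by (simp add: field_simps power2_eq_square)
    show "\<bar>quantile ?N \<omega>\<bar> \<le> 1 / (2 * ?C) * v / 4" using y by simp
  next
    fix h assume h: "0 < h" "h \<le> 1 / (2 * ?C)"
    obtain m where m: "\<bar>m - v * h\<bar> \<le> v * h\<^sup>2"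
      "measure F {m..} \<le> measure ?N {v * h - (?C + v * h\<^sup>2)..}"
      "measure ?N {v * h + (?C + v * h\<^sup>2)..} \<le> measure F {m..}"
      by (rule class_A1_tail_sandwich[OF F mean v(1) vC h])
    show "quantile F \<omega> \<le> v * h + v * h\<^sup>2" if "quantile ?N \<omega> < v * h - (?C + v * h\<^sup>2)"
      using quantile_transfer_atLeast[OF rd N \<omega> m(2) that] m(1) by linarith
    show "v * h - v * h\<^sup>2 \<le> quantile F \<omega>" if "v * h + (?C + v * h\<^sup>2) < quantile ?N \<omega>"
    proof (rule ccontr)
      assume "\<not> v * h - v * h\<^sup>2 \<le> quantile F \<omega>"
      then have "quantile F \<omega> < m" using m(1) by linarith
      from quantile_transfer_atLeast[OF N rd \<omega> m(3) this] that show False by linarith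
    qed
  next
    fix h assume h: "0 < h" "h \<le> 1 / (2 * ?C)"
    obtain m where m: "\<bar>m - v * h\<bar> \<le> v * h\<^sup>2"
      "measure ?G {m..} \<le> measure ?N {v * h - (?C + v * h\<^sup>2)..}"
      "measure ?N {v * h + (?C + v * h\<^sup>2)..} \<le> measure ?G {m..}"
      by (rule class_A1_tail_sandwich[OF G Gm vC h])
    note m' = m(2,3)[unfolded GF measure_scaled_normal_atMost[symmetric]]
    show "- (v * h + v * h\<^sup>2) \<le> quantile F \<omega>" if "- (v * h - (?C + v * h\<^sup>2)) < quantile ?N \<omega>"
    proof (rule ccontr)
      assume "\<not> - (v * h + v * h\<^sup>2) \<le> quantile F \<omega>"
      then have "quantile F \<omega> \<le> - m" using m(1) by linarith
      from quantile_transfer_atMost[OF N rd \<omega> m'(1) this] that show False by linarith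
    qed
    show "quantile F \<omega> \<le> - (v * h - v * h\<^sup>2)" if "quantile ?N \<omega> < - (v * h + (?C + v * h\<^sup>2))"
      using quantile_transfer_atMost[OF rd N \<omega> m'(2)] that m(1) by linarith
  qed
qed

section \<open>Exponential moments of the coupled difference\<close>

lemma nn_integral_exp_abs_le:
  fixes r B :: real
  assumes [measurable_cong]: "sets D = sets borel"
    and "(\<integral>\<^sup>+x. ennreal (exp (r * x)) \<partial>D) \<le> ennreal B" "(\<integral>\<^sup>+x. ennreal (exp (- r * x)) \<partial>D) \<le> ennreal B"
    and "B \<ge> 0"
  shows "(\<integral>\<^sup>+x. ennreal (exp (r * \<bar>x\<bar>)) \<partial>D) \<le> ennreal (2 * B)"
proof -
  have "(\<integral>\<^sup>+x. ennreal (exp (r * \<bar>x\<bar>)) \<partial>D) \<le> (\<integral>\<^sup>+x. ennreal (exp (r * x)) + ennreal (exp (- r * x)) \<partial>D)"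
    by (intro nn_integral_mono) (auto simp: abs_if simp flip: ennreal_plus)
  also have "\<dots> = (\<integral>\<^sup>+x. ennreal (exp (r * x)) \<partial>D) + (\<integral>\<^sup>+x. ennreal (exp (- r * x)) \<partial>D)"
    by (intro nn_integral_add) auto
  also have "\<dots> \<le> ennreal B + ennreal B" by (intro add_mono assms)
  also have "\<dots> = ennreal (2 * B)" using assms(4) by (simp flip: ennreal_plus)
  finally show ?thesis .
qed

lemma class_A1_exp_abs_le:
  assumes F: "F \<in> class_A1 (1 / 8)" and mean: "prob_space.expectation F (\<lambda>x. x) = 0"
    and v: "v = prob_space.variance F (\<lambda>x. x)" and r: "0 \<le> r" "r \<le> 2"
  shows "(\<integral>\<^sup>+x. ennreal (exp (r * \<bar>x\<bar>)) \<partial>F) \<le> ennreal (2 * exp (v * r\<^sup>2))"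
proof -
  have rd: "real_distribution F" using F by (simp add: class_A1_def)
  interpret real_distribution F by (rule rd)
  obtain K :: "real \<Rightarrow> real" where c:
    "\<And>h. \<bar>h\<bar> \<le> 2 \<Longrightarrow> integrable F (\<lambda>x. exp (h * x))"
    "\<And>h. \<bar>h\<bar> \<le> 2 \<Longrightarrow> (LINT x|F. exp (h * x)) = exp (K h)"
    "\<And>h. \<bar>h\<bar> \<le> 2 \<Longrightarrow> \<bar>K h - v * h\<^sup>2 / 2\<bar> \<le> v * \<bar>h\<bar> ^ 3 / 16"
    using class_A1_cumulant_expansion[OF F mean v] by metis
  have v0: "v \<ge> 0" by (simp add: v)
  have b: "(\<integral>\<^sup>+x. ennreal (exp (h * x)) \<partial>F) \<le> ennreal (exp (v * r\<^sup>2))" if h: "\<bar>h\<bar> = r" for h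
  proof -
    have h2: "\<bar>h\<bar> \<le> 2" using h r by simp
    have "(\<integral>\<^sup>+x. ennreal (exp (h * x)) \<partial>F) = ennreal (exp (K h))"
      using c(1,2)[OF h2] by (subst nn_integral_eq_integral) auto
    moreover have "K h \<le> v * r\<^sup>2"
    proof -
      have hr: "h\<^sup>2 = r\<^sup>2" using h r by (metis power2_abs)
      have "(v * r\<^sup>2) * r \<le> (v * r\<^sup>2) * 2" using v0 r by (intro mult_left_mono) auto
      then have "v * r ^ 3 \<le> 2 * (v * r\<^sup>2)" by (simp add: power2_eq_square power3_eq_cube mult_ac)
      moreover have "0 \<le> v * r\<^sup>2" using v0 by simp
      ultimately show ?thesis using c(3)[OF h2] unfolding h hr by linarith
    qed
    ultimately show ?thesis by simp
  qed
  show ?thesis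
    using nn_integral_exp_abs_le[of F r "exp (v * r\<^sup>2)"] b[of r] b[of "- r"] r by simp
qed

lemma scaled_normal_exp_abs_le:
  "(\<integral>\<^sup>+x. ennreal (exp (r * \<bar>x\<bar>)) \<partial>scaled_normal s) \<le> ennreal (2 * exp (r\<^sup>2 * s\<^sup>2 / 2))"
proof (rule nn_integral_exp_abs_le)
  show "sets (scaled_normal s) = sets borel" by (simp add: scaled_normal_def)
  show "(\<integral>\<^sup>+x. ennreal (exp (r * x)) \<partial>scaled_normal s) \<le> ennreal (exp (r\<^sup>2 * s\<^sup>2 / 2))"
    by (simp only: nn_integral_scaled_normal_exp order_refl)
  show "(\<integral>\<^sup>+x. ennreal (exp (- r * x)) \<partial>scaled_normal s) \<le> ennreal (exp (r\<^sup>2 * s\<^sup>2 / 2))"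
    by (simp only: nn_integral_scaled_normal_exp power2_minus order_refl)
qed simp

lemma nn_integral_quantile:
  assumes D: "real_distribution D" and [measurable]: "f \<in> borel_measurable borel"
  shows "(\<integral>\<^sup>+\<omega>. f (quantile D \<omega>) \<partial>unit_interval) = (\<integral>\<^sup>+x. f x \<partial>D)"
proof -
  note [measurable] = measurable_quantile[OF D]
  have "(\<integral>\<^sup>+x. f x \<partial>D) = (\<integral>\<^sup>+x. f x \<partial>distr unit_interval borel (quantile D))"
    by (simp only: distr_quantile[OF D])
  also have "\<dots> = (\<integral>\<^sup>+\<omega>. f (quantile D \<omega>) \<partial>unit_interval)" by (rule nn_integral_distr) auto
  finally show ?thesis by simp
qed

text \<open>Decouples the two quantiles, so that only the exponential moments of the marginals are
  needed.\<close>

lemma exp_add_le: "exp (p + q) \<le> (exp (2 * p) + exp (2 * q)) / 2" for p q :: real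
  using sum_squares_bound[of "exp p" "exp q"] by (simp add: exp_add exp_double mult.assoc)

lemma ennreal_mult_add:
  "0 \<le> k \<Longrightarrow> 0 \<le> p \<Longrightarrow> 0 \<le> q \<Longrightarrow> ennreal k * (ennreal p + ennreal q) = ennreal (k * (p + q))"
  by (subst ennreal_mult) (auto intro: add_nonneg_nonneg)

text \<open>The factor 200 is large enough for three purposes: \<open>b\<close> times the constant
  of the quantile bound is at most 1/4, the moments are bounded for v < 16 C^2, and for larger
  \<open>v\<close> they grow more slowly than the far event decays. The bound 6 is 2 e rounded up in
  the first case and 4 + 2 in the second, for the near and the far event.\<close>

lemma quantile_coupling_exp_moment:
  fixes F :: "real measure" and v :: real
  defines "N \<equiv> scaled_normal (sqrt v)"
  assumes F: "F \<in> class_A1 (1 / 8)" and mean: "prob_space.expectation F (\<lambda>x. x) = 0"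
    and v: "v = prob_space.variance F (\<lambda>x. x)"
  shows "(\<integral>\<^sup>+\<omega>. ennreal (exp (\<bar>quantile F \<omega> - quantile N \<omega>\<bar> / (200 * sandwich_const))) \<partial>unit_interval) \<le> 6"
proof -
  let ?C = sandwich_const
  define b where "b = 1 / (200 * ?C)"
  have C: "?C \<ge> 32" by (rule sandwich_const_ge)
  have b: "0 < b" "b \<le> 1 / 4" using C by (simp_all add: b_def field_simps)
  have rd: "real_distribution F" using F by (simp add: class_A1_def)
  have N: "real_distribution N" unfolding N_def by (rule real_distribution_scaled_normal)
  note [measurable] = measurable_quantile[OF rd] measurable_quantile[OF N]
  have v0: "v \<ge> 0" by (simp add: v)
  let ?X = "quantile F" and ?Y = "quantile N"
  have X: "(\<integral>\<^sup>+\<omega>. ennreal (exp (2 * (b * \<bar>?X \<omega>\<bar>))) \<partial>unit_interval) \<le> ennreal (2 * exp (v * (2 * b)\<^sup>2))"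
    using class_A1_exp_abs_le[OF F mean v, of "2 * b"] b
    by (subst nn_integral_quantile[OF rd, of "\<lambda>x. ennreal (exp (2 * (b * \<bar>x\<bar>)))"]) (auto simp: mult.assoc)
  have Y: "(\<integral>\<^sup>+\<omega>. ennreal (exp (2 * (r * \<bar>?Y \<omega>\<bar>))) \<partial>unit_interval) \<le> ennreal (2 * exp (2 * r\<^sup>2 * v))" for r
    using scaled_normal_exp_abs_le[where r = "2 * r" and s = "sqrt v"] v0
    by (subst nn_integral_quantile[OF N, of "\<lambda>x. ennreal (exp (2 * (r * \<bar>x\<bar>)))"])
       (auto simp: mult.assoc N_def power_mult_distrib mult.commute[of v])
  have XY: "(\<integral>\<^sup>+\<omega>. ennreal (k / 2) * (ennreal (exp (2 * (b * \<bar>?X \<omega>\<bar>))) + ennreal (exp (2 * (r * \<bar>?Y \<omega>\<bar>)))) \<partial>unit_interval)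
      \<le> ennreal (k * (exp (v * (2 * b)\<^sup>2) + exp (2 * r\<^sup>2 * v)))" if k: "k \<ge> 0" for k r
  proof -
    have "(\<integral>\<^sup>+\<omega>. ennreal (k / 2) * (ennreal (exp (2 * (b * \<bar>?X \<omega>\<bar>))) + ennreal (exp (2 * (r * \<bar>?Y \<omega>\<bar>)))) \<partial>unit_interval)
      = ennreal (k / 2) * ((\<integral>\<^sup>+\<omega>. ennreal (exp (2 * (b * \<bar>?X \<omega>\<bar>))) \<partial>unit_interval) +
          (\<integral>\<^sup>+\<omega>. ennreal (exp (2 * (r * \<bar>?Y \<omega>\<bar>))) \<partial>unit_interval))"
      by (subst nn_integral_cmult, simp, subst nn_integral_add) auto
    also have "\<dots> \<le> ennreal (k / 2) * (ennreal (2 * exp (v * (2 * b)\<^sup>2)) + ennreal (2 * exp (2 * r\<^sup>2 * v)))"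
      by (intro mult_left_mono add_mono X Y) auto
    also have "\<dots> = ennreal (k / 2 * (2 * exp (v * (2 * b)\<^sup>2) + 2 * exp (2 * r\<^sup>2 * v)))"
      using k by (intro ennreal_mult_add) auto
    also have "k / 2 * (2 * exp (v * (2 * b)\<^sup>2) + 2 * exp (2 * r\<^sup>2 * v)) = k * (exp (v * (2 * b)\<^sup>2) + exp (2 * r\<^sup>2 * v))"
      by (simp add: algebra_simps)
    finally show ?thesis .
  qed
  have tri: "\<bar>x - y\<bar> * b \<le> b * \<bar>x\<bar> + b * \<bar>y\<bar>" for x y
  proof -
    have "\<bar>x - y\<bar> * b \<le> (\<bar>x\<bar> + \<bar>y\<bar>) * b" using b by (intro mult_right_mono) auto
    then show ?thesis by (simp add: algebra_simps)
  qed
  have b2: "b\<^sup>2 = 1 / (40000 * ?C\<^sup>2)" by (simp add: b_def power_mult_distrib power_divide)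
  have Cp: "?C\<^sup>2 > 0" using C by simp
  have "(\<integral>\<^sup>+\<omega>. ennreal (exp (\<bar>?X \<omega> - ?Y \<omega>\<bar> * b)) \<partial>unit_interval) \<le> 6"
  \<comment> \<open>For small \<open>v\<close> the quantiles need not be close; v b^2 \<le> 1/4
    keeps each exponential moment below e.\<close>
  proof (cases "v \<ge> 16 * ?C\<^sup>2")
    case False
    have "(\<integral>\<^sup>+\<omega>. ennreal (exp (\<bar>?X \<omega> - ?Y \<omega>\<bar> * b)) \<partial>unit_interval) \<le>
      (\<integral>\<^sup>+\<omega>. ennreal (1 / 2) * (ennreal (exp (2 * (b * \<bar>?X \<omega>\<bar>))) + ennreal (exp (2 * (b * \<bar>?Y \<omega>\<bar>)))) \<partial>unit_interval)"
    proof (rule nn_integral_mono)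
      fix \<omega>
      have "exp (\<bar>?X \<omega> - ?Y \<omega>\<bar> * b) \<le> exp (b * \<bar>?X \<omega>\<bar> + b * \<bar>?Y \<omega>\<bar>)" using tri by simp
      also have "\<dots> \<le> 1 / 2 * (exp (2 * (b * \<bar>?X \<omega>\<bar>)) + exp (2 * (b * \<bar>?Y \<omega>\<bar>)))"
        using exp_add_le[of "b * \<bar>?X \<omega>\<bar>" "b * \<bar>?Y \<omega>\<bar>"] by simp
      finally show "ennreal (exp (\<bar>?X \<omega> - ?Y \<omega>\<bar> * b)) \<le>
          ennreal (1 / 2) * (ennreal (exp (2 * (b * \<bar>?X \<omega>\<bar>))) + ennreal (exp (2 * (b * \<bar>?Y \<omega>\<bar>))))"
        by (subst ennreal_mult_add) (auto intro: ennreal_leI)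
    qed
    also have "\<dots> \<le> ennreal (1 * (exp (v * (2 * b)\<^sup>2) + exp (2 * b\<^sup>2 * v)))"
      by (rule XY) simp
    also have "\<dots> \<le> 6"
    proof -
      have "v * b\<^sup>2 \<le> (16 * ?C\<^sup>2) * b\<^sup>2" using False by (intro mult_right_mono) auto
      also have "\<dots> \<le> 1 / 4" using Cp unfolding b2 by (simp add: field_simps)
      finally have vb: "v * b\<^sup>2 \<le> 1 / 4" .
      have "exp (v * (2 * b)\<^sup>2) \<le> exp 1" "exp (2 * b\<^sup>2 * v) \<le> exp 1"
        using vb v0 by (simp_all add: power_mult_distrib mult.commute)
      then have "1 * (exp (v * (2 * b)\<^sup>2) + exp (2 * b\<^sup>2 * v)) \<le> 6"
        unfolding mult_1 using exp_le by linarith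
      then show ?thesis by (metis ennreal_leI ennreal_numeral zero_le_numeral)
    qed
    finally show ?thesis .
  next
    case True
    \<comment> \<open>Exponent of a Chernoff bound for the far event |Y| > z. It gives \<alpha> z =
      v / (1024 C^2), which exceeds both moment exponents 4 b^2 v and 2 (b + \<alpha>)^2 v.\<close>
    define \<alpha> where "\<alpha> = 1 / (128 * ?C)"
    define z where "z = v / (8 * ?C)"
    have vp: "v > 0" using True Cp by linarith
    have \<alpha>: "\<alpha> > 0" "b + \<alpha> \<le> 2 * \<alpha>" using C by (simp_all add: \<alpha>_def b_def field_simps)
    have pw: "exp (\<bar>?X \<omega> - ?Y \<omega>\<bar> * b) \<le> 2 * exp ((?Y \<omega>)\<^sup>2 / (4 * v)) +
        exp (- \<alpha> * z) / 2 * (exp (2 * (b * \<bar>?X \<omega>\<bar>)) + exp (2 * ((b + \<alpha>) * \<bar>?Y \<omega>\<bar>)))"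
      if \<omega>: "0 < \<omega>" "\<omega> < 1" for \<omega>
    proof (cases "\<bar>?Y \<omega>\<bar> \<le> z")
      case True
      have "\<bar>?X \<omega> - ?Y \<omega>\<bar> \<le> (4 * ?C + 64) * (1 + (?Y \<omega>)\<^sup>2 / v)"
        using class_A1_quantile_close[OF F mean v _ \<omega>] \<open>v \<ge> 16 * ?C\<^sup>2\<close> True unfolding N_def z_def by blast
      then have "\<bar>?X \<omega> - ?Y \<omega>\<bar> * b \<le> ((4 * ?C + 64) * (1 + (?Y \<omega>)\<^sup>2 / v)) * b"
        using b by (intro mult_right_mono) auto
      also have "\<dots> = ((4 * ?C + 64) * b) * (1 + (?Y \<omega>)\<^sup>2 / v)" by (simp only: mult_ac)
      \<comment> \<open>The coefficient 1/4 of Y^2 / v matches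
        \<open>nn_integral_scaled_normal_exp_square\<close>.\<close>
      also have "\<dots> \<le> 1 / 4 * (1 + (?Y \<omega>)\<^sup>2 / v)"
      proof (rule mult_right_mono)
        show "(4 * ?C + 64) * b \<le> 1 / 4" using C by (simp add: b_def field_simps)
      qed (use vp in simp)
      finally have "exp (\<bar>?X \<omega> - ?Y \<omega>\<bar> * b) \<le> exp (1 / 4 + (?Y \<omega>)\<^sup>2 / (4 * v))" by simp
      also have "\<dots> \<le> 2 * exp ((?Y \<omega>)\<^sup>2 / (4 * v))"
      proof -
        have "exp (1 / 4 :: real) \<le> 2" using exp_bound_half[of "1 / 4 :: real"] by simp
        then show ?thesis unfolding exp_add by (intro mult_right_mono) auto
      qed
      finally show ?thesis by (rule order_trans) (auto intro!: add_increasing2 mult_nonneg_nonneg add_nonneg_nonneg)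
    next
      case False
      have "\<alpha> * z \<le> \<alpha> * \<bar>?Y \<omega>\<bar>" using False \<alpha> by (intro mult_left_mono) auto
      then have "\<bar>?X \<omega> - ?Y \<omega>\<bar> * b \<le> - \<alpha> * z + (b * \<bar>?X \<omega>\<bar> + (b + \<alpha>) * \<bar>?Y \<omega>\<bar>)"
        using tri[of "?X \<omega>" "?Y \<omega>"] by (simp add: distrib_right)
      then have "exp (\<bar>?X \<omega> - ?Y \<omega>\<bar> * b) \<le> exp (- \<alpha> * z) * exp (b * \<bar>?X \<omega>\<bar> + (b + \<alpha>) * \<bar>?Y \<omega>\<bar>)"
        by (simp flip: exp_add)
      also have "\<dots> \<le> exp (- \<alpha> * z) * ((exp (2 * (b * \<bar>?X \<omega>\<bar>)) + exp (2 * ((b + \<alpha>) * \<bar>?Y \<omega>\<bar>))) / 2)"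
        by (intro mult_left_mono exp_add_le) simp
      finally show ?thesis by (rule order_trans) (simp add: add_increasing)
    qed
    have "(\<integral>\<^sup>+\<omega>. ennreal (exp (\<bar>?X \<omega> - ?Y \<omega>\<bar> * b)) \<partial>unit_interval) \<le>
      (\<integral>\<^sup>+\<omega>. ennreal 2 * ennreal (exp ((?Y \<omega>)\<^sup>2 / (4 * v))) +
        ennreal (exp (- \<alpha> * z) / 2) * (ennreal (exp (2 * (b * \<bar>?X \<omega>\<bar>))) + ennreal (exp (2 * ((b + \<alpha>) * \<bar>?Y \<omega>\<bar>)))) \<partial>unit_interval)"
    proof (rule nn_integral_mono)
      fix \<omega> assume "\<omega> \<in> space unit_interval"
      then have \<omega>: "0 < \<omega>" "\<omega> < 1" by (auto simp: space_restrict_space)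
      have "ennreal (exp (\<bar>?X \<omega> - ?Y \<omega>\<bar> * b)) \<le> ennreal (2 * exp ((?Y \<omega>)\<^sup>2 / (4 * v)) +
        exp (- \<alpha> * z) / 2 * (exp (2 * (b * \<bar>?X \<omega>\<bar>)) + exp (2 * ((b + \<alpha>) * \<bar>?Y \<omega>\<bar>))))"
        by (intro ennreal_leI pw \<omega>)
      also have "\<dots> = ennreal (2 * exp ((?Y \<omega>)\<^sup>2 / (4 * v))) +
          ennreal (exp (- \<alpha> * z) / 2 * (exp (2 * (b * \<bar>?X \<omega>\<bar>)) + exp (2 * ((b + \<alpha>) * \<bar>?Y \<omega>\<bar>))))"
        by (rule ennreal_plus) (auto intro!: mult_nonneg_nonneg add_nonneg_nonneg)
      also have "\<dots> = ennreal 2 * ennreal (exp ((?Y \<omega>)\<^sup>2 / (4 * v))) +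
        ennreal (exp (- \<alpha> * z) / 2) * (ennreal (exp (2 * (b * \<bar>?X \<omega>\<bar>))) + ennreal (exp (2 * ((b + \<alpha>) * \<bar>?Y \<omega>\<bar>))))"
        by (intro arg_cong2[where f = "(+)"] ennreal_mult ennreal_mult_add[symmetric]) auto
      finally show "ennreal (exp (\<bar>?X \<omega> - ?Y \<omega>\<bar> * b)) \<le> ennreal 2 * ennreal (exp ((?Y \<omega>)\<^sup>2 / (4 * v))) +
        ennreal (exp (- \<alpha> * z) / 2) * (ennreal (exp (2 * (b * \<bar>?X \<omega>\<bar>))) + ennreal (exp (2 * ((b + \<alpha>) * \<bar>?Y \<omega>\<bar>))))" .
    qed
    also have "\<dots> = ennreal 2 * (\<integral>\<^sup>+\<omega>. ennreal (exp ((?Y \<omega>)\<^sup>2 / (4 * v))) \<partial>unit_interval) +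
        (\<integral>\<^sup>+\<omega>. ennreal (exp (- \<alpha> * z) / 2) * (ennreal (exp (2 * (b * \<bar>?X \<omega>\<bar>))) + ennreal (exp (2 * ((b + \<alpha>) * \<bar>?Y \<omega>\<bar>)))) \<partial>unit_interval)"
      by (subst nn_integral_add, simp, simp, subst nn_integral_cmult) auto
    also have "\<dots> \<le> ennreal 4 + ennreal 2"
    proof (rule add_mono)
      have "(\<integral>\<^sup>+\<omega>. ennreal (exp ((?Y \<omega>)\<^sup>2 / (4 * v))) \<partial>unit_interval) = (\<integral>\<^sup>+x. ennreal (exp (x\<^sup>2 / (4 * v))) \<partial>N)"
        by (rule nn_integral_quantile[OF N]) simp
      also have "\<dots> = ennreal (sqrt 2)"
        using nn_integral_scaled_normal_exp_square[of "sqrt v"] vp by (simp add: N_def)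
      also have "\<dots> \<le> ennreal 2" by (rule ennreal_leI) (simp add: real_le_lsqrt)
      finally have "ennreal 2 * (\<integral>\<^sup>+\<omega>. ennreal (exp ((?Y \<omega>)\<^sup>2 / (4 * v))) \<partial>unit_interval) \<le> ennreal 2 * ennreal 2"
        by (rule mult_left_mono) simp
      then show "ennreal 2 * (\<integral>\<^sup>+\<omega>. ennreal (exp ((?Y \<omega>)\<^sup>2 / (4 * v))) \<partial>unit_interval) \<le> ennreal 4"
        by (simp flip: ennreal_mult)
      have "(\<integral>\<^sup>+\<omega>. ennreal (exp (- \<alpha> * z) / 2) * (ennreal (exp (2 * (b * \<bar>?X \<omega>\<bar>))) + ennreal (exp (2 * ((b + \<alpha>) * \<bar>?Y \<omega>\<bar>)))) \<partial>unit_interval)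
        \<le> ennreal (exp (- \<alpha> * z) * (exp (v * (2 * b)\<^sup>2) + exp (2 * (b + \<alpha>)\<^sup>2 * v)))"
        by (rule XY) simp
      also have "\<dots> \<le> ennreal 2"
      proof (rule ennreal_leI)
        have az: "\<alpha> * z = v * (1 / (1024 * ?C\<^sup>2))" by (simp add: \<alpha>_def z_def power2_eq_square)
        have "v * (2 * b)\<^sup>2 = v * (1 / (10000 * ?C\<^sup>2))" by (simp add: power_mult_distrib b2)
        also have "\<dots> \<le> v * (1 / (1024 * ?C\<^sup>2))"
          using vp Cp by (intro mult_left_mono divide_left_mono) auto
        finally have 1: "exp (- \<alpha> * z) * exp (v * (2 * b)\<^sup>2) \<le> 1" using az by (simp flip: exp_add)
        have "(b + \<alpha>)\<^sup>2 \<le> (2 * \<alpha>)\<^sup>2" using \<alpha> b by (intro power_mono) auto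
        also have "\<dots> = 1 / (4096 * ?C\<^sup>2)" by (simp add: \<alpha>_def power_mult_distrib power_divide)
        finally have "2 * (b + \<alpha>)\<^sup>2 * v \<le> 2 * (1 / (4096 * ?C\<^sup>2)) * v"
          using vp by (intro mult_right_mono mult_left_mono) auto
        also have "\<dots> \<le> v * (1 / (1024 * ?C\<^sup>2))"
          using vp Cp by (simp add: field_simps)
        finally have 2: "exp (- \<alpha> * z) * exp (2 * (b + \<alpha>)\<^sup>2 * v) \<le> 1" using az by (simp flip: exp_add)
        show "exp (- \<alpha> * z) * (exp (v * (2 * b)\<^sup>2) + exp (2 * (b + \<alpha>)\<^sup>2 * v)) \<le> 2"
          unfolding distrib_left using 1 2 by linarith
      qed
      finally show "(\<integral>\<^sup>+\<omega>. ennreal (exp (- \<alpha> * z) / 2) * (ennreal (exp (2 * (b * \<bar>?X \<omega>\<bar>))) + ennreal (exp (2 * ((b + \<alpha>) * \<bar>?Y \<omega>\<bar>)))) \<partial>unit_interval) \<le> ennreal 2" .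
    qed
    also have "\<dots> = 6" by (simp flip: ennreal_plus)
    finally show ?thesis .
  qed
  then show ?thesis by (simp add: b_def)
qed

text \<open>By Bernoulli, enlarging the scale by 5 divides the integral of \<psi> by 5; the moment
  bound 6 means that this integral is at most 5.\<close>

lemma exp_div_5_le: "exp (u / 5) - 1 \<le> (exp u - 1) / 5" if "u \<ge> 0" for u :: real
proof -
  have "1 + real 5 * (exp (u / 5) - 1) \<le> (1 + (exp (u / 5) - 1)) ^ 5"
    by (rule Bernoulli_inequality) (simp add: order_trans[of _ 0])
  then show ?thesis by (simp flip: exp_of_nat_mult)
qed

text \<open>The factor 1 / (8 \<tau>) normalises the class parameter to 1/8, and the quantile
  coupling is scaled back by 8 \<tau>. The degenerate case is included, since
  \<open>scaled_normal\<close> and \<open>quantile\<close> cover variance 0.\<close>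

lemma class_A1_wasserstein_le:
  fixes \<tau> :: real and F :: "real measure"
  assumes \<tau>: "\<tau> > 0" and F: "F \<in> class_A1 \<tau>" and mean: "prob_space.expectation F (\<lambda>x. x) = 0"
  shows "wasserstein_orlicz (\<lambda>x. exp \<bar>x\<bar> - 1) F
         (normal_distribution 0 (prob_space.variance F (\<lambda>x. x)))
       \<le> ennreal (8000 * sandwich_const * \<tau>)"
proof -
  let ?C = sandwich_const
  have c: "8000 * ?C > 0" using sandwich_const_ge by simp
  have rd: "real_distribution F" using F by (simp add: class_A1_def)
  interpret F: real_distribution F by (rule rd)
  let ?\<sigma> = "F.variance (\<lambda>x. x)" and ?c = "1 / (8 * \<tau>)"
  define G where "G = distr F borel (\<lambda>x. ?c * x)"
  define v where "v = prob_space.variance G (\<lambda>x. x)"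
  let ?N = "scaled_normal (sqrt v)"
  have G: "G \<in> class_A1 (1 / 8)" using class_A1_scale[OF F, of ?c] \<tau> by (simp add: G_def)
  have Gm: "prob_space.expectation G (\<lambda>x. x) = 0" and v: "v = ?c\<^sup>2 * ?\<sigma>"
    using prob_space_scale_variance[OF rd, of ?c] mean by (simp_all only: v_def G_def mult_zero_right)
  have Grd: "real_distribution G" using G by (simp add: class_A1_def)
  note Nrd = real_distribution_scaled_normal[of "sqrt v"]
  let ?X = "\<lambda>\<omega>. 8 * \<tau> * quantile G \<omega>" and ?Y = "\<lambda>\<omega>. 8 * \<tau> * quantile ?N \<omega>"
  note [measurable] = measurable_quantile[OF Grd] measurable_quantile[OF Nrd]
  interpret U: prob_space unit_interval by (rule prob_space_unit_interval)
  let ?\<pi> = "distr unit_interval (borel \<Otimes>\<^sub>M borel) (\<lambda>\<omega>. (?X \<omega>, ?Y \<omega>))"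
  have FX: "distr unit_interval borel ?X = F"
  proof -
    have "distr unit_interval borel ?X = distr (distr unit_interval borel (quantile G)) borel (\<lambda>x. 8 * \<tau> * x)"
      by (subst distr_distr) (auto simp: o_def)
    also have "\<dots> = distr F borel (\<lambda>x. x)"
      unfolding distr_quantile[OF Grd] unfolding G_def using \<tau> by (subst distr_distr) (auto simp: o_def)
    also have "\<dots> = F" by (rule distr_id2) simp
    finally show ?thesis .
  qed
  have NY: "distr unit_interval borel ?Y = normal_distribution 0 ?\<sigma>"
  proof -
    have "distr unit_interval borel ?Y = distr (distr unit_interval borel (quantile ?N)) borel (\<lambda>x. 8 * \<tau> * x)"
      by (subst distr_distr) (auto simp: o_def)
    also have "\<dots> = scaled_normal (8 * \<tau> * sqrt v)"
      unfolding distr_quantile[OF Nrd] by (rule scaled_normal_mult)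
    also have "8 * \<tau> * sqrt v = sqrt ?\<sigma>" using \<tau> by (simp add: v real_sqrt_mult real_sqrt_divide)
    also have "scaled_normal (sqrt ?\<sigma>) = normal_distribution 0 ?\<sigma>"
      by (rule normal_distribution_eq_scaled[symmetric]) simp
    finally show ?thesis .
  qed
  have cp: "?\<pi> \<in> couplings F (normal_distribution 0 ?\<sigma>)"
  proof -
    have mp: "(\<lambda>\<omega>. (?X \<omega>, ?Y \<omega>)) \<in> unit_interval \<rightarrow>\<^sub>M borel \<Otimes>\<^sub>M borel" by measurable
    have "distr ?\<pi> borel fst = F" "distr ?\<pi> borel snd = normal_distribution 0 ?\<sigma>"
      using FX NY by (simp_all only: distr_distr[OF measurable_fst mp] distr_distr[OF measurable_snd mp] o_def fst_conv snd_conv)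
    with U.prob_space_distr[OF mp] show ?thesis unfolding couplings_def by simp
  qed
  \<comment> \<open>8000 = 8 * 200 * 5: the normalisation of \<tau>, the scale of the moment bound
    and the Bernoulli factor.\<close>
  define a where "a = 8000 * ?C * \<tau>"
  have a: "a > 0" using c \<tau> by (simp add: a_def)
  let ?D = "\<lambda>\<omega>. \<bar>quantile G \<omega> - quantile ?N \<omega>\<bar> / (200 * ?C)"
  have D0: "?D \<omega> \<ge> 0" for \<omega> using sandwich_const_ge by simp
  have "(\<integral>\<^sup>+(x, y). ennreal (exp \<bar>\<bar>x - y\<bar> / a\<bar> - 1) \<partial>?\<pi>) =
      (\<integral>\<^sup>+\<omega>. ennreal (exp \<bar>\<bar>?X \<omega> - ?Y \<omega>\<bar> / a\<bar> - 1) \<partial>unit_interval)"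
    by (subst nn_integral_distr) (auto simp: case_prod_beta')
  also have "\<dots> \<le> (\<integral>\<^sup>+\<omega>. ennreal (1 / 5) * ennreal (exp (?D \<omega>) - 1) \<partial>unit_interval)"
  proof (rule nn_integral_mono)
    fix \<omega>
    have "\<bar>\<bar>?X \<omega> - ?Y \<omega>\<bar> / a\<bar> = ?D \<omega> / 5"
    proof -
      have "\<bar>?X \<omega> - ?Y \<omega>\<bar> = 8 * \<tau> * \<bar>quantile G \<omega> - quantile ?N \<omega>\<bar>"
        using \<tau> by (simp add: abs_mult flip: right_diff_distrib)
      then show ?thesis using a \<tau> sandwich_const_ge by (simp add: a_def)
    qed
    then have "exp \<bar>\<bar>?X \<omega> - ?Y \<omega>\<bar> / a\<bar> - 1 \<le> 1 / 5 * (exp (?D \<omega>) - 1)"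
      using exp_div_5_le[OF D0[of \<omega>]] by simp
    then have "ennreal (exp \<bar>\<bar>?X \<omega> - ?Y \<omega>\<bar> / a\<bar> - 1) \<le> ennreal (1 / 5 * (exp (?D \<omega>) - 1))"
      by (rule ennreal_leI)
    also have "\<dots> = ennreal (1 / 5) * ennreal (exp (?D \<omega>) - 1)"
      using D0[of \<omega>] by (intro ennreal_mult) auto
    finally show "ennreal (exp \<bar>\<bar>?X \<omega> - ?Y \<omega>\<bar> / a\<bar> - 1) \<le> ennreal (1 / 5) * ennreal (exp (?D \<omega>) - 1)" .
  qed
  also have "\<dots> = ennreal (1 / 5) * (\<integral>\<^sup>+\<omega>. ennreal (exp (?D \<omega>) - 1) \<partial>unit_interval)"
    by (rule nn_integral_cmult) simp
  also have "\<dots> \<le> ennreal (1 / 5) * 5"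
  proof (rule mult_left_mono)
    have "(\<integral>\<^sup>+\<omega>. ennreal (exp (?D \<omega>) - 1) \<partial>unit_interval) + 1 =
        (\<integral>\<^sup>+\<omega>. ennreal (exp (?D \<omega>) - 1) + 1 \<partial>unit_interval)"
      by (subst nn_integral_add, measurable) (simp only: nn_integral_const U.emeasure_space_1 mult_1)
    also have "\<dots> = (\<integral>\<^sup>+\<omega>. ennreal (exp (?D \<omega>)) \<partial>unit_interval)"
    proof (rule nn_integral_cong)
      fix \<omega>
      have "ennreal (exp (?D \<omega>) - 1) + ennreal 1 = ennreal (exp (?D \<omega>))"
        using D0[of \<omega>] by (subst ennreal_plus[symmetric]) auto
      then show "ennreal (exp (?D \<omega>) - 1) + 1 = ennreal (exp (?D \<omega>))" by simp
    qed
    also have "\<dots> \<le> 5 + 1"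
      using quantile_coupling_exp_moment[OF G Gm v_def] by simp
    finally show "(\<integral>\<^sup>+\<omega>. ennreal (exp (?D \<omega>) - 1) \<partial>unit_interval) \<le> 5"
      by (subst (asm) ennreal_add_left_cancel_le[of 1, unfolded add.commute[of 1]]) auto
  qed simp
  also have "ennreal (1 / 5) * 5 = 1"
    by (simp flip: ennreal_numeral ennreal_mult)
  finally have "(INF \<pi>\<in>couplings F (normal_distribution 0 ?\<sigma>).
      \<integral>\<^sup>+(x, y). ennreal (exp \<bar>\<bar>x - y\<bar> / a\<bar> - 1) \<partial>\<pi>) \<le> 1"
    by (rule INF_lower2[OF cp])
  then have "wasserstein_orlicz (\<lambda>x. exp \<bar>x\<bar> - 1) F (normal_distribution 0 ?\<sigma>) \<le> ennreal a"
    unfolding wasserstein_orlicz_def using a by (intro Inf_lower imageI) auto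
  then show "wasserstein_orlicz (\<lambda>x. exp \<bar>x\<bar> - 1) F (normal_distribution 0 ?\<sigma>) \<le> ennreal (8000 * ?C * \<tau>)"
    by (simp add: a_def)
qed

theorem theorem2:
  shows "\<exists>c2::real. c2 > 0 \<and>
    (\<forall>(\<tau>::real) (F::real measure).
       \<tau> > 0 \<longrightarrow> F \<in> class_A1 \<tau> \<longrightarrow> prob_space.expectation F (\<lambda>x. x) = 0 \<longrightarrow>
       wasserstein_orlicz (\<lambda>x. exp \<bar>x\<bar> - 1) F
         (normal_distribution 0 (prob_space.variance F (\<lambda>x. x)))
       \<le> ennreal (c2 * \<tau>))"
proof (intro exI[of _ "8000 * sandwich_const"] conjI allI impI)
  show "8000 * sandwich_const > 0" using sandwich_const_ge by simp
qed (rule class_A1_wasserstein_le)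

end
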